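(* Let $\mathbf k$ be an integral domain, let $\kappa\in\mathbb Z$ and let $\lambda$ be a partition of $n$ with $\beta=\mathrm{cont}(\lambda)$. In type $C_\infty$, the set $\{\psi_{w^{\mathsf t}}\overline m^{\lambda}\mid \mathsf t\in\mathrm{Std}(\lambda)\}$ is a $\mathbf k$-basis of the Specht module $S^\lambda_\kappa$. Moreover (for $\mathbf k$ a field) \[ \mathrm{ch}_q S^{\lambda}_\kappa=\sum_{\mathsf t\in \mathrm{Std}(\lambda)} q^{\deg(\mathsf t)}\,\mathrm{res}(\mathsf t). \]
   Context: Type $C_\infty$: $I=\mathbb Z_{\ge0}$, Cartan matrix $a_{ii}=2$, $a_{10}=-2$, $a_{ij}=-1$ if $|i-j|=1$ and $(i,j)\ne(1,0)$, $a_{ij}=0$ otherwise; $d_0=2$, $d_i=1$ ($i\ge1$); simple roots $\alpha_i$ with $(\alpha_i,\alpha_j)=d_ia_{ij}$; $Q^+=\bigoplus_i\mathbb Z_{\ge0}\alpha_i$. Polynomials $Q_{ii}=0$, $Q_{ij}(u,v)=Q_{ji}(v,u)$, and for $i<j$: $Q_{01}=u+v^2$, $Q_{i,i+1}=u+v$ ($i\ge1$), $Q_{ij}=1$ otherwise. The quiver Hecke algebra $R(n)$ over a commutative ring $\mathbf k$ is the graded algebra generated by $e(\nu)$ ($\nu\in I^n$), $x_1,\dots,x_n$, $\psi_1,\dots,\psi_{n-1}$ with relations $e(\nu)e(\nu')=\delta_{\nu\nu'}e(\nu)$, $\sum_\nu e(\nu)=1$, $x_re(\nu)=e(\nu)x_r$,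 $\psi_re(\nu)=e(s_r\nu)\psi_r$ ($s_r\nu$ swaps entries $r,r+1$), $x_rx_s=x_sx_r$, $\psi_rx_s=x_s\psi_r$ ($s\ne r,r+1$), $\psi_r\psi_s=\psi_s\psi_r$ ($|r-s|>1$), $x_r\psi_re(\nu)=(\psi_rx_{r+1}-\delta_{\nu_r\nu_{r+1}})e(\nu)$, $x_{r+1}\psi_re(\nu)=(\psi_rx_r+\delta_{\nu_r\nu_{r+1}})e(\nu)$, $\psi_r^2e(\nu)=Q_{\nu_r\nu_{r+1}}(x_r,x_{r+1})e(\nu)$, and $(\psi_{r+1}\psi_r\psi_{r+1}-\psi_r\psi_{r+1}\psi_r)e(\nu)$ equals $\frac{Q_{\nu_r\nu_{r+1}}(x_r,x_{r+1})-Q_{\nu_r\nu_{r+1}}(x_{r+2},x_{r+1})}{x_r-x_{r+2}}e(\nu)$ if $\nu_r=\nu_{r+2}$ and $0$ otherwise; grading $\deg e(\nu)=0$, $\deg x_re(\nu)=(\alpha_{\nu_r},\alpha_{\nu_r})$, $\deg\psi_se(\nu)=-(\alpha_{\nu_s},\alpha_{\nu_{s+1}})$. For $\beta\in Q^+$ of height $n$, $R(\beta)=R(n)e(\beta)$, $e(\beta)=\sum_{\nu\in I^\beta}e(\nu)$, $I^\beta=\{\nu\in I^n:\sum_k\alpha_{\nu_k}=\beta\}$. For $w\in\mathfrak S_n$ with a fixed reduced expression $s_{i_1}\cdots s_{i_t}$, $\psi_w=\psi_{i_1}\cdots\psi_{i_t}$. Convolution: for an $R(\beta)$-module $M$ and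 $R(\beta')$-module $N$, $M\circ N=R(\beta+\beta')e(\beta,\beta')\otimes_{R(\beta)\otimes R(\beta')}(M\otimes N)$, $e(\beta,\beta')=\sum e(\nu*\nu')$ (concatenation). $q$ denotes grading shift, $(qM)_k=M_{k-1}$; $\mathrm{ch}_qM=\sum_\nu\dim_q(e(\nu)M)\,\nu$. Combinatorics: residues $\overline k=|k|$ for $k\in\mathbb Z$. For a partition $\lambda=(\lambda_1,\dots,\lambda_s)$ with charge $\kappa$, node $(r,c)$ has residue $\overline{\kappa+c-r}$, $\mathrm{cont}(\lambda)=\sum_{A}\alpha_{\mathrm{res}A}$. A $\lambda$-tableau is a bijection $\mathsf t:[\lambda]\to\{1,\dots,n\}$; row-strict if entries increase along rows, standard if also down columns; $\mathrm{Std}(\lambda)$ standard tableaux. $\mathsf t^\lambda$ fills rows in order; $w^{\mathsf t}\in\mathfrak S_n$ is defined by $w^{\mathsf t}\mathsf t^\lambda=\mathsf t$ ($\mathfrak S_n$ acts on entries); $\mathrm{res}(\mathsf t)=(\mathrm{res}\,\mathsf t^{-1}(1),\dots,\mathrm{res}\,\mathsf t^{-1}(n))$. Node $A'$ is below $A$ if it is in a later row. For an $i$-node $A$, $d_A(\lambda)=d_i(\#\{\text{addable }i\text{-nodes below }A\}-\#\{\text{removable }i\text{-nodes below }A\})$. Degree of a standard tableau: $\deg$ of the empty tableau is 0 and $\deg\mathsf t=\deg(\mathsf t_{\le n-1})+d_A(\lambda)$ with $A=\mathsf t^{-1}(n)$ and $\mathsf t_{\le n-1}$ the restriction to entries $\le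 n-1$ (a tableau of shape $\lambda$ minus $A$). A node $A=(r,c)$ is a Garnir node if $(r+1,c)\in[\lambda]$; its Garnir belt is $\{(r,a):a\ge c\}\cup\{(r+1,a):a\le c\}$; the Garnir tableau $\mathsf g^A$ agrees with $\mathsf t^\lambda$ outside the belt and has the entries $\mathsf t^\lambda(r,c),\dots,\mathsf t^\lambda(r+1,c)$ filling the belt in order, first row $r+1$ left to right, then row $r$ left to right. $w^{\mathsf g^A}$ is fully commutative so $\psi_{w^{\mathsf g^A}}$ is independent of reduced expression. Specht modules: for $k\in\mathbb Z$, $m\ge0$, $L(k;m)=\mathbf k\gamma$ is the one-dimensional graded $R(\sum_{s=k}^{k+m-1}\alpha_{\overline s})$-module with $\deg\gamma=0$, $x_i\gamma=\psi_j\gamma=0$, $e(\nu)\gamma=\delta_{\nu,(\overline k,\overline{k+1},\dots,\overline{k+m-1})}\gamma$. Let $P^\lambda_\kappa=L(\kappa;\lambda_1)\circ L(\kappa-1;\lambda_2)\circ\cdots\circ L(\kappa-s+1;\lambda_s)$ with generator $m^\lambda=1\otimes\gamma\otimes\cdots\otimes\gamma$, $G^\lambda_\kappa$ the $R(\beta)$-submodule generated by $\{\psi_{w^{\mathsf g^A}}m^\lambda: A \text{ Garnir node}\}$, and over a field $S^\lambda_\kappa=q^{\deg\mathsf t^\lambda}P^\lambda_\kappa/G^\lambda_\kappa$, with $\overline m^\lambda$ the image of $m^\lambda$. Over an integral domain $\mathbf k$ with fraction field $F$, $S^\lambda_\kappa(\mathbf k)$ is the $R_{\mathbf k}(\beta)$-submodule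 of $S^\lambda_\kappa(F)$ generated by $\overline m^\lambda$. *)

theory Defs
  imports "HOL-Computational_Algebra.Polynomial_Factorial"
begin

text \<open>Symmetrised Cartan form (alpha_i, alpha_j) = d_i a_ij.\<close>
definition ip :: "nat \<Rightarrow> nat \<Rightarrow> int" where
  "ip i j = (if i = j then (if i = 0 then 4 else 2)
             else if (i = 0 \<and> j = 1) \<or> (i = 1 \<and> j = 0) then -2
             else if i = Suc j \<or> j = Suc i then -1 else 0)"

definition dsym :: "nat \<Rightarrow> int" where
  "dsym i = (if i = 0 then 2 else 1)"

text \<open>Q_ij for i<j as a list of terms (c,a,b) meaning c * u^a * v^b.\<close>
definition Qlt :: "nat \<Rightarrow> nat \<Rightarrow> (int \<times> nat \<times> nat) list" where
  "Qlt i j = (if i = 0 \<and> j = 1 then [(1,1,0),(1,0,2)]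
              else if j = Suc i then [(1,1,0),(1,0,1)] else [(1,0,0)])"

definition Qpoly :: "nat \<Rightarrow> nat \<Rightarrow> (int \<times> nat \<times> nat) list" where
  "Qpoly i j = (if i < j then Qlt i j
                else if j < i then map (\<lambda>(c,a,b). (c,b,a)) (Qlt j i) else [])"

datatype gen = E "nat list" | X nat | Psi nat

text \<open>Elements of the free algebra: functions from words to coefficients
 (finitely supported in all relevant cases). Word u@v is the product u*v.\<close>

definition wd :: "gen list \<Rightarrow> gen list \<Rightarrow> 'k::comm_ring_1" where
  "wd u = (\<lambda>w. if w = u then 1 else 0)"

definition cadd :: "(gen list \<Rightarrow> 'k::comm_ring_1) \<Rightarrow> (gen list \<Rightarrow> 'k) \<Rightarrow> gen list \<Rightarrow> 'k" where
  "cadd f g = (\<lambda>w. f w + g w)"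

definition csub :: "(gen list \<Rightarrow> 'k::comm_ring_1) \<Rightarrow> (gen list \<Rightarrow> 'k) \<Rightarrow> gen list \<Rightarrow> 'k" where
  "csub f g = (\<lambda>w. f w - g w)"

definition csc :: "'k::comm_ring_1 \<Rightarrow> (gen list \<Rightarrow> 'k) \<Rightarrow> gen list \<Rightarrow> 'k" where
  "csc c f = (\<lambda>w. c * f w)"

definition csum :: "'a set \<Rightarrow> ('a \<Rightarrow> gen list \<Rightarrow> 'k::comm_ring_1) \<Rightarrow> gen list \<Rightarrow> 'k" where
  "csum A F = (\<lambda>w. \<Sum>a\<in>A. F a w)"

definition cmul :: "(gen list \<Rightarrow> 'k::comm_ring_1) \<Rightarrow> (gen list \<Rightarrow> 'k) \<Rightarrow> gen list \<Rightarrow> 'k" where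
  "cmul f g = (\<lambda>w. \<Sum>i\<in>{0..length w}. f (take i w) * g (drop i w))"

definition cmap :: "('a \<Rightarrow> 'b) \<Rightarrow> (gen list \<Rightarrow> 'a) \<Rightarrow> gen list \<Rightarrow> 'b" where
  "cmap h f = (\<lambda>w. h (f w))"

text \<open>s_r acting on sequences (positions 1-based): swap entries r, r+1.\<close>
definition sw :: "nat \<Rightarrow> nat list \<Rightarrow> nat list" where
  "sw r \<nu> = (\<nu>[r - 1 := \<nu> ! r])[r := \<nu> ! (r - 1)]"

definition nth1 :: "nat list \<Rightarrow> nat \<Rightarrow> nat" where
  "nth1 \<nu> r = \<nu> ! (r - 1)"

definition valid_gen :: "nat \<Rightarrow> nat list set \<Rightarrow> gen \<Rightarrow> bool" where
  "valid_gen n Ib g = (case g of E \<nu> \<Rightarrow> \<nu> \<in> Ib | X r \<Rightarrow> 1 \<le> r \<and> r \<le> n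
                        | Psi r \<Rightarrow> 1 \<le> r \<and> r < n)"

definition valid_word :: "nat \<Rightarrow> nat list set \<Rightarrow> gen list \<Rightarrow> bool" where
  "valid_word n Ib u = (\<forall>g\<in>set u. valid_gen n Ib g)"

definition fin_valid :: "nat \<Rightarrow> nat list set \<Rightarrow> (gen list \<Rightarrow> 'k::comm_ring_1) \<Rightarrow> bool" where
  "fin_valid n Ib f = (finite {w. f w \<noteq> 0} \<and> (\<forall>w. f w \<noteq> 0 \<longrightarrow> valid_word n Ib w))"

text \<open>Q(x_r, x_s) * tail, and the divided difference
  (Q(x_r,x_s) - Q(x_t,x_s))/(x_r - x_t) * tail.\<close>
definition qeval :: "(int \<times> nat \<times> nat) list \<Rightarrow> nat \<Rightarrow> nat \<Rightarrow> gen list \<Rightarrow> gen list \<Rightarrow> 'k::comm_ring_1" where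
  "qeval p r s tail = (\<lambda>w. sum_list (map (\<lambda>(c,a,b).
      of_int c * wd (replicate a (X r) @ replicate b (X s) @ tail) w) p))"

definition ddeval :: "(int \<times> nat \<times> nat) list \<Rightarrow> nat \<Rightarrow> nat \<Rightarrow> nat \<Rightarrow> gen list \<Rightarrow> gen list \<Rightarrow> 'k::comm_ring_1" where
  "ddeval p r s t tail = (\<lambda>w. sum_list (map (\<lambda>(c,a,b).
      of_int c * (\<Sum>k<a. wd (replicate k (X r) @ replicate (a - 1 - k) (X t)
                               @ replicate b (X s) @ tail) w)) p))"

definition deltal :: "nat list \<Rightarrow> nat list \<Rightarrow> 'k::comm_ring_1" where
  "deltal i j = (if i = j then 1 else 0)"

definition delta :: "nat \<Rightarrow> nat \<Rightarrow> 'k::comm_ring_1" where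
  "delta i j = (if i = j then 1 else 0)"

text \<open>Defining relations of the quiver Hecke algebra R(beta) with n = ht beta and
  I^beta = Ib (each element listed must be zero in R(beta)).\<close>
definition qh_rels :: "nat \<Rightarrow> nat list set \<Rightarrow> (gen list \<Rightarrow> 'k::comm_ring_1) set" where
  "qh_rels n Ib =
     {csub (wd [E \<nu>, E \<nu>']) (csc (deltal \<nu> \<nu>') (wd [E \<nu>])) | \<nu> \<nu>'. \<nu> \<in> Ib \<and> \<nu>' \<in> Ib}
   \<union> {csub (csum Ib (\<lambda>\<nu>. wd [E \<nu>])) (wd [])}
   \<union> {csub (wd [X r, E \<nu>]) (wd [E \<nu>, X r]) | r \<nu>. 1 \<le> r \<and> r \<le> n \<and> \<nu> \<in> Ib}
   \<union> {csub (wd [Psi r, E \<nu>]) (wd [E (sw r \<nu>), Psi r]) | r \<nu>. 1 \<le> r \<and> r < n \<and> \<nu> \<in> Ib}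
   \<union> {csub (wd [X r, X s]) (wd [X s, X r]) | r s. 1 \<le> r \<and> r \<le> n \<and> 1 \<le> s \<and> s \<le> n}
   \<union> {csub (wd [Psi r, X s]) (wd [X s, Psi r]) | r s. 1 \<le> r \<and> r < n \<and> 1 \<le> s \<and> s \<le> n
        \<and> s \<noteq> r \<and> s \<noteq> Suc r}
   \<union> {csub (wd [Psi r, Psi s]) (wd [Psi s, Psi r]) | r s. 1 \<le> r \<and> r < n \<and> 1 \<le> s \<and> s < n
        \<and> (Suc r < s \<or> Suc s < r)}
   \<union> {csub (wd [X r, Psi r, E \<nu>])
          (csub (wd [Psi r, X (Suc r), E \<nu>]) (csc (delta (nth1 \<nu> r) (nth1 \<nu> (Suc r))) (wd [E \<nu>])))
        | r \<nu>. 1 \<le> r \<and> r < n \<and> \<nu> \<in> Ib}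
   \<union> {csub (wd [X (Suc r), Psi r, E \<nu>])
          (cadd (wd [Psi r, X r, E \<nu>]) (csc (delta (nth1 \<nu> r) (nth1 \<nu> (Suc r))) (wd [E \<nu>])))
        | r \<nu>. 1 \<le> r \<and> r < n \<and> \<nu> \<in> Ib}
   \<union> {csub (wd [Psi r, Psi r, E \<nu>]) (qeval (Qpoly (nth1 \<nu> r) (nth1 \<nu> (Suc r))) r (Suc r) [E \<nu>])
        | r \<nu>. 1 \<le> r \<and> r < n \<and> \<nu> \<in> Ib}
   \<union> {csub (csub (wd [Psi (Suc r), Psi r, Psi (Suc r), E \<nu>]) (wd [Psi r, Psi (Suc r), Psi r, E \<nu>]))
          (if nth1 \<nu> r = nth1 \<nu> (Suc (Suc r))
           then ddeval (Qpoly (nth1 \<nu> r) (nth1 \<nu> (Suc r))) r (Suc r) (Suc (Suc r)) [E \<nu>]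
           else (\<lambda>_. 0))
        | r \<nu>. 1 \<le> r \<and> Suc (Suc r) \<le> n \<and> \<nu> \<in> Ib}"

text \<open>The left ideal Rl-two-sided-ideal + (left ideal generated by G) of the free algebra.
  Its image in R(beta) = free/(ideal of Rl) is the left ideal generated by the image of G.\<close>
inductive_set lideal :: "nat \<Rightarrow> nat list set \<Rightarrow> (gen list \<Rightarrow> 'k::comm_ring_1) set
      \<Rightarrow> (gen list \<Rightarrow> 'k) set \<Rightarrow> (gen list \<Rightarrow> 'k) set"
  for n Ib Rl G where
  rel: "r \<in> Rl \<Longrightarrow> fin_valid n Ib a \<Longrightarrow> fin_valid n Ib b \<Longrightarrow> cmul a (cmul r b) \<in> lideal n Ib Rl G"
| gen: "g \<in> G \<Longrightarrow> fin_valid n Ib a \<Longrightarrow> cmul a g \<in> lideal n Ib Rl G"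
| add: "x \<in> lideal n Ib Rl G \<Longrightarrow> y \<in> lideal n Ib Rl G \<Longrightarrow> cadd x y \<in> lideal n Ib Rl G"

text \<open>Right-to-left trace of a word applied to e(nu): resulting idempotent and degree,
  or None if the word times e(nu) is zero for idempotent-mismatch reasons.\<close>
fun wtrace :: "gen list \<Rightarrow> nat list \<Rightarrow> (nat list \<times> int) option" where
  "wtrace [] \<nu> = Some (\<nu>, 0)"
| "wtrace (g # u) \<nu> = (case wtrace u \<nu> of None \<Rightarrow> None
     | Some (\<mu>, d) \<Rightarrow> (case g of
         E \<mu>' \<Rightarrow> if \<mu>' = \<mu> then Some (\<mu>, d) else None
       | X r \<Rightarrow> Some (\<mu>, d + ip (nth1 \<mu> r) (nth1 \<mu> r))
       | Psi r \<Rightarrow> Some (sw r \<mu>, d - ip (nth1 \<mu> r) (nth1 \<mu> (Suc r)))))"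

definition is_partition :: "nat list \<Rightarrow> bool" where
  "is_partition lam = (sorted (rev lam) \<and> (\<forall>x\<in>set lam. 0 < x))"

definition nodes :: "nat list \<Rightarrow> (nat \<times> nat) set" where
  "nodes lam = {(r, c). 1 \<le> r \<and> r \<le> length lam \<and> 1 \<le> c \<and> c \<le> lam ! (r - 1)}"

definition resn :: "int \<Rightarrow> nat \<times> nat \<Rightarrow> nat" where
  "resn \<kappa> A = nat \<bar>\<kappa> + int (snd A) - int (fst A)\<bar>"

definition tlam :: "nat list \<Rightarrow> nat \<times> nat \<Rightarrow> nat" where
  "tlam lam A = (if A \<in> nodes lam then sum_list (take (fst A - 1) lam) + snd A else 0)"

definition is_std :: "nat list \<Rightarrow> (nat \<times> nat \<Rightarrow> nat) \<Rightarrow> bool" where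
  "is_std lam t = (t ` nodes lam = {1..sum_list lam} \<and> inj_on t (nodes lam)
      \<and> (\<forall>A. A \<notin> nodes lam \<longrightarrow> t A = 0)
      \<and> (\<forall>r c. (r, c) \<in> nodes lam \<longrightarrow> (r, Suc c) \<in> nodes lam \<longrightarrow> t (r, c) < t (r, Suc c))
      \<and> (\<forall>r c. (r, c) \<in> nodes lam \<longrightarrow> (Suc r, c) \<in> nodes lam \<longrightarrow> t (r, c) < t (Suc r, c)))"

definition Std :: "nat list \<Rightarrow> (nat \<times> nat \<Rightarrow> nat) set" where
  "Std lam = {t. is_std lam t}"

definition tinv :: "nat list \<Rightarrow> (nat \<times> nat \<Rightarrow> nat) \<Rightarrow> nat \<Rightarrow> nat \<times> nat" where
  "tinv lam t k = (THE A. A \<in> nodes lam \<and> t A = k)"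

definition resseq :: "int \<Rightarrow> nat list \<Rightarrow> (nat \<times> nat \<Rightarrow> nat) \<Rightarrow> nat list" where
  "resseq \<kappa> lam t = map (\<lambda>k. resn \<kappa> (tinv lam t k)) [1..<Suc (sum_list lam)]"

definition is_diag :: "(nat \<times> nat) set \<Rightarrow> bool" where
  "is_diag D = (finite D \<and> (\<forall>(r, c)\<in>D. 1 \<le> r \<and> 1 \<le> c \<and>
      (\<forall>r' c'. 1 \<le> r' \<longrightarrow> r' \<le> r \<longrightarrow> 1 \<le> c' \<longrightarrow> c' \<le> c \<longrightarrow> (r', c') \<in> D)))"

definition addable :: "(nat \<times> nat) set \<Rightarrow> (nat \<times> nat) set" where
  "addable D = {B. B \<notin> D \<and> is_diag (insert B D)}"

definition removable :: "(nat \<times> nat) set \<Rightarrow> (nat \<times> nat) set" where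
  "removable D = {B. B \<in> D \<and> is_diag (D - {B})}"

definition dA :: "int \<Rightarrow> nat \<times> nat \<Rightarrow> (nat \<times> nat) set \<Rightarrow> int" where
  "dA \<kappa> A D = dsym (resn \<kappa> A) *
     (int (card {B \<in> addable D. resn \<kappa> B = resn \<kappa> A \<and> fst A < fst B})
      - int (card {B \<in> removable D. resn \<kappa> B = resn \<kappa> A \<and> fst A < fst B}))"

text \<open>Degree of a standard tableau: the recursion deg t = deg t_{<=n-1} + d_{t^-1(n)}(shape),
  unrolled.\<close>
definition tdeg :: "int \<Rightarrow> nat list \<Rightarrow> (nat \<times> nat \<Rightarrow> nat) \<Rightarrow> int" where
  "tdeg \<kappa> lam t = (\<Sum>k\<in>{1..sum_list lam}.
      dA \<kappa> (tinv lam t k) {A \<in> nodes lam. t A \<le> k})"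

text \<open>Permutation w^t with w^t t^lam = t.\<close>
definition wperm :: "nat list \<Rightarrow> (nat \<times> nat \<Rightarrow> nat) \<Rightarrow> nat \<Rightarrow> nat" where
  "wperm lam t = (\<lambda>k. if 1 \<le> k \<and> k \<le> sum_list lam then t (tinv lam (tlam lam) k) else k)"

definition garnir :: "nat list \<Rightarrow> nat \<times> nat \<Rightarrow> nat \<times> nat \<Rightarrow> nat" where
  "garnir lam A = (\<lambda>B.
     if fst B = Suc (fst A) \<and> 1 \<le> snd B \<and> snd B \<le> snd A then tlam lam A + snd B - 1
     else if fst B = fst A \<and> snd A \<le> snd B \<and> B \<in> nodes lam then tlam lam A + snd B
     else tlam lam B)"

definition garnir_nodes :: "nat list \<Rightarrow> (nat \<times> nat) set" where
  "garnir_nodes lam = {(r, c). (r, c) \<in> nodes lam \<and> (Suc r, c) \<in> nodes lam}"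

definition sref :: "nat \<Rightarrow> nat \<Rightarrow> nat" where
  "sref i = (\<lambda>x. if x = i then Suc i else if x = Suc i then i else x)"

definition wordperm :: "nat list \<Rightarrow> nat \<Rightarrow> nat" where
  "wordperm is = foldr (\<lambda>i f. sref i \<circ> f) is id"

definition isperm :: "nat \<Rightarrow> (nat \<Rightarrow> nat) \<Rightarrow> bool" where
  "isperm n w = (bij_betw w {1..n} {1..n} \<and> (\<forall>k. k \<notin> {1..n} \<longrightarrow> w k = k))"

definition is_reduced :: "nat \<Rightarrow> nat list \<Rightarrow> (nat \<Rightarrow> nat) \<Rightarrow> bool" where
  "is_reduced n is w = (set is \<subseteq> {1..<n} \<and> wordperm is = w \<and>
      (\<forall>js. set js \<subseteq> {1..<n} \<longrightarrow> wordperm js = w \<longrightarrow> length is \<le> length js))"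

definition nu0 :: "int \<Rightarrow> nat list \<Rightarrow> nat list" where
  "nu0 \<kappa> lam = resseq \<kappa> lam (tlam lam)"

definition Ibeta :: "int \<Rightarrow> nat list \<Rightarrow> nat list set" where
  "Ibeta \<kappa> lam = {\<nu>. mset \<nu> = mset (nu0 \<kappa> lam)}"

definition rowseg :: "nat list \<Rightarrow> nat \<Rightarrow> nat list \<Rightarrow> nat list" where
  "rowseg lam i \<nu> = take (lam ! i) (drop (sum_list (take i lam)) \<nu>)"

text \<open>Sequences nu_1 * ... * nu_s with nu_i in I^{beta_i} (beta_i the content of row i).\<close>
definition Iblock :: "int \<Rightarrow> nat list \<Rightarrow> nat list set" where
  "Iblock \<kappa> lam = {\<nu>. length \<nu> = sum_list lam \<and>
      (\<forall>i<length lam. mset (rowseg lam i \<nu>) = mset (rowseg lam i (nu0 \<kappa> lam)))}"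

definition eBl :: "int \<Rightarrow> nat list \<Rightarrow> gen list \<Rightarrow> 'k::comm_ring_1" where
  "eBl \<kappa> lam = csum (Iblock \<kappa> lam) (\<lambda>\<nu>. wd [E \<nu>])"

definition internal :: "nat list \<Rightarrow> nat \<Rightarrow> bool" where
  "internal lam r = (\<exists>i<length lam. sum_list (take i lam) < r \<and> Suc r \<le> sum_list (take (Suc i) lam))"

definition psiw :: "nat list \<Rightarrow> gen list" where
  "psiw is = map Psi is"

text \<open>Generators of the left ideal whose quotient is S^lam: the image of the annihilator
  (as generated by letter minus character value) of gamma tensor ... tensor gamma in
  R(beta_1) x ... x R(beta_s), giving P^lam, plus the Garnir elements.\<close>
definition spechtgens :: "int \<Rightarrow> nat list \<Rightarrow> ((nat \<Rightarrow> nat) \<Rightarrow> nat list) \<Rightarrow> (gen list \<Rightarrow> 'k::comm_ring_1) set" where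
  "spechtgens \<kappa> lam red =
     {cmul (wd [X r]) (eBl \<kappa> lam) | r. 1 \<le> r \<and> r \<le> sum_list lam}
   \<union> {cmul (wd [Psi r]) (eBl \<kappa> lam) | r. 1 \<le> r \<and> r < sum_list lam \<and> internal lam r}
   \<union> {csub (wd [E \<nu>]) (csc (deltal \<nu> (nu0 \<kappa> lam)) (eBl \<kappa> lam)) | \<nu>. \<nu> \<in> Iblock \<kappa> lam}
   \<union> {cmul (wd (psiw (red (wperm lam (garnir lam A))))) (eBl \<kappa> lam) | A. A \<in> garnir_nodes lam}"

text \<open>S^lam = R(beta) m / SK: an element f*m (f in the free algebra) is zero iff f*eBl in SK.\<close>
definition SK :: "int \<Rightarrow> nat list \<Rightarrow> ((nat \<Rightarrow> nat) \<Rightarrow> nat list) \<Rightarrow> (gen list \<Rightarrow> 'k::comm_ring_1) set" where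
  "SK \<kappa> lam red = lideal (sum_list lam) (Ibeta \<kappa> lam) (qh_rels (sum_list lam) (Ibeta \<kappa> lam))
                         (spechtgens \<kappa> lam red)"

definition psim :: "int \<Rightarrow> nat list \<Rightarrow> ((nat \<Rightarrow> nat) \<Rightarrow> nat list) \<Rightarrow> (nat \<times> nat \<Rightarrow> nat) \<Rightarrow> gen list \<Rightarrow> 'k::comm_ring_1" where
  "psim \<kappa> lam red t = cmul (wd (psiw (red (wperm lam t)))) (eBl \<kappa> lam)"

definition indep_mod :: "(gen list \<Rightarrow> 'f::field) set \<Rightarrow> (gen list \<Rightarrow> 'f) set \<Rightarrow> bool" where
  "indep_mod K B = (\<forall>c. csum B (\<lambda>b. csc (c b) b) \<in> K \<longrightarrow> (\<forall>b\<in>B. c b = 0))"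

text \<open>Spanning set of e(nu) S_d (degree d piece of S^lam including the shift q^{deg t^lam}).\<close>
definition gpiece :: "int \<Rightarrow> nat list \<Rightarrow> nat list \<Rightarrow> int \<Rightarrow> (gen list \<Rightarrow> 'k::comm_ring_1) set" where
  "gpiece \<kappa> lam \<nu> d = {cmul (wd u) (eBl \<kappa> lam) | u j.
      valid_word (sum_list lam) (Ibeta \<kappa> lam) u \<and> wtrace u (nu0 \<kappa> lam) = Some (\<nu>, j)
      \<and> j + tdeg \<kappa> lam (tlam lam) = d}"

end

theory Submission
  imports Defs "HOL-Combinatorics.Permutations" "HOL-Library.Function_Algebras"
begin

text \<open>Spanning holds integrally and by induction on the number of \<open>\<psi>\<close>s: modulo fewer \<open>\<psi>\<close>s the \<open>\<psi>\<^sub>r\<close> satisfy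
  the nil-Coxeter relations, so by Matsumoto's theorem a word in the \<open>\<psi>\<^sub>r\<close> that is not a \<open>\<psi>\<close>-word of a standard
  tableau can be rewritten to end in a generator that kills the cyclic vector.

  For independence, deform: over \<open>\<int>[z]\<close> let \<open>x\<^sub>r\<close> act on the cyclic vector by \<open>cz z k\<close>, where \<open>k\<close> is the
  content of the \<open>r\<close>-th node. The \<open>Q\<^sub>i\<^sub>j\<close> vanish at the eigenvalues of neighbouring contents, and
  contents \<open>k\<close>, \<open>-k\<close> of equal residue are separated, so over \<open>\<rat>(z)\<close> there is a seminormal
  representation on the span of the standard tableaux. Its initial vector satisfies all deformed
  Specht relations (for the Garnir relations because no standard tableau has the required residue sequence),
  and the vectors \<open>\<psi>\<^sub>w\<^sub>t v\<close> are unitriangular up to nonzero scalars, hence independent. The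
  straightening coefficients therefore exist and are unique over \<open>\<int>[z]\<close>; their values at \<open>z = 0\<close>
  define functionals on the Specht module over any field that are dual to the \<open>\<psi>\<^sub>w\<^sub>t m\<close>.
  Giving \<open>z\<close> degree 2 makes all of this graded.\<close>

text \<open>The seminormal matrices have denominators \<open>cz z l - cz z k\<close> =
  \<plusminus>2z, so they specialise neither to z = 0 nor to characteristic 2, and no representation
  over the target field is constructed. What survives specialisation is the table of straightening
  coefficients: spanning places them in \<int>[z], and independence over the fraction field forces
  them to inherit the relations of the representation. These are polynomial identities with integer
  coefficients and can be reduced to any field. The eigenvalues are determined by the value z at
  content 1. A step along a row or column must give a zero of Q, so u + v asks for alternating signs
  away from 0 and u + v^2 asks for -z^2 at content 0. The sign left open at content -1 is chosen so
  that \<open>cz z (- k) = - cz z k\<close> for k \<noteq> 0: passing to residues identifies k with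
  -k, and only a nonzero z tells these contents apart.\<close>

declare One_nat_def [simp del]

section \<open>Reduced words in the symmetric group\<close>

lemma wordperm_Nil [simp]: "wordperm [] = id"
  and wordperm_Cons [simp]: "wordperm (i # is) = sref i \<circ> wordperm is"
  by (simp_all add: wordperm_def)

lemma wordperm_append: "wordperm (xs @ ys) = wordperm xs \<circ> wordperm ys"
  by (induction xs) (auto simp: comp_assoc)

lemma wordperm_snoc: "wordperm (xs @ [i]) = wordperm xs \<circ> sref i"
  by (simp only: wordperm_append wordperm_Cons wordperm_Nil comp_id)

lemma sref_sref [simp]: "sref i (sref i x) = x"
  by (auto simp: sref_def)

lemma sref_comp_sref [simp]: "sref i \<circ> sref i = id"
  by auto

lemma sref_permutes: "1 \<le> i \<Longrightarrow> i < n \<Longrightarrow> sref i permutes {1..n}"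
proof -
  have "sref i = Transposition.transpose i (Suc i)"
    by (auto simp: sref_def Transposition.transpose_def)
  then show "1 \<le> i \<Longrightarrow> i < n \<Longrightarrow> sref i permutes {1..n}"
    by (auto intro!: permutes_swap_id)
qed

lemma wordperm_permutes: "set is \<subseteq> {1..<n} \<Longrightarrow> wordperm is permutes {1..n}"
  by (induction "is") (auto simp: permutes_id intro!: permutes_compose sref_permutes)

lemma isperm_permutes: "isperm n w \<longleftrightarrow> w permutes {1..n}"
  unfolding isperm_def using bij_imp_permutes permutes_imp_bij permutes_not_in by metis

section \<open>Inversions and length of permutations\<close>

definition invs :: "nat \<Rightarrow> (nat \<Rightarrow> nat) \<Rightarrow> (nat \<times> nat) set" where
  "invs n w = {(a, b). 1 \<le> a \<and> a < b \<and> b \<le> n \<and> w b < w a}"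

definition ilen :: "nat \<Rightarrow> (nat \<Rightarrow> nat) \<Rightarrow> nat" where
  "ilen n w = card (invs n w)"

lemma finite_invs [simp]: "finite (invs n w)"
  by (rule finite_subset[of _ "{1..n} \<times> {1..n}"]) (auto simp: invs_def)

lemma invs_id [simp]: "invs n id = {}"
  by (auto simp: invs_def)

lemma ilen_id [simp]: "ilen n id = 0"
  by (simp add: ilen_def)

text \<open>Left multiplication by s_i exchanges the values i and i + 1, which compare alike with
  every other value. Only the pair (p, q) of their positions changes its order.\<close>

lemma invs_sref_comp:
  assumes w: "w permutes {1..n}" and pq: "1 \<le> p" "p < q" "q \<le> n" "w p = i" "w q = Suc i"
  shows "invs n (sref i \<circ> w) = insert (p, q) (invs n w)" "(p, q) \<notin> invs n w"
proof -
  have inj: "w a = w b \<longleftrightarrow> a = b" for a b using w by (meson permutes_inj injD)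
  have "(a, b) \<in> invs n (sref i \<circ> w) \<longleftrightarrow> (a, b) \<in> insert (p, q) (invs n w)" for a b
  proof (cases "(a, b) = (p, q) \<or> (a, b) = (q, p)")
    case True
    then show ?thesis using pq by (auto simp: invs_def sref_def)
  next
    case F: False
    have "sref i (w b) < sref i (w a) \<longleftrightarrow> w b < w a" if "a \<noteq> b"
    proof -
      have "\<not> (w a = i \<and> w b = Suc i)" "\<not> (w b = i \<and> w a = Suc i)" "w a \<noteq> w b"
        using inj pq F that by (metis)+
      then show ?thesis by (auto simp: sref_def)
    qed
    then show ?thesis using F by (auto simp: invs_def)
  qed
  then show "invs n (sref i \<circ> w) = insert (p, q) (invs n w)" by auto
  show "(p, q) \<notin> invs n w" using pq by (auto simp: invs_def)
qed

lemma ilen_sref_comp: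
  assumes "w permutes {1..n}" "1 \<le> p" "p < q" "q \<le> n" "w p = i" "w q = Suc i"
  shows "ilen n (sref i \<circ> w) = Suc (ilen n w)"
  using invs_sref_comp[OF assms] by (simp add: ilen_def)

lemma permutes_adjacent_preimages:
  assumes "w permutes {1..n}" "1 \<le> i" "i < n"
  shows "\<exists>p q. p \<in> {1..n} \<and> q \<in> {1..n} \<and> w p = i \<and> w q = Suc i"
proof -
  have a: "i \<in> w ` {1..n}" and b: "Suc i \<in> w ` {1..n}"
    using permutes_image[OF assms(1)] assms(2,3) by auto
  obtain p where p: "i = w p" "p \<in> {1..n}" using a by (rule imageE)
  obtain q where q: "Suc i = w q" "q \<in> {1..n}" using b by (rule imageE)
  show ?thesis by (intro exI[of _ p] exI[of _ q]) (use p q in simp)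
qed

lemma ilen_sref_comp_le:
  assumes w: "w permutes {1..n}" and i: "1 \<le> i" "i < n"
  shows "ilen n (sref i \<circ> w) \<le> Suc (ilen n w)"
proof -
  obtain p q where pq: "p \<in> {1..n}" "q \<in> {1..n}" "w p = i" "w q = Suc i"
    using permutes_adjacent_preimages[OF w i] by blast
  show ?thesis
  proof (cases p q rule: linorder_cases)
    case less
    then show ?thesis using ilen_sref_comp[OF w] pq by auto
  next
    case equal
    then show ?thesis using pq by auto
  next
    case greater
    have w': "sref i \<circ> w permutes {1..n}" using w i by (intro permutes_compose sref_permutes)
    have "ilen n (sref i \<circ> (sref i \<circ> w)) = Suc (ilen n (sref i \<circ> w))"
      using pq greater by (intro ilen_sref_comp[OF w', of q p]) (auto simp: sref_def)
    then show ?thesis by (simp add: o_assoc)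
  qed
qed

lemma ilen_le_length: "set is \<subseteq> {1..<n} \<Longrightarrow> ilen n (wordperm is) \<le> length is"
proof (induction "is")
  case (Cons i js)
  have "ilen n (sref i \<circ> wordperm js) \<le> Suc (ilen n (wordperm js))"
    using Cons.prems by (intro ilen_sref_comp_le wordperm_permutes) auto
  then show ?case using Cons by (simp del: comp_apply)
qed simp

text \<open>Right multiplication exchanges positions, so inversions are carried along by renaming
  positions; the one pair whose order is really reversed is (i, i + 1).\<close>

lemma invs_comp_sref:
  assumes i: "1 \<le> i" "i < n" and d: "w (Suc i) < w i"
  shows "bij_betw (map_prod (sref i) (sref i)) (invs n (w \<circ> sref i)) (invs n w - {(i, Suc i)})"
proof (rule bij_betwI[where g = "map_prod (sref i) (sref i)"])
  show "map_prod (sref i) (sref i) \<in> invs n (w \<circ> sref i) \<rightarrow> invs n w - {(i, Suc i)}"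
    using i d by (auto simp: invs_def sref_def split: if_splits)
  show "map_prod (sref i) (sref i) \<in> invs n w - {(i, Suc i)} \<rightarrow> invs n (w \<circ> sref i)"
    using i d by (auto simp: invs_def sref_def split: if_splits)
qed auto

lemma ilen_comp_sref:
  assumes i: "1 \<le> i" "i < n" and d: "w (Suc i) < w i"
  shows "Suc (ilen n (w \<circ> sref i)) = ilen n w"
proof -
  have "(i, Suc i) \<in> invs n w" using i d by (auto simp: invs_def)
  moreover have "card (invs n (w \<circ> sref i)) = card (invs n w - {(i, Suc i)})"
    using invs_comp_sref[where w = w, OF assms] by (rule bij_betw_same_card)
  ultimately show ?thesis unfolding ilen_def
    by (metis card_Suc_Diff1 finite_invs)
qed

lemma ilen_comp_sref_up:
  assumes i: "1 \<le> i" "i < n" and d: "w i < w (Suc i)"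
  shows "ilen n (w \<circ> sref i) = Suc (ilen n w)"
proof -
  have "Suc (ilen n ((w \<circ> sref i) \<circ> sref i)) = ilen n (w \<circ> sref i)"
    using d by (intro ilen_comp_sref i) (simp add: sref_def)
  then show ?thesis by (simp add: comp_assoc)
qed

text \<open>Reducedness measured by inversions; see \<open>rword_if_is_reduced\<close> for the definition by minimality.\<close>
definition rword :: "nat \<Rightarrow> nat list \<Rightarrow> (nat \<Rightarrow> nat) \<Rightarrow> bool" where
  "rword n is w \<longleftrightarrow> set is \<subseteq> {1..<n} \<and> wordperm is = w \<and> length is = ilen n w"

lemma rword_permutes: "rword n is w \<Longrightarrow> w permutes {1..n}"
  unfolding rword_def using wordperm_permutes by blast

text \<open>Without descents w is increasing, hence pointwise at least the identity, and a
  permutation with that property is the identity.\<close>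

lemma no_descent_id:
  assumes w: "w permutes {1..n}" and d: "\<And>i. 1 \<le> i \<Longrightarrow> i < n \<Longrightarrow> \<not> w (Suc i) < w i"
  shows "w = id"
proof -
  have inj: "inj w" using w by (rule permutes_inj)
  have up: "w i < w (Suc i)" if "1 \<le> i" "i < n" for i
    using d[OF that] inj by (metis injD linorder_less_linear n_not_Suc_n)
  have "1 \<le> i \<longrightarrow> i \<le> n \<longrightarrow> i \<le> w i" for i
  proof (induction i)
    case (Suc i)
    show ?case
    proof (cases "i = 0")
      case True
      have "n \<ge> 1 \<Longrightarrow> w 1 \<in> {1..n}" using w permutes_in_image[OF w] by auto
      then show ?thesis using True by (auto simp: One_nat_def)
    qed (use Suc up[of i] in force)
  qed simp
  then show ?thesis using w by (intro permutes_natset_ge) auto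
qed

lemma rword_exists:
  assumes "w permutes {1..n}" shows "\<exists>is. rword n is w"
  using assms
proof (induction "ilen n w" arbitrary: w rule: less_induct)
  case less
  show ?case
  proof (cases "\<exists>i. 1 \<le> i \<and> i < n \<and> w (Suc i) < w i")
    case False
    then have "w = id" using less.prems no_descent_id by blast
    then show ?thesis by (auto simp: rword_def intro!: exI[of _ "[]"])
  next
    case True
    then obtain i where i: "1 \<le> i" "i < n" "w (Suc i) < w i" by auto
    note l = ilen_comp_sref[OF i]
    have "w \<circ> sref i permutes {1..n}"
      using less.prems i by (intro permutes_compose sref_permutes)
    then obtain js where js: "rword n js (w \<circ> sref i)" using less.hyps[of "w \<circ> sref i"] l by auto
    have "rword n (js @ [i]) w"
      using js i l by (auto simp: rword_def wordperm_append comp_assoc)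
    then show ?thesis by blast
  qed
qed

text \<open>\<open>ilen\<close> bounds the length of any word for w from below and
  \<open>rword_exists\<close> attains the bound.\<close>

lemma rword_if_is_reduced:
  assumes "is_reduced n is w" shows "rword n is w"
proof -
  have a: "set is \<subseteq> {1..<n}" "wordperm is = w" using assms by (auto simp: is_reduced_def)
  obtain js where js: "rword n js w" using rword_exists wordperm_permutes a by metis
  then have "length is \<le> length js" using assms by (auto simp: is_reduced_def rword_def)
  moreover have "ilen n w \<le> length is" using ilen_le_length a by blast
  ultimately show ?thesis using js a by (auto simp: rword_def)
qed

lemma rword_snocD:
  assumes "rword n (js @ [i]) w"
  shows "1 \<le> i" "i < n" "w (Suc i) < w i" "rword n js (w \<circ> sref i)"
proof -
  show i: "1 \<le> i" "i < n" using assms by (auto simp: rword_def)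
  have js: "set js \<subseteq> {1..<n}" "wordperm js = w \<circ> sref i" "Suc (length js) = ilen n w"
    using assms by (auto simp: rword_def wordperm_append comp_assoc)
  have le: "ilen n (w \<circ> sref i) \<le> length js" using ilen_le_length js by metis
  have "w i \<noteq> w (Suc i)" using rword_permutes[OF assms] by (metis n_not_Suc_n permutes_inj injD)
  moreover have "\<not> w i < w (Suc i)" using ilen_comp_sref_up[OF i, of w] le js by auto
  ultimately show d: "w (Suc i) < w i" by simp
  show "rword n js (w \<circ> sref i)"
    using js ilen_comp_sref[where w = w, OF i d] by (auto simp: rword_def)
qed

text \<open>Counterpart of \<open>rword_snocD\<close> at the other end. The new inversion is
  recorded by its positions p, q: for a permutation \<open>wperm lam t\<close>, positions are nodes
  in row reading order and values are entries of t.\<close>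

lemma rword_ConsD:
  assumes "rword n (i # js) w"
  shows "\<exists>p q. 1 \<le> p \<and> p < q \<and> q \<le> n \<and> wordperm js p = i \<and> wordperm js q = Suc i \<and>
    invs n w = insert (p, q) (invs n (wordperm js))"
    "1 \<le> i" "i < n" "rword n js (sref i \<circ> w)" "sref i \<circ> w = wordperm js"
proof -
  show i: "1 \<le> i" "i < n" using assms by (auto simp: rword_def)
  have js: "set js \<subseteq> {1..<n}" "Suc (length js) = ilen n w" and w: "w = sref i \<circ> wordperm js"
    using assms by (auto simp: rword_def)
  let ?v = "wordperm js"
  have v: "?v permutes {1..n}" using js wordperm_permutes by blast
  obtain p q where pq: "p \<in> {1..n}" "q \<in> {1..n}" "?v p = i" "?v q = Suc i"
    using permutes_adjacent_preimages[OF v i] by blast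
  have le: "ilen n ?v \<le> length js" using ilen_le_length js by metis
  have "p \<noteq> q" using pq by auto
  moreover have "\<not> q < p"
  proof
    assume "q < p"
    then have "ilen n (sref i \<circ> (sref i \<circ> ?v)) = Suc (ilen n (sref i \<circ> ?v))"
      using pq v i by (intro ilen_sref_comp[of _ _ q p] permutes_compose sref_permutes) (auto simp: sref_def)
    then show False using le js w by (simp add: o_assoc)
  qed
  ultimately have lt: "p < q" by simp
  have "ilen n w = Suc (ilen n ?v)" unfolding w using pq lt by (intro ilen_sref_comp[OF v]) auto
  then show "rword n js (sref i \<circ> w)" using js w by (simp add: rword_def o_assoc)
  show "sref i \<circ> w = wordperm js" using w by (simp add: o_assoc)
  show "\<exists>p q. 1 \<le> p \<and> p < q \<and> q \<le> n \<and> wordperm js p = i \<and> wordperm js q = Suc i \<and>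
      invs n w = insert (p, q) (invs n (wordperm js))"
    using pq lt invs_sref_comp(1)[OF v, of p q i] w by (intro exI[of _ p] exI[of _ q]) auto
qed

text \<open>Moves of equal length only. Deleting a square i i is not among them, since \<psi>_r^2
  acts as a polynomial in the x's; squares are treated separately through
  \<open>nonreduced_beq_square\<close>.\<close>

inductive beq :: "nat list \<Rightarrow> nat list \<Rightarrow> bool" where
  beq_refl: "beq xs xs"
| beq_sym: "beq xs ys \<Longrightarrow> beq ys xs"
| beq_trans [trans]: "beq xs ys \<Longrightarrow> beq ys zs \<Longrightarrow> beq xs zs"
| beq_comm: "Suc i < j \<Longrightarrow> beq (xs @ [i, j] @ ys) (xs @ [j, i] @ ys)"
| beq_braid: "beq (xs @ [i, Suc i, i] @ ys) (xs @ [Suc i, i, Suc i] @ ys)"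

lemma beq_context: "beq xs ys \<Longrightarrow> beq (as @ xs @ bs) (as @ ys @ bs)"
proof (induction rule: beq.induct)
  case (beq_comm i j xs ys)
  then show ?case using beq.beq_comm[of i j "as @ xs" "ys @ bs"] by simp
next
  case (beq_braid xs i ys)
  then show ?case using beq.beq_braid[of "as @ xs" i "ys @ bs"] by simp
qed (auto intro: beq.intros)

lemma beq_length_set: "beq xs ys \<Longrightarrow> length xs = length ys \<and> set xs = set ys"
  by (induction rule: beq.induct) auto

lemma beq_append1: "beq xs ys \<Longrightarrow> beq (xs @ bs) (ys @ bs)"
  using beq_context[of xs ys "[]" bs] by simp

lemma sref_commute: "Suc i < j \<Longrightarrow> sref i \<circ> sref j = sref j \<circ> sref i"
  by (auto simp: sref_def fun_eq_iff)

lemma sref_braid: "sref i \<circ> sref (Suc i) \<circ> sref i = sref (Suc i) \<circ> sref i \<circ> sref (Suc i)"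
  by (auto simp: sref_def fun_eq_iff)

lemma rword_snocI:
  "1 \<le> i \<Longrightarrow> i < n \<Longrightarrow> w (Suc i) < w i \<Longrightarrow> rword n js (w \<circ> sref i) \<Longrightarrow> rword n (js @ [i]) w"
  using ilen_comp_sref[of i n w] by (auto simp: rword_def wordperm_append comp_assoc)

text \<open>Matsumoto's theorem, by comparing last letters: two descents \<open>i\<close>, \<open>j\<close> of \<open>w\<close> split off
  the longest element of the parabolic subgroup they generate.\<close>
theorem matsumoto:
  assumes "rword n xs w" "rword n ys w" shows "beq xs ys"
  using assms
proof (induction "ilen n w" arbitrary: w xs ys rule: less_induct)
  case less
  show ?case
  proof (cases "xs = [] \<or> ys = []")
    case True
    then have "xs = [] \<and> ys = []" using less.prems by (auto simp: rword_def)
    then show ?thesis by (simp add: beq_refl)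
  next
    case False
    then obtain us i vs j where xy: "xs = us @ [i]" "ys = vs @ [j]"
      by (metis rev_exhaust)
    note I = rword_snocD[OF less.prems(1)[unfolded xy]]
    note J = rword_snocD[OF less.prems(2)[unfolded xy]]
    have wp: "w permutes {1..n}" using less.prems rword_permutes by blast
    have IHi: "beq us zs" if "rword n zs (w \<circ> sref i)" for zs
      using less.hyps[OF _ I(4) that] ilen_comp_sref[OF I(1-3)] by simp
    have IHj: "beq vs zs" if "rword n zs (w \<circ> sref j)" for zs
      using less.hyps[OF _ J(4) that] ilen_comp_sref[OF J(1-3)] by simp
    have far: "beq (us @ [i]) (vs @ [j])" if ij: "Suc i < j \<or> Suc j < i"
    proof -
      have c: "sref i \<circ> sref j = sref j \<circ> sref i" using ij sref_commute[of i j] sref_commute[of j i] by auto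
      let ?w = "w \<circ> sref i \<circ> sref j"
      have "?w permutes {1..n}" using I J wp by (intro permutes_compose sref_permutes)
      then obtain zs where zs: "rword n zs ?w" using rword_exists by blast
      have zi: "rword n (zs @ [j]) (w \<circ> sref i)"
        using ij by (intro rword_snocI J(1,2)) (use zs J(3) in \<open>auto simp: sref_def comp_assoc\<close>)
      have "?w = w \<circ> sref j \<circ> sref i" by (simp only: comp_assoc c)
      then have zj: "rword n (zs @ [i]) (w \<circ> sref j)"
        using ij by (intro rword_snocI I(1,2)) (use zs I(3) in \<open>auto simp: sref_def\<close>)
      have "beq (us @ [i]) ((zs @ [j]) @ [i])" using IHi[OF zi] beq_append1 by blast
      also have "beq ((zs @ [j]) @ [i]) ((zs @ [i]) @ [j])"
        using ij beq_comm[of i j zs "[]"] beq_comm[of j i zs "[]"] beq_sym by auto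
      also have "beq ((zs @ [i]) @ [j]) (vs @ [j])" using IHj[OF zj] beq_append1 beq_sym by blast
      finally show ?thesis .
    qed
    have near: "beq (as @ [k]) (bs @ [Suc k])"
      if k: "1 \<le> k" "Suc k < n" "w (Suc k) < w k" "w (Suc (Suc k)) < w (Suc k)"
        and A: "\<And>zs. rword n zs (w \<circ> sref k) \<Longrightarrow> beq as zs"
        and B: "\<And>zs. rword n zs (w \<circ> sref (Suc k)) \<Longrightarrow> beq bs zs" for k as bs
    proof -
      \<comment> \<open>\<open>?w\<close> is w with the longest element of the parabolic subgroup of
        s_k and s_(k+1) divided off; both given words are compared with completions of one word for
        \<open>?w\<close>.\<close>
      let ?w = "w \<circ> sref k \<circ> sref (Suc k) \<circ> sref k"
      have "?w permutes {1..n}" using k wp by (intro permutes_compose sref_permutes) auto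
      then obtain zs where zs: "rword n zs ?w" using rword_exists by blast
      have "rword n (zs @ [k]) (w \<circ> sref k \<circ> sref (Suc k))"
        using k by (intro rword_snocI zs) (auto simp: sref_def)
      then have "rword n ((zs @ [k]) @ [Suc k]) (w \<circ> sref k)"
        using k by (intro rword_snocI[where js = "zs @ [k]"]) (auto simp: sref_def)
      note a = A[OF this]
      have "?w = w \<circ> sref (Suc k) \<circ> sref k \<circ> sref (Suc k)"
        using sref_braid[of k] by (simp only: comp_assoc)
      then have zs': "rword n zs (w \<circ> sref (Suc k) \<circ> sref k \<circ> sref (Suc k))" using zs by (simp only:)
      have "rword n (zs @ [Suc k]) (w \<circ> sref (Suc k) \<circ> sref k)"
        using k by (intro rword_snocI zs') (auto simp: sref_def)
      then have "rword n ((zs @ [Suc k]) @ [k]) (w \<circ> sref (Suc k))"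
        using k by (intro rword_snocI[where js = "zs @ [Suc k]"]) (auto simp: sref_def)
      note b = B[OF this]
      have "beq (as @ [k]) (zs @ [k, Suc k, k])" using beq_append1[OF a, of "[k]"] by simp
      also have "beq (zs @ [k, Suc k, k]) (zs @ [Suc k, k, Suc k])" using beq_braid[of zs k "[]"] by simp
      also have "beq (zs @ [Suc k, k, Suc k]) (bs @ [Suc k])" using beq_append1[OF b, of "[Suc k]"] beq_sym by simp
      finally show ?thesis .
    qed
    consider "i = j" | "Suc i < j \<or> Suc j < i" | "j = Suc i" | "i = Suc j" by linarith
    then show ?thesis
    proof cases
      case 1
      then show ?thesis using IHi J(4) xy beq_append1 by blast
    next
      case 2
      then show ?thesis using far xy by simp
    next
      case 3
      then show ?thesis using near[of i us vs] IHi IHj I J xy by auto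
    next
      case 4
      then show ?thesis using near[of j vs us] IHi IHj I J xy beq_sym by auto
    qed
  qed
qed

text \<open>Inclusion of inversion sets, taken as pairs of positions, is the weak order in which v
  occurs at the right end. The last letter of a word for v is a descent of v, hence of w, and can be
  split off both. At the right end of a \<psi>-word, v acts first on the cyclic vector.\<close>

lemma rword_right_factor:
  assumes "rword n js v" "w permutes {1..n}" "invs n v \<subseteq> invs n w"
  shows "\<exists>ks. rword n (ks @ js) w"
  using assms
proof (induction js arbitrary: v w rule: rev_induct)
  case Nil
  then show ?case using rword_exists by simp
next
  case (snoc i js)
  note S = rword_snocD[OF snoc.prems(1)]
  have "(i, Suc i) \<in> invs n v" using S by (auto simp: invs_def)
  then have d: "w (Suc i) < w i" using snoc.prems(3) by (auto simp: invs_def)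
  have "invs n (v \<circ> sref i) \<subseteq> invs n (w \<circ> sref i)"
  proof
    fix x assume x: "x \<in> invs n (v \<circ> sref i)"
    let ?f = "map_prod (sref i) (sref i)"
    have "?f x \<in> invs n v - {(i, Suc i)}"
      using bij_betwE[OF invs_comp_sref[OF S(1-3)]] x by simp
    then have "?f x \<in> ?f ` invs n (w \<circ> sref i)"
      using bij_betw_imp_surj_on[OF invs_comp_sref[where w = w, OF S(1,2) d]] snoc.prems(3) by auto
    then have "?f (?f x) \<in> ?f ` ?f ` invs n (w \<circ> sref i)" by (rule imageI)
    moreover have "?f (?f y) = y" for y by (cases y) simp
    ultimately show "x \<in> invs n (w \<circ> sref i)" by (simp add: image_image)
  qed
  moreover have "w \<circ> sref i permutes {1..n}" using snoc.prems S by (intro permutes_compose sref_permutes)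
  ultimately obtain ks where "rword n (ks @ js) (w \<circ> sref i)" using snoc.IH S(4) by blast
  then have "rword n ((ks @ js) @ [i]) w" using S d by (intro rword_snocI)
  then show ?case by auto
qed

text \<open>The shortest non-reduced prefix is a reduced word for some v followed by a descent i of
  v, and by Matsumoto's theorem the word for v can be chosen to end in i.\<close>

lemma nonreduced_beq_square:
  assumes "set is \<subseteq> {1..<n}" "length is \<noteq> ilen n (wordperm is)"
  shows "\<exists>xs i ys. beq is (xs @ [i, i] @ ys)"
  using assms
proof (induction "is" rule: rev_induct)
  case (snoc i js)
  show ?case
  proof (cases "length js = ilen n (wordperm js)")
    case False
    then obtain xs k ys where "beq js (xs @ [k, k] @ ys)" using snoc by auto
    then have "beq (js @ [i]) (xs @ [k, k] @ (ys @ [i]))" using beq_append1[of js _ "[i]"] by fastforce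
    then show ?thesis by blast
  next
    case True
    let ?v = "wordperm js"
    have rw: "rword n js ?v" using True snoc.prems by (auto simp: rword_def)
    have i: "1 \<le> i" "i < n" using snoc.prems by auto
    have "ilen n (?v \<circ> sref i) \<noteq> Suc (length js)"
      using snoc.prems(2) by (simp only: wordperm_snoc length_append_singleton not_sym)
    then have "\<not> ?v i < ?v (Suc i)" using ilen_comp_sref_up[OF i, of ?v] True by metis
    moreover have "?v i \<noteq> ?v (Suc i)" using rword_permutes[OF rw] by (metis n_not_Suc_n permutes_inj injD)
    ultimately have d: "?v (Suc i) < ?v i" by simp
    have "?v \<circ> sref i permutes {1..n}" using rword_permutes[OF rw] i by (intro permutes_compose sref_permutes)
    then obtain ks where "rword n ks (?v \<circ> sref i)" using rword_exists by blast
    then have "rword n (ks @ [i]) ?v" using d i by (intro rword_snocI)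
    then have "beq js (ks @ [i])" using matsumoto rw by blast
    then have "beq (js @ [i]) (ks @ [i, i] @ [])" using beq_append1[of js "ks @ [i]" "[i]"] by simp
    then show ?thesis by blast
  qed
qed simp

text \<open>The tail of the word preserves the interval {p..q}. The first letter s_i acts on the
  values i, i + 1 at two positions of this interval, so both values lie in it too.\<close>

lemma rword_support:
  assumes "rword n is w" "invs n w \<subseteq> {p..q} \<times> {p..q}"
  shows "set is \<subseteq> {p..<q}"
  using assms
proof (induction "is" arbitrary: w)
  case (Cons i js)
  obtain a b where ab: "1 \<le> a" "a < b" "b \<le> n" "wordperm js a = i" "wordperm js b = Suc i"
    "invs n w = insert (a, b) (invs n (wordperm js))"
    using rword_ConsD(1)[OF Cons.prems(1)] by blast
  have js: "set js \<subseteq> {p..<q}"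
    using Cons.IH[OF rword_ConsD(4)[OF Cons.prems(1)]] Cons.prems(2) ab(6) rword_ConsD(5)[OF Cons.prems(1)]
    by auto
  have "wordperm js x \<in> {p..q}" if "x \<in> {p..q}" for x
    using js that by (induction js) (auto simp: sref_def)
  moreover have "a \<in> {p..q}" "b \<in> {p..q}" using ab Cons.prems(2) by auto
  ultimately have "i \<in> {p..q}" "Suc i \<in> {p..q}" using ab(4,5) by metis+
  then show ?case using js by auto
qed simp

section \<open>Tableaux\<close>

text \<open>No order conditions on rows or columns: \<open>sref r \<circ> t\<close> stays in this
  class while it may leave \<open>Std lam\<close>, and \<open>wperm\<close> matches the class with
  all permutations.\<close>

definition is_fill :: "nat list \<Rightarrow> (nat \<times> nat \<Rightarrow> nat) \<Rightarrow> bool" where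
  "is_fill lam t \<longleftrightarrow> t ` nodes lam = {1..sum_list lam} \<and> inj_on t (nodes lam) \<and> (\<forall>A. A \<notin> nodes lam \<longrightarrow> t A = 0)"

text \<open>The residue is the absolute value of this signed content; the sign is what the
  deformation sees in addition.\<close>

definition cont :: "int \<Rightarrow> nat \<times> nat \<Rightarrow> int" where
  "cont \<kappa> A = \<kappa> + int (snd A) - int (fst A)"

lemma resn_cont: "resn \<kappa> A = nat \<bar>cont \<kappa> A\<bar>"
  by (simp add: resn_def cont_def)

lemma finite_nodes [simp]: "finite (nodes lam)"
proof -
  have "nodes lam \<subseteq> (SIGMA r:{1..length lam}. {1..lam ! (r - 1)})" by (auto simp: nodes_def)
  then show ?thesis by (rule finite_subset) auto
qed

lemma Std_iff:
  "t \<in> Std lam \<longleftrightarrow> is_fill lam t \<and>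
    (\<forall>r c. (r, c) \<in> nodes lam \<longrightarrow> (r, Suc c) \<in> nodes lam \<longrightarrow> t (r, c) < t (r, Suc c)) \<and>
    (\<forall>r c. (r, c) \<in> nodes lam \<longrightarrow> (Suc r, c) \<in> nodes lam \<longrightarrow> t (r, c) < t (Suc r, c))"
  by (auto simp: Std_def is_std_def is_fill_def)

lemma Std_fill: "t \<in> Std lam \<Longrightarrow> is_fill lam t"
  by (simp add: Std_iff)

lemma fill_range: "is_fill lam t \<Longrightarrow> A \<in> nodes lam \<Longrightarrow> 1 \<le> t A \<and> t A \<le> sum_list lam"
  unfolding is_fill_def by (metis atLeastAtMost_iff imageI)

lemma fill_inj: "is_fill lam t \<Longrightarrow> A \<in> nodes lam \<Longrightarrow> B \<in> nodes lam \<Longrightarrow> t A = t B \<longleftrightarrow> A = B"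
  unfolding is_fill_def by (meson inj_onD)

lemma fill_tinv_left [simp]: "is_fill lam t \<Longrightarrow> A \<in> nodes lam \<Longrightarrow> tinv lam t (t A) = A"
  unfolding tinv_def by (rule the_equality) (auto simp: fill_inj)

lemma fill_tinv:
  assumes "is_fill lam t" "1 \<le> k" "k \<le> sum_list lam"
  shows "tinv lam t k \<in> nodes lam" "t (tinv lam t k) = k"
proof -
  have "k \<in> t ` nodes lam" using assms by (simp add: is_fill_def)
  then obtain A where "k = t A" "A \<in> nodes lam" by (rule imageE)
  then show "tinv lam t k \<in> nodes lam" "t (tinv lam t k) = k" using assms(1) by simp_all
qed

lemma fill_tinv_eq: "is_fill lam t \<Longrightarrow> A \<in> nodes lam \<Longrightarrow> t A = k \<Longrightarrow> tinv lam t k = A"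
  by auto

lemma finite_Std [simp]: "finite (Std lam)"
proof -
  have "Std lam \<subseteq> {t. (\<forall>A\<in>nodes lam. t A \<in> {0..sum_list lam}) \<and> (\<forall>A. A \<notin> nodes lam \<longrightarrow> t A = 0)}"
    using fill_range by (fastforce simp: Std_iff is_fill_def)
  moreover have "finite {t. (\<forall>A\<in>nodes lam. t A \<in> {0..sum_list lam}) \<and> (\<forall>A. A \<notin> nodes lam \<longrightarrow> t A = 0)}"
    using finite_set_of_finite_funs[of "nodes lam" "{0..sum_list lam}" 0] by (simp add: all_conj_distrib Ball_def imp_conjL conj_commute imp_conjR)
  ultimately show ?thesis by (rule finite_subset)
qed

subsection \<open>Row reading\<close>

lemma sum_list_take_Suc: "i < length lam \<Longrightarrow> sum_list (take (Suc i) lam) = sum_list (take i lam) + lam ! i"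
  by (simp add: take_Suc_conv_app_nth)

lemma sum_list_take_mono: "i \<le> j \<Longrightarrow> sum_list (take i lam) \<le> sum_list (take j (lam::nat list))"
proof -
  assume "i \<le> j"
  then have "take j lam = take i lam @ take (j - i) (drop i lam)"
    by (metis le_add_diff_inverse take_add)
  then show ?thesis by simp
qed

lemma tlam_bounds:
  assumes "(r, c) \<in> nodes lam"
  shows "sum_list (take (r - 1) lam) < tlam lam (r, c)" "tlam lam (r, c) \<le> sum_list (take r lam)"
    "sum_list (take r lam) \<le> sum_list lam"
proof -
  have r: "1 \<le> r" "r \<le> length lam" "1 \<le> c" "c \<le> lam ! (r - 1)" using assms by (auto simp: nodes_def)
  show "sum_list (take (r - 1) lam) < tlam lam (r, c)" using assms r by (simp add: tlam_def)
  have "sum_list (take r lam) = sum_list (take (r - 1) lam) + lam ! (r - 1)"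
    using sum_list_take_Suc[of "r - 1" lam] r by simp
  then show "tlam lam (r, c) \<le> sum_list (take r lam)" using assms r by (simp add: tlam_def)
  show "sum_list (take r lam) \<le> sum_list lam"
    using sum_list_take_mono[of r "length lam" lam] r by simp
qed

lemma tlam_less_iff:
  assumes "A \<in> nodes lam" "B \<in> nodes lam"
  shows "tlam lam A < tlam lam B \<longleftrightarrow> fst A < fst B \<or> (fst A = fst B \<and> snd A < snd B)"
proof -
  have row: "tlam lam A < tlam lam B" if "fst A < fst B" "A \<in> nodes lam" "B \<in> nodes lam" for A B
  proof -
    have "sum_list (take (fst A) lam) \<le> sum_list (take (fst B - 1) lam)"
      using that by (intro sum_list_take_mono) simp
    then show ?thesis using tlam_bounds[of "fst A" "snd A" lam] tlam_bounds[of "fst B" "snd B" lam] that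
      by simp
  qed
  show ?thesis
  proof (cases "fst A" "fst B" rule: linorder_cases)
    case equal
    then show ?thesis using assms by (simp add: tlam_def)
  qed (use row[of A B] row[of B A] assms in auto)
qed

lemma tlam_fill: "is_fill lam (tlam lam)"
  unfolding is_fill_def
proof (intro conjI)
  show inj: "inj_on (tlam lam) (nodes lam)"
  proof (rule inj_onI)
    fix A B assume "A \<in> nodes lam" "B \<in> nodes lam" "tlam lam A = tlam lam B"
    then show "A = B" using tlam_less_iff[of A lam B] tlam_less_iff[of B lam A]
      by (metis linorder_less_linear nat_less_le prod_eqI)
  qed
  show "tlam lam ` nodes lam = {1..sum_list lam}"
  proof (intro equalityI subsetI)
    fix k assume "k \<in> tlam lam ` nodes lam"
    then show "k \<in> {1..sum_list lam}" using tlam_bounds by fastforce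
  next
    fix k assume k: "k \<in> {1..sum_list lam}"
    \<comment> \<open>The row of k is the first one whose partial sum reaches k; the partial sum
      before it gives the column.\<close>
    define r where "r = (LEAST r. k \<le> sum_list (take r lam))"
    have ex: "k \<le> sum_list (take (length lam) lam)" using k by simp
    then have r: "k \<le> sum_list (take r lam)" unfolding r_def by (rule LeastI)
    have rl: "r \<le> length lam" unfolding r_def by (rule Least_le) (rule ex)
    have "r \<noteq> 0" using r k by (cases r) auto
    then obtain i where i: "r = Suc i" by (cases r) auto
    have "\<not> k \<le> sum_list (take i lam)" using not_less_Least[of i "\<lambda>r. k \<le> sum_list (take r lam)"] i
      by (simp add: r_def)
    then have "(r, k - sum_list (take i lam)) \<in> nodes lam" "tlam lam (r, k - sum_list (take i lam)) = k"
      using r rl i sum_list_take_Suc[of i lam] by (auto simp: nodes_def tlam_def)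
    then show "k \<in> tlam lam ` nodes lam" by (metis imageI)
  qed
  show "\<forall>A. A \<notin> nodes lam \<longrightarrow> tlam lam A = 0" by (simp add: tlam_def)
qed

lemma perm_fill:
  assumes "w permutes {1..sum_list lam}" shows "is_fill lam (w \<circ> tlam lam)"
  unfolding is_fill_def
proof (intro conjI allI impI)
  have a: "tlam lam ` nodes lam = {1..sum_list lam}" using tlam_fill by (simp add: is_fill_def)
  show "(w \<circ> tlam lam) ` nodes lam = {1..sum_list lam}"
    unfolding image_comp[symmetric] a by (rule permutes_image[OF assms])
  show "inj_on (w \<circ> tlam lam) (nodes lam)"
    using tlam_fill permutes_inj[OF assms] by (auto simp: is_fill_def intro!: comp_inj_on intro: inj_on_subset)
  fix A assume "A \<notin> nodes lam"
  then show "(w \<circ> tlam lam) A = 0" using permutes_not_in[OF assms, of 0] by (simp add: tlam_def)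
qed

lemma wperm_tlam:
  assumes "is_fill lam t" "A \<in> nodes lam" shows "wperm lam t (tlam lam A) = t A"
  using assms fill_range[OF tlam_fill assms(2)] by (simp add: wperm_def tlam_fill)

lemma wperm_comp_tlam: "is_fill lam t \<Longrightarrow> wperm lam t \<circ> tlam lam = t"
proof
  fix A assume t: "is_fill lam t"
  show "(wperm lam t \<circ> tlam lam) A = t A"
  proof (cases "A \<in> nodes lam")
    case True
    then show ?thesis using wperm_tlam[OF t] by simp
  next
    case False
    then have "t A = 0" "tlam lam A = 0" using t unfolding is_fill_def tlam_def by (blast, simp)
    then show ?thesis by (simp add: wperm_def)
  qed
qed

lemma wperm_permutes: "is_fill lam t \<Longrightarrow> wperm lam t permutes {1..sum_list lam}"
proof (rule bij_imp_permutes)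
  assume t: "is_fill lam t"
  have "wperm lam t ` {1..sum_list lam} = wperm lam t ` tlam lam ` nodes lam"
    using tlam_fill by (simp add: is_fill_def)
  also have "\<dots> = t ` nodes lam" unfolding image_image using wperm_tlam[OF t] by (intro image_cong) auto
  finally have im: "wperm lam t ` {1..sum_list lam} = {1..sum_list lam}" using t by (simp add: is_fill_def)
  then show "bij_betw (wperm lam t) {1..sum_list lam} {1..sum_list lam}"
    unfolding bij_betw_def using finite_surj_inj[of "{1..sum_list lam}" "wperm lam t"] by simp
qed (auto simp: wperm_def)

lemma wperm_perm:
  assumes "w permutes {1..sum_list lam}" shows "wperm lam (w \<circ> tlam lam) = w"
proof
  fix k show "wperm lam (w \<circ> tlam lam) k = w k"
    using fill_tinv[OF tlam_fill, of k lam] permutes_not_in[OF assms, of k] by (auto simp: wperm_def)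
qed

lemma sref_fill:
  assumes "is_fill lam t" "1 \<le> i" "i < sum_list lam" shows "is_fill lam (sref i \<circ> t)"
proof -
  have "sref i \<circ> wperm lam t permutes {1..sum_list lam}"
    using assms by (intro permutes_compose sref_permutes wperm_permutes)
  from perm_fill[OF this] show ?thesis using wperm_comp_tlam[OF assms(1)] by (simp add: comp_assoc)
qed

lemma wperm_sref:
  assumes "is_fill lam t" "1 \<le> i" "i < sum_list lam"
  shows "wperm lam (sref i \<circ> t) = sref i \<circ> wperm lam t"
proof -
  have "sref i \<circ> wperm lam t permutes {1..sum_list lam}"
    using assms by (intro permutes_compose sref_permutes wperm_permutes)
  from wperm_perm[OF this] show ?thesis using wperm_comp_tlam[OF assms(1)] by (simp add: comp_assoc)
qed

lemma tinv_sref: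
  assumes "is_fill lam t" "1 \<le> i" "i < sum_list lam" "1 \<le> k" "k \<le> sum_list lam"
  shows "tinv lam (sref i \<circ> t) k = tinv lam t (sref i k)"
proof -
  have "1 \<le> sref i k" "sref i k \<le> sum_list lam" using assms by (auto simp: sref_def)
  note a = fill_tinv[OF assms(1) this]
  show ?thesis using sref_fill[OF assms(1-3)] a by (intro fill_tinv_eq) auto
qed

lemma length_resseq [simp]: "length (resseq \<kappa> lam t) = sum_list lam"
  by (simp add: resseq_def One_nat_def del: upt_Suc)

lemma nth_resseq: "k < sum_list lam \<Longrightarrow> resseq \<kappa> lam t ! k = resn \<kappa> (tinv lam t (Suc k))"
  by (simp add: resseq_def One_nat_def del: upt_Suc)

lemma nth1_resseq: "1 \<le> k \<Longrightarrow> k \<le> sum_list lam \<Longrightarrow> nth1 (resseq \<kappa> lam t) k = resn \<kappa> (tinv lam t k)"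
  by (simp add: nth1_def nth_resseq)

lemma length_sw [simp]: "length (sw r \<nu>) = length \<nu>"
  by (simp add: sw_def)

lemma nth1_sw:
  assumes "1 \<le> r" "r < length \<nu>" "1 \<le> k" "k \<le> length \<nu>" shows "nth1 (sw r \<nu>) k = nth1 \<nu> (sref r k)"
  using assms by (auto simp: nth1_def sw_def sref_def nth_list_update)

lemma nth1_eqI:
  assumes "length \<mu> = length \<nu>" "\<And>k. 1 \<le> k \<Longrightarrow> k \<le> length \<mu> \<Longrightarrow> nth1 \<mu> k = nth1 \<nu> k" shows "\<mu> = \<nu>"
proof (rule nth_equalityI)
  fix i assume "i < length \<mu>"
  then show "\<mu> ! i = \<nu> ! i" using assms(2)[of "Suc i"] by (simp add: nth1_def)
qed fact

lemma resseq_sref: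
  assumes "is_fill lam t" "1 \<le> i" "i < sum_list lam"
  shows "resseq \<kappa> lam (sref i \<circ> t) = sw i (resseq \<kappa> lam t)"
proof (rule nth1_eqI)
  fix k assume k: "1 \<le> k" "k \<le> length (resseq \<kappa> lam (sref i \<circ> t))"
  then have "1 \<le> sref i k" "sref i k \<le> sum_list lam" using assms by (auto simp: sref_def)
  then show "nth1 (resseq \<kappa> lam (sref i \<circ> t)) k = nth1 (sw i (resseq \<kappa> lam t)) k"
    using k assms by (simp add: nth1_sw nth1_resseq tinv_sref)
qed simp

lemma mset_sw: "1 \<le> r \<Longrightarrow> r < length \<nu> \<Longrightarrow> mset (sw r \<nu>) = mset \<nu>"
  unfolding sw_def using mset_swap[of "r - 1" \<nu> r] list_update_swap[of "r - 1" r \<nu>] by simp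

lemma nth_sw_sw: "1 \<le> r \<Longrightarrow> r < length \<nu> \<Longrightarrow> sw r (sw r \<nu>) = \<nu>"
  by (rule nth1_eqI) (auto simp: nth1_sw sref_def)

lemma Ibeta_length: "\<nu> \<in> Ibeta \<kappa> lam \<Longrightarrow> length \<nu> = sum_list lam"
  unfolding Ibeta_def nu0_def using mset_eq_length by fastforce

lemma Ibeta_sw: "\<nu> \<in> Ibeta \<kappa> lam \<Longrightarrow> 1 \<le> r \<Longrightarrow> r < sum_list lam \<Longrightarrow> sw r \<nu> \<in> Ibeta \<kappa> lam"
  using mset_sw[of r \<nu>] Ibeta_length[of \<nu> \<kappa> lam] by (simp add: Ibeta_def)

lemma finite_Ibeta [simp]: "finite (Ibeta \<kappa> lam)"
  unfolding Ibeta_def by (rule finite_subset[of _ "{\<nu>. set \<nu> \<subseteq> set (nu0 \<kappa> lam) \<and> length \<nu> = length (nu0 \<kappa> lam)}"])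
    (auto simp: finite_lists_length_eq dest: mset_eq_setD mset_eq_length)

lemma nu0_Ibeta [simp]: "nu0 \<kappa> lam \<in> Ibeta \<kappa> lam"
  by (simp add: Ibeta_def)

lemma nu0_Iblock [simp]: "nu0 \<kappa> lam \<in> Iblock \<kappa> lam"
  by (simp add: Iblock_def nu0_def)

lemma concat_rowseg:
  assumes "length \<nu> = sum_list lam" "j \<le> length lam"
  shows "take (sum_list (take j lam)) \<nu> = concat (map (\<lambda>i. rowseg lam i \<nu>) [0..<j])"
  using assms(2)
proof (induction j)
  case (Suc j)
  then show ?case using sum_list_take_Suc[of j lam] by (simp add: take_add rowseg_def)
qed simp

text \<open>A sequence is the concatenation of its row segments, so equal content in every row adds
  up to equal content.\<close>

lemma Iblock_subset: "Iblock \<kappa> lam \<subseteq> Ibeta \<kappa> lam"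
proof
  fix \<nu> assume nu: "\<nu> \<in> Iblock \<kappa> lam"
  have e: "mset \<mu> = (\<Sum>i\<leftarrow>[0..<length lam]. mset (rowseg lam i \<mu>))" if "length \<mu> = sum_list lam" for \<mu> :: "nat list"
  proof -
    have "\<mu> = concat (map (\<lambda>i. rowseg lam i \<mu>) [0..<length lam])"
      using concat_rowseg[OF that, of "length lam"] that by simp
    then have "mset \<mu> = mset (concat (map (\<lambda>i. rowseg lam i \<mu>) [0..<length lam]))" by (rule arg_cong)
    also have "\<dots> = (\<Sum>i\<leftarrow>[0..<length lam]. mset (rowseg lam i \<mu>))" by (simp add: mset_concat o_def)
    finally show ?thesis .
  qed
  have "(\<Sum>i\<leftarrow>[0..<length lam]. mset (rowseg lam i \<nu>)) = (\<Sum>i\<leftarrow>[0..<length lam]. mset (rowseg lam i (nu0 \<kappa> lam)))"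
    using nu by (intro arg_cong[where f = sum_list] map_cong) (auto simp: Iblock_def)
  moreover have "length \<nu> = sum_list lam" using nu by (simp add: Iblock_def)
  moreover have "length (nu0 \<kappa> lam) = sum_list lam" by (simp add: nu0_def)
  ultimately show "\<nu> \<in> Ibeta \<kappa> lam" using e[of \<nu>] e[of "nu0 \<kappa> lam"] by (simp add: Ibeta_def)
qed

lemma finite_Iblock [simp]: "finite (Iblock \<kappa> lam)"
  using finite_subset[OF Iblock_subset finite_Ibeta] .

subsection \<open>Standard tableaux\<close>

lemma nodes_down:
  assumes p: "is_partition lam" and "(r, c) \<in> nodes lam" "1 \<le> r'" "r' \<le> r" "1 \<le> c'" "c' \<le> c"
  shows "(r', c') \<in> nodes lam"
proof -
  have "lam ! (r - 1) \<le> lam ! (r' - 1)"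
  proof -
    have "sorted_wrt (\<ge>) lam" using p by (simp add: is_partition_def sorted_wrt_rev)
    then show ?thesis using assms sorted_wrt_nth_less[of "(\<ge>)" lam "r' - 1" "r - 1"]
      by (cases "r' = r") (auto simp: nodes_def)
  qed
  then show ?thesis using assms by (auto simp: nodes_def)
qed

lemma nodes_pos: "(r, c) \<in> nodes lam \<Longrightarrow> 1 \<le> r \<and> 1 \<le> c"
  by (simp add: nodes_def)

lemma Std_row:
  assumes "is_partition lam"
    "\<And>r c. (r, c) \<in> nodes lam \<Longrightarrow> (r, Suc c) \<in> nodes lam \<Longrightarrow> t (r, c) < (t (r, Suc c) :: nat)"
    "(r, c') \<in> nodes lam" "1 \<le> c" "c \<le> c'"
  shows "t (r, c) \<le> t (r, c')"
  using assms(5,3)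
proof (induction c' rule: dec_induct)
  case (step m)
  have "(r, m) \<in> nodes lam" using nodes_down[OF assms(1) step.prems, of r m] step assms(4) nodes_pos[OF step.prems] by auto
  then show ?case using step assms(2)[of r m] by auto
qed simp

lemma Std_col:
  assumes "is_partition lam"
    "\<And>r c. (r, c) \<in> nodes lam \<Longrightarrow> (Suc r, c) \<in> nodes lam \<Longrightarrow> t (r, c) < (t (Suc r, c) :: nat)"
    "(r', c) \<in> nodes lam" "1 \<le> r" "r \<le> r'"
  shows "t (r, c) \<le> t (r', c)"
  using assms(5,3)
proof (induction r' rule: dec_induct)
  case (step m)
  have "(m, c) \<in> nodes lam" using nodes_down[OF assms(1) step.prems, of m c] step assms(4) nodes_pos[OF step.prems] by auto
  then show ?case using step assms(2)[of m c] by auto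
qed simp

lemma Std_mono_le:
  assumes "is_partition lam" "t \<in> Std lam" "(r', c') \<in> nodes lam" "1 \<le> r" "r \<le> r'" "1 \<le> c" "c \<le> c'"
  shows "t (r, c) \<le> t (r', c')"
proof -
  have "t (r, c) \<le> t (r, c')"
    using assms nodes_down[OF assms(1,3), of r c'] nodes_pos[OF assms(3)]
    by (intro Std_row[OF assms(1)]) (auto simp: Std_iff)
  also have "\<dots> \<le> t (r', c')" using assms by (intro Std_col[OF assms(1)]) (auto simp: Std_iff)
  finally show ?thesis .
qed

lemma Std_mono:
  assumes "is_partition lam" "t \<in> Std lam" "(r', c') \<in> nodes lam" "1 \<le> r" "r \<le> r'" "1 \<le> c" "c \<le> c'"
    "(r, c) \<noteq> (r', c')"
  shows "t (r, c) < t (r', c')"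
proof -
  have "(r, c) \<in> nodes lam" using nodes_down assms by metis
  then have "t (r, c) \<noteq> t (r', c')" using fill_inj[OF Std_fill[OF assms(2)]] assms by metis
  then show ?thesis using Std_mono_le[OF assms(1-7)] by simp
qed

lemma tlam_Std: "tlam lam \<in> Std lam"
  by (auto simp: Std_iff tlam_fill tlam_less_iff)

text \<open>The neighbours of A to the right and below both lie weakly northwest of B, so their two
  different entries fit strictly between those of A and B.\<close>

lemma Std_same_diagonal:
  assumes p: "is_partition lam" and t: "t \<in> Std lam" and A: "A \<in> nodes lam" and B: "B \<in> nodes lam"
    and c: "cont \<kappa> A = cont \<kappa> B" and l: "t A < t B"
  shows "t A + 2 < t B"
proof -
  obtain a b a' b' where AB: "A = (a, b)" "B = (a', b')" by (metis surj_pair)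
  have ab: "int b - int a = int b' - int a'" using c AB by (simp add: cont_def)
  have pos: "1 \<le> a" "1 \<le> b" "1 \<le> a'" "1 \<le> b'" using nodes_pos A B AB by auto
  have "a < a'"
  proof (rule ccontr)
    assume "\<not> a < a'"
    then have "a' \<le> a" "b' \<le> b" using ab by auto
    then have "t B \<le> t A" using Std_mono_le[OF p t, of a b a' b'] A AB pos by auto
    then show False using l by simp
  qed
  then have lt: "a < a'" "b < b'" using ab by auto
  have N: "(a, Suc b) \<in> nodes lam" "(Suc a, b) \<in> nodes lam"
    using nodes_down[OF p, of a' b'] B AB lt pos by auto
  have "t A < t (a, Suc b)" "t A < t (Suc a, b)" using Std_mono[OF p t N(1), of a b] Std_mono[OF p t N(2), of a b] AB pos by auto
  moreover have "t (a, Suc b) < t B" "t (Suc a, b) < t B"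
    using Std_mono[OF p t, of a' b' a "Suc b"] Std_mono[OF p t, of a' b' "Suc a" b] B AB lt pos by auto
  moreover have "t (a, Suc b) \<noteq> t (Suc a, b)" using fill_inj[OF Std_fill[OF t] N] by simp
  ultimately show ?thesis by linarith
qed

text \<open>Three consecutive entries thus have distinct contents, which the seminormal form
  requires in the commutation of x's with \<psi>'s and in the braid relation.\<close>

lemma Std_cont_distinct:
  assumes p: "is_partition lam" and t: "t \<in> Std lam" and k: "1 \<le> k" "k < m" "m \<le> k + 2" "m \<le> sum_list lam"
  shows "cont \<kappa> (tinv lam t k) \<noteq> cont \<kappa> (tinv lam t m)"
proof
  note f = Std_fill[OF t]
  assume e: "cont \<kappa> (tinv lam t k) = cont \<kappa> (tinv lam t m)"
  have K: "tinv lam t k \<in> nodes lam" "t (tinv lam t k) = k" using fill_tinv[OF f, of k] k by auto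
  have M: "tinv lam t m \<in> nodes lam" "t (tinv lam t m) = m" using fill_tinv[OF f, of m] k by auto
  from Std_same_diagonal[OF p t K(1) M(1) e] show False using K M k by simp
qed

text \<open>Standardness compares only neighbouring nodes, whose contents differ by 1, and s_i
  reverses no order except that of the entries i and i + 1.\<close>

lemma Std_sref:
  assumes t: "t \<in> Std lam" and i: "1 \<le> i" "i < sum_list lam"
    and d: "\<bar>cont \<kappa> (tinv lam t i) - cont \<kappa> (tinv lam t (Suc i))\<bar> \<noteq> 1"
  shows "sref i \<circ> t \<in> Std lam"
proof -
  note f = Std_fill[OF t]
  have key: "sref i (t A) < sref i (t B)"
    if "A \<in> nodes lam" "B \<in> nodes lam" "t A < t B" "\<bar>cont \<kappa> A - cont \<kappa> B\<bar> = 1" for A B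
  proof -
    have "\<not> (t A = i \<and> t B = Suc i)" using d that fill_tinv_eq[OF f] by metis
    then show ?thesis using that(3) by (auto simp: sref_def)
  qed
  show ?thesis using t sref_fill[OF f i] by (auto simp: Std_iff intro!: key) (auto simp: cont_def)
qed

text \<open>The first letter of a reduced word of \<open>w\<^sup>t\<close> swaps two entries whose nodes are
  neither in the same row nor in the same column, so it leads to a standard tableau.\<close>
lemma Std_rword_Cons:
  assumes p: "is_partition lam" and t: "t \<in> Std lam" and rw: "rword (sum_list lam) (i # js) (wperm lam t)"
  defines "s \<equiv> sref i \<circ> t"
  shows "s \<in> Std lam" "rword (sum_list lam) js (wperm lam s)" "t = sref i \<circ> s" "1 \<le> i" "i < sum_list lam"
    "fst (tinv lam s i) < fst (tinv lam s (Suc i))"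
    "\<bar>cont \<kappa> (tinv lam s i) - cont \<kappa> (tinv lam s (Suc i))\<bar> \<ge> 2"
    "\<bar>cont \<kappa> (tinv lam t i) - cont \<kappa> (tinv lam t (Suc i))\<bar> \<ge> 2"
proof -
  let ?n = "sum_list lam"
  note f = Std_fill[OF t]
  show i: "1 \<le> i" "i < ?n" using rword_ConsD[OF rw] by auto
  have sf: "is_fill lam s" unfolding s_def by (rule sref_fill[OF f i])
  have ws: "wperm lam s = sref i \<circ> wperm lam t" unfolding s_def by (rule wperm_sref[OF f i])
  show "rword ?n js (wperm lam s)" using rword_ConsD(4)[OF rw] ws by simp
  show ts: "t = sref i \<circ> s" by (simp add: s_def fun_eq_iff)
  obtain q r where qr: "1 \<le> q" "q < r" "r \<le> ?n" "wperm lam s q = i" "wperm lam s r = Suc i"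
    using rword_ConsD(1,5)[OF rw] ws by auto
  define A B where "A = tinv lam (tlam lam) q" and "B = tinv lam (tlam lam) r"
  have AB: "A \<in> nodes lam" "B \<in> nodes lam" "tlam lam A = q" "tlam lam B = r"
    using fill_tinv[OF tlam_fill, of q lam] fill_tinv[OF tlam_fill, of r lam] qr by (auto simp: A_def B_def)
  have sAB: "s A = i" "s B = Suc i"
    using wperm_tlam[OF sf AB(1)] wperm_tlam[OF sf AB(2)] AB(3,4) qr(4,5) by simp_all
  then have tAB: "t A = Suc i" "t B = i" by (simp_all add: ts sref_def)
  have si: "tinv lam s i = A" "tinv lam s (Suc i) = B" using fill_tinv_eq[OF sf] AB sAB by auto
  have ti: "tinv lam t (Suc i) = A" "tinv lam t i = B" using fill_tinv_eq[OF f] AB tAB by auto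
  obtain a b a' b' where ab: "A = (a, b)" "B = (a', b')" by (metis surj_pair)
  have pos: "1 \<le> a" "1 \<le> b" "1 \<le> a'" "1 \<le> b'" using nodes_pos AB ab by auto
  have "tlam lam A < tlam lam B" using AB qr by simp
  then have o: "a < a' \<or> a = a' \<and> b < b'" using tlam_less_iff[OF AB(1,2)] ab by simp
  have 1: "\<not> (a \<le> a' \<and> b \<le> b')"
    using Std_mono_le[OF p t, of a' b' a b] AB pos ab tAB by auto
  then have lt: "a < a'" "b' < b" using o by auto
  then show "fst (tinv lam s i) < fst (tinv lam s (Suc i))" using si ab by simp
  show d: "\<bar>cont \<kappa> (tinv lam s i) - cont \<kappa> (tinv lam s (Suc i))\<bar> \<ge> 2"
    "\<bar>cont \<kappa> (tinv lam t i) - cont \<kappa> (tinv lam t (Suc i))\<bar> \<ge> 2"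
    using si ti ab lt by (auto simp: cont_def)
  show "s \<in> Std lam" unfolding s_def by (rule Std_sref[OF t i, of \<kappa>]) (use d in auto)
qed

subsection \<open>Garnir tableaux\<close>

lemma internal_nodes:
  assumes "internal lam r"
  shows "\<exists>a b. (a, b) \<in> nodes lam \<and> (a, Suc b) \<in> nodes lam \<and> tlam lam (a, b) = r \<and> tlam lam (a, Suc b) = Suc r"
proof -
  obtain i where i: "i < length lam" "sum_list (take i lam) < r" "Suc r \<le> sum_list (take (Suc i) lam)"
    using assms by (auto simp: internal_def)
  show ?thesis using i sum_list_take_Suc[of i lam]
    by (intro exI[of _ "Suc i"] exI[of _ "r - sum_list (take i lam)"]) (auto simp: nodes_def tlam_def)
qed

lemma nodes_internal:
  assumes "(a, b) \<in> nodes lam" "(a, Suc b) \<in> nodes lam"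
  shows "internal lam (tlam lam (a, b))" "tlam lam (a, Suc b) = Suc (tlam lam (a, b))"
proof -
  show *: "tlam lam (a, Suc b) = Suc (tlam lam (a, b))" using assms by (simp add: tlam_def)
  have "a - 1 < length lam" "Suc (a - 1) = a" using assms by (auto simp: nodes_def)
  then show "internal lam (tlam lam (a, b))"
    using tlam_bounds[OF assms(1)] tlam_bounds[OF assms(2)] * unfolding internal_def
    by (intro exI[of _ "a - 1"]) auto
qed

definition belt :: "nat list \<Rightarrow> nat \<times> nat \<Rightarrow> (nat \<times> nat) set" where
  "belt lam A = {B \<in> nodes lam. fst B = fst A \<and> snd A \<le> snd B \<or> fst B = Suc (fst A) \<and> snd B \<le> snd A}"

context
  fixes lam :: "nat list" and a c p q :: nat
  assumes part: "is_partition lam" and A: "(a, c) \<in> garnir_nodes lam"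
    and p_def: "p = tlam lam (a, c)" and q_def: "q = tlam lam (Suc a, c)"
begin

lemma garnir_nodes_in: "(a, c) \<in> nodes lam" "(Suc a, c) \<in> nodes lam" "1 \<le> a" "1 \<le> c"
  using A nodes_pos by (auto simp: garnir_nodes_def)

lemma belt_iff: "B \<in> nodes lam \<Longrightarrow> B \<in> belt lam (a, c) \<longleftrightarrow> p \<le> tlam lam B \<and> tlam lam B \<le> q"
  using tlam_less_iff[of B lam "(a, c)"] tlam_less_iff[of "(Suc a, c)" lam B] garnir_nodes_in
  by (auto simp: belt_def p_def q_def not_less[symmetric])

text \<open>In terms of contents, the entry at B is \<open>cont \<kappa> B\<close> plus the constant
  p + a - \<kappa>. The contents of the belt nodes are consecutive integers without repetition, and
  the Garnir tableau fills the belt in order of content.\<close>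

lemma garnir_belt:
  assumes "B \<in> belt lam (a, c)"
  shows "garnir lam (a, c) B + fst B = p + a + snd B"
  using assms garnir_nodes_in nodes_pos[of "fst B" "snd B" lam]
  by (auto simp: belt_def garnir_def p_def)

lemma garnir_off_belt: "B \<notin> belt lam (a, c) \<Longrightarrow> garnir lam (a, c) B = tlam lam B"
  using nodes_down[OF part garnir_nodes_in(2), of "Suc a" "snd B"] 
  by (cases B) (auto simp: belt_def garnir_def)

lemma belt_length: "q = p + lam ! (a - 1)"
proof -
  have "a - 1 < length lam" "Suc (a - 1) = a" using garnir_nodes_in by (auto simp: nodes_def)
  then show ?thesis
    using garnir_nodes_in sum_list_take_Suc[of "a - 1" lam] by (simp add: p_def q_def tlam_def)
qed

lemma garnir_belt_bounds:
  assumes "B \<in> belt lam (a, c)"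
  shows "p \<le> garnir lam (a, c) B" "garnir lam (a, c) B \<le> q"
proof -
  have B: "B \<in> nodes lam" using assms by (simp add: belt_def)
  note q = belt_length
  show "p \<le> garnir lam (a, c) B" "garnir lam (a, c) B \<le> q"
    using garnir_belt[OF assms] assms B garnir_nodes_in q by (auto simp: belt_def nodes_def)
qed

lemma garnir_fill: "is_fill lam (garnir lam (a, c))"
proof -
  let ?g = "garnir lam (a, c)"
  have b: "(B \<in> belt lam (a, c)) = (p \<le> ?g B \<and> ?g B \<le> q)" if "B \<in> nodes lam" for B
    using that belt_iff garnir_belt_bounds garnir_off_belt by (cases "B \<in> belt lam (a, c)") auto
  have inj: "inj_on ?g (nodes lam)"
  proof (rule inj_onI)
    fix B C assume B: "B \<in> nodes lam" and C: "C \<in> nodes lam" and e: "?g B = ?g C"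
    then have bc: "B \<in> belt lam (a, c) \<longleftrightarrow> C \<in> belt lam (a, c)" using b by metis
    show "B = C"
    proof (cases "B \<in> belt lam (a, c)")
      case True
      then show ?thesis using garnir_belt[of B] garnir_belt[of C] bc e
        by (auto simp: belt_def prod_eq_iff)
    next
      case False
      then show ?thesis using garnir_off_belt bc e fill_inj[OF tlam_fill B C] by metis
    qed
  qed
  have sub: "?g ` nodes lam \<subseteq> {1..sum_list lam}"
  proof (rule image_subsetI)
    fix B assume B: "B \<in> nodes lam"
    have "1 \<le> p" "q \<le> sum_list lam" using fill_range[OF tlam_fill] garnir_nodes_in by (auto simp: p_def q_def)
    then show "?g B \<in> {1..sum_list lam}"
      using garnir_belt_bounds[of B] garnir_off_belt[of B] fill_range[OF tlam_fill B]
      by (cases "B \<in> belt lam (a, c)") auto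
  qed
  have "card (?g ` nodes lam) = card (tlam lam ` nodes lam)"
    using card_image[OF inj] card_image[of "tlam lam" "nodes lam"] tlam_fill[of lam]
    unfolding is_fill_def by metis
  also have "\<dots> = sum_list lam" using tlam_fill[of lam] unfolding is_fill_def by simp
  finally have "?g ` nodes lam = {1..sum_list lam}" using sub by (intro card_subset_eq) auto
  moreover have "?g B = 0" if "B \<notin> nodes lam" for B
    using that garnir_off_belt[of B] by (auto simp: belt_def tlam_def)
  ultimately show ?thesis using inj by (simp add: is_fill_def)
qed

text \<open>Off the belt nothing moves, belt entries stay within {p..q}, and each row keeps its
  order. Only a node of the upper row against one of the lower row can be inverted.\<close>

lemma garnir_invs:
  assumes "(x, y) \<in> invs (sum_list lam) (wperm lam (garnir lam (a, c)))"
  shows "\<exists>b d. (a, b) \<in> nodes lam \<and> (Suc a, d) \<in> nodes lam \<and> c \<le> b \<and> d \<le> c \<and>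
    x = tlam lam (a, b) \<and> y = tlam lam (Suc a, d)"
proof -
  let ?g = "garnir lam (a, c)"
  have xy: "1 \<le> x" "x < y" "y \<le> sum_list lam" "wperm lam ?g y < wperm lam ?g x"
    using assms by (auto simp: invs_def)
  define B C where "B = tinv lam (tlam lam) x" and "C = tinv lam (tlam lam) y"
  have BC: "B \<in> nodes lam" "C \<in> nodes lam" "tlam lam B = x" "tlam lam C = y"
    using fill_tinv[OF tlam_fill, of x lam] fill_tinv[OF tlam_fill, of y lam] xy by (auto simp: B_def C_def)
  have g: "?g C < ?g B" "tlam lam B < tlam lam C"
    using wperm_tlam[OF garnir_fill BC(1)] wperm_tlam[OF garnir_fill BC(2)] xy BC(3,4) by simp_all
  have cases: "B \<in> belt lam (a, c) \<and> p \<le> ?g B \<and> ?g B \<le> q \<or> ?g B = tlam lam B \<and> (tlam lam B < p \<or> q < tlam lam B)"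
    "C \<in> belt lam (a, c) \<and> p \<le> ?g C \<and> ?g C \<le> q \<or> ?g C = tlam lam C \<and> (tlam lam C < p \<or> q < tlam lam C)"
    using belt_iff[OF BC(1)] belt_iff[OF BC(2)] garnir_belt_bounds garnir_off_belt by (metis not_less)+
  have bB: "B \<in> belt lam (a, c) \<longrightarrow> p \<le> tlam lam B \<and> tlam lam B \<le> q"
    and bC: "C \<in> belt lam (a, c) \<longrightarrow> p \<le> tlam lam C \<and> tlam lam C \<le> q"
    using belt_iff[OF BC(1)] belt_iff[OF BC(2)] by auto
  have belt: "B \<in> belt lam (a, c)" "C \<in> belt lam (a, c)" using cases bB bC g by linarith+
  obtain b1 b2 c1 c2 where bc: "B = (b1, b2)" "C = (c1, c2)" by (metis surj_pair)
  have "b1 = a \<and> c \<le> b2 \<and> c1 = Suc a \<and> c2 \<le> c"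
    using belt garnir_belt[OF belt(1)] garnir_belt[OF belt(2)] g tlam_less_iff[OF BC(1,2)] bc
    by (auto simp: belt_def)
  then show ?thesis using BC bc by auto
qed

lemma garnir_invs_belt: "invs (sum_list lam) (wperm lam (garnir lam (a, c))) \<subseteq> {p..q} \<times> {p..q}"
proof
  fix z assume z: "z \<in> invs (sum_list lam) (wperm lam (garnir lam (a, c)))"
  obtain x y where xy: "z = (x, y)" by (cases z)
  obtain b d where b: "(a, b) \<in> nodes lam" "(Suc a, d) \<in> nodes lam" "c \<le> b" "d \<le> c"
    "x = tlam lam (a, b)" "y = tlam lam (Suc a, d)"
    using garnir_invs z xy by metis
  then show "z \<in> {p..q} \<times> {p..q}"
    using belt_iff[OF b(1)] belt_iff[OF b(2)] xy by (auto simp: belt_def)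
qed

text \<open>A column violation at (a, c) spreads along both rows: all entries in the lower part of
  the belt are smaller than all entries in the upper part. By \<open>rword_right_factor\<close> the
  Garnir word then sits at the right end of a word for \<open>wperm lam t\<close>.\<close>

lemma garnir_invs_subset:
  assumes t: "is_fill lam t"
    and row: "\<And>r c. (r, c) \<in> nodes lam \<Longrightarrow> (r, Suc c) \<in> nodes lam \<Longrightarrow> t (r, c) < t (r, Suc c)"
    and v: "t (Suc a, c) < t (a, c)"
  shows "invs (sum_list lam) (wperm lam (garnir lam (a, c))) \<subseteq> invs (sum_list lam) (wperm lam t)"
proof
  fix z assume z: "z \<in> invs (sum_list lam) (wperm lam (garnir lam (a, c)))"
  obtain x y where xy: "z = (x, y)" by (cases z)
  obtain b d where b: "(a, b) \<in> nodes lam" "(Suc a, d) \<in> nodes lam" "c \<le> b" "d \<le> c"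
    "x = tlam lam (a, b)" "y = tlam lam (Suc a, d)"
    using garnir_invs z xy by metis
  have "t (Suc a, d) \<le> t (Suc a, c)"
    using b nodes_pos garnir_nodes_in by (intro Std_row[OF part row]) auto
  also have "\<dots> < t (a, c)" by (rule v)
  also have "\<dots> \<le> t (a, b)" using b garnir_nodes_in by (intro Std_row[OF part row]) auto
  finally show "z \<in> invs (sum_list lam) (wperm lam t)"
    using z xy wperm_tlam[OF t b(1)] wperm_tlam[OF t b(2)] b(5,6) by (auto simp: invs_def)
qed

text \<open>On the belt the contents are distinct and \<open>\<tau>\<close> below takes the value \<open>\<plusminus>cont\<close> at each
  node. If \<open>(a, c)\<close> precedes \<open>(a + 1, c)\<close>, the value \<open>\<tau> = -cont\<close> occurs at the one of nonzero content
  further from \<open>0\<close>, and the node of opposite content is then out of order in its row.\<close>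
lemma no_Std_with_garnir_residues:
  assumes t: "t \<in> Std lam" and off: "\<And>B. B \<in> nodes lam \<Longrightarrow> B \<notin> belt lam (a, c) \<Longrightarrow> t B = tlam lam B"
    and res: "resseq \<kappa> lam t = resseq \<kappa> lam (garnir lam (a, c))"
  shows False
proof -
  let ?n = "sum_list lam"
  let ?g = "garnir lam (a, c)"
  note f = Std_fill[OF t]
  \<comment> \<open>The entries off the belt are those of \<open>tlam lam\<close>, so the belt
    carries the remaining ones, p to q.\<close>
  have bounds: "p \<le> t B \<and> t B \<le> q" if B: "B \<in> belt lam (a, c)" for B
  proof (rule ccontr)
    assume n: "\<not> (p \<le> t B \<and> t B \<le> q)"
    have Bn: "B \<in> nodes lam" using B by (simp add: belt_def)
    have r: "1 \<le> t B" "t B \<le> ?n" using fill_range[OF f Bn] by auto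
    define C where "C = tinv lam (tlam lam) (t B)"
    have C: "C \<in> nodes lam" "tlam lam C = t B" using fill_tinv[OF tlam_fill r] by (auto simp: C_def)
    then have "C \<notin> belt lam (a, c)" using n belt_iff by auto
    then have "t C = t B" using off C by simp
    then have "C = B" using fill_inj[OF f C(1) Bn] by simp
    then show False using \<open>C \<notin> belt lam (a, c)\<close> B by simp
  qed
  \<comment> \<open>\<open>\<tau> B\<close> is the content of the node that holds the entry
    \<open>t B\<close> in the Garnir tableau. Equal residue sequences therefore allow only
    \<open>cont \<kappa> B\<close> or its negative.\<close>
  define \<tau> where "\<tau> B = \<kappa> - int a + (int (t B) - int p)" for B
  have tau: "\<tau> B = cont \<kappa> B \<or> \<tau> B = - cont \<kappa> B" if B: "B \<in> belt lam (a, c)" for B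
  proof -
    have Bn: "B \<in> nodes lam" using B by (simp add: belt_def)
    have r: "1 \<le> t B" "t B \<le> ?n" using fill_range[OF f Bn] by auto
    define C where "C = tinv lam ?g (t B)"
    have C: "C \<in> nodes lam" "?g C = t B" using fill_tinv[OF garnir_fill r] by (auto simp: C_def)
    then have Cb: "C \<in> belt lam (a, c)" using bounds[OF B] belt_iff[OF C(1)] garnir_off_belt[of C] by auto
    then have "\<tau> B = cont \<kappa> C" using garnir_belt[OF Cb] C(2) by (simp add: cont_def \<tau>_def)
    moreover have "resn \<kappa> B = resn \<kappa> C"
      using arg_cong[OF res, of "\<lambda>\<nu>. nth1 \<nu> (t B)"] r f Bn by (simp add: nth1_resseq C_def)
    ultimately show ?thesis by (auto simp: resn_cont)
  qed
  have inj: "\<tau> B \<noteq> \<tau> C" if "B \<in> nodes lam" "C \<in> nodes lam" "B \<noteq> C" for B C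
    using fill_inj[OF f that(1,2)] that(3) by (simp add: \<tau>_def)
  have less: "\<tau> B < \<tau> C \<longleftrightarrow> t B < t C" for B C by (simp add: \<tau>_def)
  define k where "k = \<kappa> + int c - int a"
  have b1: "(a, c) \<in> belt lam (a, c)" "(Suc a, c) \<in> belt lam (a, c)" using garnir_nodes_in by (auto simp: belt_def)
  have k1: "\<tau> (a, c) = k \<or> \<tau> (a, c) = - k" "\<tau> (Suc a, c) = k - 1 \<or> \<tau> (Suc a, c) = 1 - k"
    using tau[OF b1(1)] tau[OF b1(2)] by (auto simp: cont_def k_def)
  have lt: "\<tau> (a, c) < \<tau> (Suc a, c)"
    using t garnir_nodes_in less by (auto simp: Std_iff)
  have qp: "int q - int p = int (lam ! (a - 1))"
    using belt_length by simp
  show False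
  proof (cases "1 \<le> k")
    case True
    then have e: "\<tau> (a, c) = - k" using k1 lt by auto
    \<comment> \<open>Row a + 1 has content -k in column b. The value -k of \<open>\<tau>\<close> is
      already taken at (a, c), so this node gets the value k.\<close>
    define b where "b = nat (int (Suc a) - k - \<kappa>)"
    have "- k \<ge> \<kappa> - int a" using e bounds[OF b1(1)] by (simp add: \<tau>_def)
    then have b: "int b = int (Suc a) - k - \<kappa>" "1 \<le> b" by (auto simp: b_def)
    then have bc: "b < c" using True by (simp add: k_def)
    have N: "(Suc a, b) \<in> nodes lam" using nodes_down[OF part garnir_nodes_in(2)] b(2) bc by auto
    then have B: "(Suc a, b) \<in> belt lam (a, c)" using bc by (simp add: belt_def)
    have "\<tau> (Suc a, b) = k"
      using tau[OF B] inj[OF N garnir_nodes_in(1)] e b by (auto simp: cont_def)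
    moreover have "\<tau> (Suc a, b) < \<tau> (Suc a, c)"
      using Std_mono[OF part t garnir_nodes_in(2)] b(2) bc less by auto
    ultimately show False using k1 True by auto
  next
    case False
    then have e: "\<tau> (Suc a, c) = 1 - k" using k1 lt by auto
    \<comment> \<open>Row a has content 1 - k in column b. That value of \<open>\<tau>\<close> is
      already taken at (a + 1, c), so this node gets the value k - 1.\<close>
    define b where "b = nat (int a + 1 - k - \<kappa>)"
    have up: "1 - k \<le> \<kappa> - int a + int (lam ! (a - 1))" using e bounds[OF b1(2)] qp by (simp add: \<tau>_def)
    have "int c < int a + 1 - k - \<kappa>" using False by (simp add: k_def)
    then have b: "int b = int a + 1 - k - \<kappa>" "c < b" by (auto simp: b_def)
    have N: "(a, b) \<in> nodes lam" using garnir_nodes_in b up by (auto simp: nodes_def)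
    then have B: "(a, b) \<in> belt lam (a, c)" using b by (simp add: belt_def)
    have "\<tau> (a, b) = k - 1"
      using tau[OF B] inj[OF N garnir_nodes_in(2)] e b by (auto simp: cont_def)
    moreover have "\<tau> (a, c) < \<tau> (a, b)"
      using Std_mono[OF part t N] garnir_nodes_in b(2) less by auto
    ultimately show False using k1 False by auto
  qed
qed

end

subsection \<open>Degrees of standard tableaux\<close>

lemma is_diag_iff:
  "is_diag D \<longleftrightarrow> finite D \<and> (\<forall>r c. (r, c) \<in> D \<longrightarrow> 1 \<le> r \<and> 1 \<le> c \<and> (r = 1 \<or> (r - 1, c) \<in> D) \<and> (c = 1 \<or> (r, c - 1) \<in> D))"
  (is "_ \<longleftrightarrow> finite D \<and> ?R")
proof
  assume d: "is_diag D"
  have *: "1 \<le> r \<and> 1 \<le> c \<and> (\<forall>r' c'. 1 \<le> r' \<longrightarrow> r' \<le> r \<longrightarrow> 1 \<le> c' \<longrightarrow> c' \<le> c \<longrightarrow> (r', c') \<in> D)"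
    if "(r, c) \<in> D" for r c using d that unfolding is_diag_def by blast
  show "finite D \<and> ?R"
  proof (intro conjI allI impI)
    show "finite D" using d by (simp add: is_diag_def)
    fix r c assume rc: "(r, c) \<in> D"
    note a = *[OF rc]
    show "1 \<le> r" "1 \<le> c" using a by auto
    show "r = 1 \<or> (r - 1, c) \<in> D" using a by (cases "r = 1") auto
    show "c = 1 \<or> (r, c - 1) \<in> D" using a by (cases "c = 1") auto
  qed
next
  assume R: "finite D \<and> ?R"
  have row: "(r', c) \<in> D" if "r' \<le> r" "1 \<le> r'" "(r, c) \<in> D" for r r' c
    using that
  proof (induction r rule: dec_induct)
    case (step m)
    have "Suc m = 1 \<or> (Suc m - 1, c) \<in> D" using R step.prems by blast
    then show ?case using step by (auto simp: One_nat_def)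
  qed simp
  have col: "(r, c') \<in> D" if "c' \<le> c" "1 \<le> c'" "(r, c) \<in> D" for r c c'
    using that
  proof (induction c rule: dec_induct)
    case (step m)
    have "Suc m = 1 \<or> (r, Suc m - 1) \<in> D" using R step.prems by blast
    then show ?case using step by (auto simp: One_nat_def)
  qed simp
  show "is_diag D" unfolding is_diag_def using R row col by blast
qed

lemma diag_down:
  assumes "is_diag D" "(r, c) \<in> D" "1 \<le> r'" "r' \<le> r" "1 \<le> c'" "c' \<le> c" shows "(r', c') \<in> D"
  using assms unfolding is_diag_def by blast

lemma diag_nbrs:
  assumes "is_diag D"
  shows "(r, c) \<in> D \<Longrightarrow> 1 \<le> r" "(r, c) \<in> D \<Longrightarrow> 1 \<le> c"
    "1 \<le> r \<Longrightarrow> (Suc r, c) \<in> D \<Longrightarrow> (r, c) \<in> D" "1 \<le> c \<Longrightarrow> (r, Suc c) \<in> D \<Longrightarrow> (r, c) \<in> D"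
proof -
  have "\<forall>r c. (r, c) \<in> D \<longrightarrow> 1 \<le> r \<and> 1 \<le> c \<and> (r = 1 \<or> (r - 1, c) \<in> D) \<and> (c = 1 \<or> (r, c - 1) \<in> D)"
    using assms is_diag_iff by blast
  then show "(r, c) \<in> D \<Longrightarrow> 1 \<le> r" "(r, c) \<in> D \<Longrightarrow> 1 \<le> c"
    "1 \<le> r \<Longrightarrow> (Suc r, c) \<in> D \<Longrightarrow> (r, c) \<in> D" "1 \<le> c \<Longrightarrow> (r, Suc c) \<in> D \<Longrightarrow> (r, c) \<in> D"
    by (force simp: One_nat_def)+
qed

lemma addable_iff:
  assumes "is_diag D"
  shows "(r, c) \<in> addable D \<longleftrightarrow> (r, c) \<notin> D \<and> 1 \<le> r \<and> 1 \<le> c \<and> (r = 1 \<or> (r - 1, c) \<in> D) \<and> (c = 1 \<or> (r, c - 1) \<in> D)"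
proof -
  have D: "finite D \<and> (\<forall>r c. (r, c) \<in> D \<longrightarrow> 1 \<le> r \<and> 1 \<le> c \<and> (r = 1 \<or> (r - 1, c) \<in> D) \<and> (c = 1 \<or> (r, c - 1) \<in> D))"
    using assms is_diag_iff by blast
  show ?thesis
    unfolding addable_def mem_Collect_eq is_diag_iff
  proof (intro iffI)
    assume a: "(r, c) \<notin> D \<and> finite (insert (r, c) D) \<and> (\<forall>ra ca. (ra, ca) \<in> insert (r, c) D \<longrightarrow> 1 \<le> ra \<and> 1 \<le> ca \<and>
      (ra = 1 \<or> (ra - 1, ca) \<in> insert (r, c) D) \<and> (ca = 1 \<or> (ra, ca - 1) \<in> insert (r, c) D))"
    then have "1 \<le> r \<and> 1 \<le> c \<and> (r = 1 \<or> (r - 1, c) \<in> insert (r, c) D) \<and> (c = 1 \<or> (r, c - 1) \<in> insert (r, c) D)" by blast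
    then show "(r, c) \<notin> D \<and> 1 \<le> r \<and> 1 \<le> c \<and> (r = 1 \<or> (r - 1, c) \<in> D) \<and> (c = 1 \<or> (r, c - 1) \<in> D)"
      using a by auto
  next
    assume "(r, c) \<notin> D \<and> 1 \<le> r \<and> 1 \<le> c \<and> (r = 1 \<or> (r - 1, c) \<in> D) \<and> (c = 1 \<or> (r, c - 1) \<in> D)"
    then show "(r, c) \<notin> D \<and> finite (insert (r, c) D) \<and> (\<forall>ra ca. (ra, ca) \<in> insert (r, c) D \<longrightarrow> 1 \<le> ra \<and> 1 \<le> ca \<and>
      (ra = 1 \<or> (ra - 1, ca) \<in> insert (r, c) D) \<and> (ca = 1 \<or> (ra, ca - 1) \<in> insert (r, c) D))"
      using D by blast
  qed
qed

lemma removable_iff: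
  assumes "is_diag D"
  shows "(r, c) \<in> removable D \<longleftrightarrow> (r, c) \<in> D \<and> (Suc r, c) \<notin> D \<and> (r, Suc c) \<notin> D"
proof -
  have D: "finite D" "\<And>r c. (r, c) \<in> D \<Longrightarrow> 1 \<le> r \<and> 1 \<le> c \<and> (r = 1 \<or> (r - 1, c) \<in> D) \<and> (c = 1 \<or> (r, c - 1) \<in> D)"
    using assms is_diag_iff by blast+
  show ?thesis
  proof
    assume a: "(r, c) \<in> removable D"
    then have rc: "(r, c) \<in> D" and d: "is_diag (D - {(r, c)})" by (auto simp: removable_def)
    note pos = D(2)[OF rc]
    show "(r, c) \<in> D \<and> (Suc r, c) \<notin> D \<and> (r, Suc c) \<notin> D"
      using diag_nbrs(3)[OF d, of r c] diag_nbrs(4)[OF d, of c r] pos rc by auto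
  next
    assume a: "(r, c) \<in> D \<and> (Suc r, c) \<notin> D \<and> (r, Suc c) \<notin> D"
    have "is_diag (D - {(r, c)})" unfolding is_diag_iff
    proof (intro conjI allI impI)
      fix x y assume xy: "(x, y) \<in> D - {(r, c)}"
      then have p: "1 \<le> x \<and> 1 \<le> y \<and> (x = 1 \<or> (x - 1, y) \<in> D) \<and> (y = 1 \<or> (x, y - 1) \<in> D)" using D(2) by blast
      then show "1 \<le> x" "1 \<le> y" by auto
      have "(x - 1, y) \<noteq> (r, c)" "(x, y - 1) \<noteq> (r, c)" using xy a p by (auto simp: One_nat_def)
      then show "x = 1 \<or> (x - 1, y) \<in> D - {(r, c)}" "y = 1 \<or> (x, y - 1) \<in> D - {(r, c)}" using p by auto
    qed (use D in simp)
    then show "(r, c) \<in> removable D" using a by (simp add: removable_def)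
  qed
qed

context
  fixes D :: "(nat \<times> nat) set" and r c :: nat
  assumes D: "is_diag D" and B: "(r, c) \<notin> D" and DB: "is_diag (insert (r, c) D)"
begin

lemma addable_insert:
  "addable (insert (r, c) D) = (addable D - {(r, c)}) \<union> {x. x = (r, Suc c) \<and> (r = 1 \<or> (r - 1, Suc c) \<in> D)}
     \<union> {x. x = (Suc r, c) \<and> (c = 1 \<or> (Suc r, c - 1) \<in> D)}" (is "?L = ?R")
proof -
  have rc: "1 \<le> r" "1 \<le> c" using diag_nbrs[OF DB] by blast+
  have nD: "(r, Suc c) \<notin> D" "(Suc r, c) \<notin> D" using diag_nbrs(3,4)[OF D] rc B by blast+
  have "(x, y) \<in> ?L \<longleftrightarrow> (x, y) \<in> ?R" for x y
    using rc nD B by (auto simp: addable_iff[OF DB] addable_iff[OF D] One_nat_def)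
  then show ?thesis by auto
qed

lemma removable_insert:
  "removable (insert (r, c) D) = insert (r, c) (removable D - {(r, c - 1), (r - 1, c)})" (is "?L = ?R")
proof -
  have rc: "1 \<le> r" "1 \<le> c" using diag_nbrs[OF DB] by blast+
  have nD: "(r, Suc c) \<notin> D" "(Suc r, c) \<notin> D" using diag_nbrs(3,4)[OF D] rc B by blast+
  have "(x, y) \<in> ?L \<longleftrightarrow> (x, y) \<in> ?R" for x y
    using rc nD B by (auto simp: removable_iff[OF DB] removable_iff[OF D] One_nat_def)
  then show ?thesis by auto
qed

end

lemma finite_addable:
  assumes D: "is_diag D" shows "finite (addable D)"
proof (rule finite_subset)
  have "finite D" using D by (simp add: is_diag_def)
  then show "finite ({(1, 1)} \<union> (\<lambda>(r, c). (Suc r, c)) ` D \<union> (\<lambda>(r, c). (r, Suc c)) ` D)" by simp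
  show "addable D \<subseteq> {(1, 1)} \<union> (\<lambda>(r, c). (Suc r, c)) ` D \<union> (\<lambda>(r, c). (r, Suc c)) ` D"
  proof
    fix x assume x: "x \<in> addable D"
    obtain r c where rc: "x = (r, c)" by (cases x)
    have a: "1 \<le> r" "1 \<le> c" "r = 1 \<or> (r - 1, c) \<in> D" "c = 1 \<or> (r, c - 1) \<in> D"
      using x addable_iff[OF D] rc by auto
    have "x = (\<lambda>(r, c). (Suc r, c)) (r - 1, c)" "x = (\<lambda>(r, c). (r, Suc c)) (r, c - 1)" using a rc by auto
    then show "x \<in> {(1, 1)} \<union> (\<lambda>(r, c). (Suc r, c)) ` D \<union> (\<lambda>(r, c). (r, Suc c)) ` D"
      using a rc by (metis Un_iff image_eqI insertI1)
  qed
qed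

lemma finite_removable: "is_diag D \<Longrightarrow> finite (removable D)"
  by (rule finite_subset[of _ D]) (auto simp: removable_def is_diag_def)

lemma card_filter_sum: "finite S \<Longrightarrow> int (card {x \<in> S. P x}) = (\<Sum>x\<in>S. of_bool (P x))"
  by (simp add: of_bool_def sum.If_cases Int_def)

text \<open>The difference that enters \<open>dA\<close>, with an arbitrary condition P in place of
  equal residue in a lower row. The effect of inserting a node is then read off by evaluating P at
  the nodes around it.\<close>

definition ar_count :: "(nat \<times> nat \<Rightarrow> bool) \<Rightarrow> (nat \<times> nat) set \<Rightarrow> int" where
  "ar_count P D = int (card {B \<in> addable D. P B}) - int (card {B \<in> removable D. P B})"

text \<open>Inserting a node of content \<open>l\<close> changes the count at content \<open>l\<close> by \<open>-2\<close> and at contents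
  \<open>l + 1\<close>, \<open>l - 1\<close> by \<open>1\<close>: either a new addable node appears or an old removable one is blocked.\<close>
lemma ar_count_insert:
  assumes D: "is_diag D" and B: "(r, c) \<notin> D" and DB: "is_diag (insert (r, c) D)"
  shows "ar_count P (insert (r, c) D) = ar_count P D - 2 * of_bool (P (r, c))
     + of_bool (if r = 1 \<or> (r - 1, Suc c) \<in> D then P (r, Suc c) else P (r - 1, c))
     + of_bool (if c = 1 \<or> (Suc r, c - 1) \<in> D then P (Suc r, c) else P (r, c - 1))"
proof -
  let ?D' = "insert (r, c) D"
  define f where "f x = (of_bool (P x) :: int)" for x
  have card_f: "int (card {x \<in> S. P x}) = sum f S" if "finite S" for S
    unfolding card_filter_sum[OF that] by (rule sum.cong) (simp_all add: f_def)
  let ?\<alpha> = "r = 1 \<or> (r - 1, Suc c) \<in> D" and ?\<beta> = "c = 1 \<or> (Suc r, c - 1) \<in> D"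
  have rc: "1 \<le> r" "1 \<le> c" using diag_nbrs[OF DB] by blast+
  have nD: "(r, Suc c) \<notin> D" "(Suc r, c) \<notin> D" using diag_nbrs(3,4)[OF D] rc B by blast+
  have Badd: "(r, c) \<in> addable D" using B DB by (simp add: addable_def)
  have up: "r = 1 \<or> (r - 1, c) \<in> D" "c = 1 \<or> (r, c - 1) \<in> D" using Badd addable_iff[OF D] by auto
  have new: "(r, Suc c) \<notin> addable D" "(Suc r, c) \<notin> addable D"
    using addable_iff[OF D] B rc by auto
  have "(\<Sum>x\<in>addable ?D'. f x) = (\<Sum>x\<in>addable D - {(r, c)}. f x)
      + (\<Sum>x\<in>{x. x = (r, Suc c) \<and> ?\<alpha>}. f x) + (\<Sum>x\<in>{x. x = (Suc r, c) \<and> ?\<beta>}. f x)"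
    unfolding addable_insert[OF D B DB] using finite_addable[OF D] new
    by (subst sum.union_disjoint; (subst sum.union_disjoint)?) (auto intro: finite_subset[of _ "{_}"])
  moreover have "(\<Sum>x\<in>addable D - {(r, c)}. f x) = (\<Sum>x\<in>addable D. f x) - f (r, c)"
    using sum_diff1[OF finite_addable[OF D], of f "(r, c)"] Badd by (simp only: if_True)
  moreover have "(\<Sum>x\<in>{x. x = (r, Suc c) \<and> ?\<alpha>}. f x) = (if ?\<alpha> then f (r, Suc c) else 0)"
    by (cases ?\<alpha>) (simp_all only: simp_thms if_True if_False, simp_all)
  moreover have "(\<Sum>x\<in>{x. x = (Suc r, c) \<and> ?\<beta>}. f x) = (if ?\<beta> then f (Suc r, c) else 0)"
    by (cases ?\<beta>) (simp_all only: simp_thms if_True if_False, simp_all)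
  moreover have "(\<Sum>x\<in>removable ?D'. f x) = f (r, c) + (\<Sum>x\<in>removable D. f x)
      - (if ?\<alpha> then 0 else f (r - 1, c)) - (if ?\<beta> then 0 else f (r, c - 1))"
  proof -
    \<comment> \<open>For r = 1 the node (r - 1, c) would lie in row 0, outside every diagram; this
      agrees with the alternative r = 1 of \<open>?\<alpha>\<close>, where no removable node is
      lost.\<close>
    have \<alpha>: "(r - 1, c) \<in> removable D \<longleftrightarrow> \<not> ?\<alpha>"
      using up(1) B rc diag_nbrs(1)[OF D, of 0] by (auto simp: removable_iff[OF D] One_nat_def)
    have \<beta>: "(r, c - 1) \<in> removable D \<longleftrightarrow> \<not> ?\<beta>"
      using up(2) B rc diag_nbrs(2)[OF D, of _ 0] by (auto simp: removable_iff[OF D] One_nat_def)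
    have ne: "(r, c - 1) \<noteq> (r - 1, c)" "(r, c) \<notin> removable D" using rc B by (auto simp: removable_def)
    have e: "removable D - {(r, c - 1), (r - 1, c)} = removable D - {(r, c - 1)} - {(r - 1, c)}" by auto
    have "(\<Sum>x\<in>removable ?D'. f x) = f (r, c) + (\<Sum>x\<in>removable D - {(r, c - 1)} - {(r - 1, c)}. f x)"
      unfolding removable_insert[OF D B DB] e using finite_removable[OF D] ne(2)
      by (intro sum.insert) simp_all
    also have "(\<Sum>x\<in>removable D - {(r, c - 1)} - {(r - 1, c)}. f x)
       = (\<Sum>x\<in>removable D. f x) - (if ?\<alpha> then 0 else f (r - 1, c)) - (if ?\<beta> then 0 else f (r, c - 1))"
    proof -
      have "(r - 1, c) \<in> removable D - {(r, c - 1)} \<longleftrightarrow> (r - 1, c) \<in> removable D" using ne(1) by auto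
      then show ?thesis
        using sum_diff1[of "removable D - {(r, c - 1)}" f "(r - 1, c)"] sum_diff1[of "removable D" f "(r, c - 1)"]
          finite_removable[OF D] \<alpha> \<beta> by (simp split: if_splits)
    qed
    finally show ?thesis by simp
  qed
  ultimately show ?thesis
    unfolding ar_count_def card_f[OF finite_addable[OF D]] card_f[OF finite_addable[OF DB]]
      card_f[OF finite_removable[OF D]] card_f[OF finite_removable[OF DB]]
    by (cases ?\<alpha>; cases ?\<beta>) (simp_all add: f_def)
qed

lemma dA_ar_count: "dA \<kappa> A D = dsym (resn \<kappa> A) * ar_count (\<lambda>B. resn \<kappa> B = resn \<kappa> A \<and> fst A < fst B) D"
  by (simp add: dA_def ar_count_def)

text \<open>The neighbours l + 1 and l - 1 of a content, folded by the absolute value and weighted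
  by d_i, reproduce the symmetrised Cartan matrix. At l = 0 both neighbours fold onto residue 1,
  which is the double bond.\<close>

lemma ip_content_count:
  "dsym i * (of_bool (nat \<bar>l + 1\<bar> = i) + of_bool (nat \<bar>l - 1\<bar> = i) - 2 * of_bool (nat \<bar>l\<bar> = i)) = - ip i (nat \<bar>l\<bar>)"
proof (cases "l = 0")
  case True
  then show ?thesis by (auto simp: ip_def dsym_def One_nat_def)
next
  case False
  define j where "j = nat \<bar>l\<bar>"
  have j: "j \<noteq> 0" using False by (simp add: j_def)
  have "of_bool (nat \<bar>l + 1\<bar> = i) + of_bool (nat \<bar>l - 1\<bar> = i) = (of_bool (Suc j = i) + of_bool (j = Suc i) :: int)"
  proof (cases "l > 0")
    case True
    have "nat \<bar>l + 1\<bar> = i \<longleftrightarrow> Suc j = i" "nat \<bar>l - 1\<bar> = i \<longleftrightarrow> j = Suc i" using True by (auto simp: j_def)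
    then show ?thesis by (simp only:)
  next
    case F: False
    have "nat \<bar>l + 1\<bar> = i \<longleftrightarrow> j = Suc i" "nat \<bar>l - 1\<bar> = i \<longleftrightarrow> Suc j = i" using F False by (auto simp: j_def)
    then show ?thesis by (simp only: add.commute)
  qed
  then show ?thesis unfolding j_def[symmetric] using j by (auto simp: ip_def dsym_def One_nat_def)
qed

text \<open>By \<open>ar_count_insert\<close> the count changes by contributions of the contents l,
  l + 1, l - 1, where l is the content of the new node. All of them come from nodes below (a, b), so
  \<open>ip_content_count\<close> turns them into the Cartan form.\<close>

lemma dA_insert_below:
  assumes M: "is_diag M" and A: "(a, b) \<notin> M" "is_diag (insert (a, b) M)"
    and B: "(a', b') \<notin> M" "is_diag (insert (a', b') (insert (a, b) M))"
    and lt: "a < a'" "b' < b"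
  shows "dA \<kappa> (a, b) (insert (a', b') (insert (a, b) M)) = dA \<kappa> (a, b) (insert (a, b) M)
    - ip (resn \<kappa> (a, b)) (resn \<kappa> (a', b'))"
proof -
  let ?D = "insert (a, b) M"
  let ?i = "resn \<kappa> (a, b)"
  define P where "P B \<longleftrightarrow> resn \<kappa> B = ?i \<and> a < fst B" for B
  let ?l = "cont \<kappa> (a', b')"
  have BD: "(a', b') \<notin> ?D" using B lt by auto
  have pos: "1 \<le> a'" "1 \<le> b'" using diag_nbrs[OF B(2)] by blast+
  have 1: "P (a', Suc b') = (nat \<bar>?l + 1\<bar> = ?i)" "P (Suc a', b') = (nat \<bar>?l - 1\<bar> = ?i)"
    "P (a', b') = (nat \<bar>?l\<bar> = ?i)"
    using lt by (auto simp: P_def resn_cont cont_def intro!: arg_cong[where f = "\<lambda>x. nat \<bar>x\<bar> = _"])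
  \<comment> \<open>An old removable node that gets blocked lies in row a' - 1 and must still be
    below row a. It is: for a' - 1 = a the node (a, b' + 1) is present because b' < b.\<close>
  have 2: "(nat \<bar>?l + 1\<bar> = ?i) = P (a' - 1, b')" if "\<not> (a' = 1 \<or> (a' - 1, Suc b') \<in> ?D)"
  proof -
    have "a < a' - 1"
    proof (rule ccontr)
      assume "\<not> a < a' - 1"
      then have e: "a' - 1 = a" using lt by simp
      have "1 \<le> a" using diag_nbrs(1)[OF A(2), of a b] by simp
      then have "(a, Suc b') \<in> ?D" using diag_down[OF A(2), of a b a "Suc b'"] lt by simp
      then show False using that e by simp
    qed
    moreover have "cont \<kappa> (a' - 1, b') = ?l + 1" using pos by (simp add: cont_def)
    ultimately show ?thesis by (simp add: P_def resn_cont)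
  qed
  have 3: "(nat \<bar>?l - 1\<bar> = ?i) = P (a', b' - 1)"
    using pos lt by (auto simp: P_def resn_cont cont_def algebra_simps)
  have "ar_count P (insert (a', b') ?D) = ar_count P ?D
     + (of_bool (nat \<bar>?l + 1\<bar> = ?i) + of_bool (nat \<bar>?l - 1\<bar> = ?i) - 2 * of_bool (nat \<bar>?l\<bar> = ?i))"
    unfolding ar_count_insert[OF A(2) BD B(2)] using 1 2 3 by (simp only: if_cancel if_False if_True split: if_split) simp
  moreover have Peq: "(\<lambda>B. resn \<kappa> B = ?i \<and> fst (a, b) < fst B) = P" by (simp add: P_def fun_eq_iff)
  ultimately have "dA \<kappa> (a, b) (insert (a', b') ?D) = dA \<kappa> (a, b) ?D + dsym ?i * 
     (of_bool (nat \<bar>?l + 1\<bar> = ?i) + of_bool (nat \<bar>?l - 1\<bar> = ?i) - 2 * of_bool (nat \<bar>?l\<bar> = ?i))"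
    unfolding dA_ar_count Peq by (simp only: distrib_left)
  then show ?thesis unfolding ip_content_count by (simp add: resn_cont)
qed

text \<open>Only nodes in rows a - 1 to a + 1 are affected, and none of them is below row
  a'.\<close>

lemma dA_insert_above:
  assumes D: "is_diag D" and A: "(a, b) \<notin> D" "is_diag (insert (a, b) D)" and lt: "a < a'"
  shows "dA \<kappa> (a', b') (insert (a, b) D) = dA \<kappa> (a', b') D"
proof -
  have "\<not> a' < a" "\<not> a' < a - 1" "\<not> a' < Suc a" using lt by auto
  then show ?thesis unfolding dA_ar_count ar_count_insert[OF D A] by simp
qed

lemma diag_Std:
  assumes p: "is_partition lam" and t: "t \<in> Std lam"
  shows "is_diag {A \<in> nodes lam. t A \<le> k}"
  unfolding is_diag_iff
proof (intro conjI allI impI)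
  fix r c assume a: "(r, c) \<in> {A \<in> nodes lam. t A \<le> k}"
  then have N: "(r, c) \<in> nodes lam" "t (r, c) \<le> k" by auto
  show pos: "1 \<le> r" "1 \<le> c" using nodes_pos[OF N(1)] by auto
  show "r = 1 \<or> (r - 1, c) \<in> {A \<in> nodes lam. t A \<le> k}"
  proof (cases "r = 1")
    case False
    then have "1 \<le> r - 1" using pos by simp
    then show ?thesis
      using nodes_down[OF p N(1), of "r - 1" c] Std_mono_le[OF p t N(1), of "r - 1" c] pos N by auto
  qed simp
  show "c = 1 \<or> (r, c - 1) \<in> {A \<in> nodes lam. t A \<le> k}"
  proof (cases "c = 1")
    case False
    then have "1 \<le> c - 1" using pos by simp
    then show ?thesis
      using nodes_down[OF p N(1), of r "c - 1"] Std_mono_le[OF p t N(1), of r "c - 1"] pos N by auto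
  qed simp
qed simp

text \<open>The summands of \<open>tdeg\<close> for other entries see the same shapes. Of the two
  that change, the node in the lower row does not notice the one above it, while the node in the
  upper row gains minus the Cartan pairing, the degree of \<psi>_i.\<close>

lemma tdeg_sref:
  assumes p: "is_partition lam" and s: "s \<in> Std lam" and t: "sref i \<circ> s \<in> Std lam"
    and i: "1 \<le> i" "i < sum_list lam" and row: "fst (tinv lam s i) < fst (tinv lam s (Suc i))"
  shows "tdeg \<kappa> lam (sref i \<circ> s) = tdeg \<kappa> lam s - ip (resn \<kappa> (tinv lam s i)) (resn \<kappa> (tinv lam s (Suc i)))"
proof -
  let ?n = "sum_list lam" and ?t = "sref i \<circ> s"
  note sf = Std_fill[OF s]
  obtain a b a' b' where AB: "tinv lam s i = (a, b)" "tinv lam s (Suc i) = (a', b')" by (metis surj_pair)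
  have N: "(a, b) \<in> nodes lam" "(a', b') \<in> nodes lam" "s (a, b) = i" "s (a', b') = Suc i"
    using fill_tinv[OF sf, of i] fill_tinv[OF sf, of "Suc i"] i AB by auto
  have ti: "tinv lam ?t i = (a', b')" "tinv lam ?t (Suc i) = (a, b)"
    using tinv_sref[OF sf i, of i] tinv_sref[OF sf i, of "Suc i"] i AB by (simp_all add: sref_def)
  have lt: "a < a'" using row AB by simp
  have pos: "1 \<le> a" "1 \<le> b" "1 \<le> a'" "1 \<le> b'" using nodes_pos N by auto
  have ltb: "b' < b"
  proof (rule ccontr)
    assume "\<not> b' < b"
    then have "?t (a, b) < ?t (a', b')" using Std_mono[OF p t N(2)] lt pos by auto
    then show False using N by (simp add: sref_def)
  qed
  define M where "M = {A \<in> nodes lam. s A \<le> i - 1}"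
  have inj: "s C = i \<longleftrightarrow> C = (a, b)" "s C = Suc i \<longleftrightarrow> C = (a', b')" if "C \<in> nodes lam" for C
    using fill_inj[OF sf that N(1)] fill_inj[OF sf that N(2)] N by auto
  have key: "s C \<le> i \<longleftrightarrow> C = (a, b) \<or> s C \<le> i - 1"
    "s C \<le> Suc i \<longleftrightarrow> C = (a', b') \<or> C = (a, b) \<or> s C \<le> i - 1"
    "?t C \<le> i \<longleftrightarrow> C = (a', b') \<or> s C \<le> i - 1"
    "?t C \<le> Suc i \<longleftrightarrow> C = (a', b') \<or> C = (a, b) \<or> s C \<le> i - 1" if "C \<in> nodes lam" for C
    unfolding inj[OF that, symmetric] using i by (auto simp: sref_def)
  have sets: "{A \<in> nodes lam. s A \<le> i} = insert (a, b) M"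
    "{A \<in> nodes lam. s A \<le> Suc i} = insert (a', b') (insert (a, b) M)"
    "{A \<in> nodes lam. ?t A \<le> i} = insert (a', b') M"
    "{A \<in> nodes lam. ?t A \<le> Suc i} = insert (a', b') (insert (a, b) M)"
    using key N(1,2) unfolding M_def by blast+
  have notM: "(a, b) \<notin> M" "(a', b') \<notin> M" using N i by (auto simp: M_def)
  have diag: "is_diag M" "is_diag (insert (a, b) M)" "is_diag (insert (a', b') (insert (a, b) M))"
    "is_diag (insert (a', b') M)"
    using diag_Std[OF p s, of "i - 1"] diag_Std[OF p s, of i] diag_Std[OF p s, of "Suc i"] diag_Std[OF p t, of i] sets
    by (simp_all add: M_def)
  let ?f = "\<lambda>u k. dA \<kappa> (tinv lam u k) {A \<in> nodes lam. u A \<le> k}"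
  have other: "?f ?t k = ?f s k" if k: "k \<in> {1..?n} - {i, Suc i}" for k
  proof -
    have "{A \<in> nodes lam. ?t A \<le> k} = {A \<in> nodes lam. s A \<le> k}" using k by (auto simp: sref_def split: if_splits)
    moreover have "tinv lam ?t k = tinv lam s k" using tinv_sref[OF sf i, of k] k by (simp add: sref_def)
    ultimately show ?thesis by simp
  qed
  have split: "(\<Sum>k\<in>{1..?n}. ?f u k) = (\<Sum>k\<in>{1..?n} - {i, Suc i}. ?f u k) + ?f u i + ?f u (Suc i)" for u
    using i by (subst sum.subset_diff[of "{i, Suc i}"]) auto
  have so: "(\<Sum>k\<in>{1..?n} - {i, Suc i}. ?f ?t k) = (\<Sum>k\<in>{1..?n} - {i, Suc i}. ?f s k)"
    by (rule sum.cong[OF refl other])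
  have "tdeg \<kappa> lam ?t - tdeg \<kappa> lam s = ?f ?t i + ?f ?t (Suc i) - ?f s i - ?f s (Suc i)"
    unfolding tdeg_def split so by simp
  also have "\<dots> = - ip (resn \<kappa> (a, b)) (resn \<kappa> (a', b'))"
    unfolding sets ti AB using dA_insert_below[OF diag(1) notM(1) diag(2) notM(2) diag(3) lt ltb, of \<kappa>]
      dA_insert_above[OF diag(4), of a b a' \<kappa> b'] diag(3) notM(1) lt by (simp add: insert_commute)
  finally show ?thesis using AB by simp
qed

text \<open>Each letter of a reduced word for \<open>wperm lam t\<close> passes between standard
  tableaux by \<open>Std_rword_Cons\<close>, and there \<open>tdeg_sref\<close> matches the degree
  of the letter. So the basis vector of t is homogeneous, of degree
  \<open>tdeg \<kappa> lam t\<close> after the shift.\<close>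

lemma wtrace_rword_Std:
  assumes p: "is_partition lam" and "t \<in> Std lam" "rword (sum_list lam) is (wperm lam t)"
  shows "wtrace (psiw is) (nu0 \<kappa> lam) = Some (resseq \<kappa> lam t, tdeg \<kappa> lam t - tdeg \<kappa> lam (tlam lam))"
  using assms(2,3)
proof (induction "is" arbitrary: t)
  case Nil
  then have "wperm lam t = id" by (auto simp: rword_def)
  then have "t = tlam lam" using wperm_comp_tlam[OF Std_fill[OF Nil(1)]] by simp
  then show ?case by (simp add: psiw_def nu0_def)
next
  case (Cons i js)
  define s where "s = sref i \<circ> t"
  note R = Std_rword_Cons[OF p Cons.prems, folded s_def]
  note sf = Std_fill[OF R(1)]
  have "wtrace (psiw js) (nu0 \<kappa> lam) = Some (resseq \<kappa> lam s, tdeg \<kappa> lam s - tdeg \<kappa> lam (tlam lam))"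
    using Cons.IH R(1,2) by blast
  moreover have ts: "sref i \<circ> s \<in> Std lam" using R(3) Cons.prems(1) by metis
  moreover have "tdeg \<kappa> lam t = tdeg \<kappa> lam s - ip (resn \<kappa> (tinv lam s i)) (resn \<kappa> (tinv lam s (Suc i)))"
    using tdeg_sref[OF p R(1) ts R(4,5,6), of \<kappa>] R(3) by metis
  moreover have "resseq \<kappa> lam t = sw i (resseq \<kappa> lam s)"
    using resseq_sref[OF sf R(4,5), of \<kappa>] R(3) by metis
  ultimately show ?case using R(4,5) by (simp add: psiw_def nth1_resseq)
qed

declare One_nat_def [simp]

section \<open>The free algebra\<close>

lemma cadd_eq: "cadd f g = f + g" and csub_eq: "csub f g = f - g"
  by (simp_all add: cadd_def csub_def fun_eq_iff)

lemma sum_fun_apply: "(\<Sum>a\<in>A. F a) w = (\<Sum>a\<in>A. F a w)"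
  by (induction A rule: infinite_finite_induct) auto

lemma csum_eq: "csum A F = sum F A"
  by (simp add: csum_def fun_eq_iff sum_fun_apply)

lemma zero_fun_eq: "(\<lambda>_. 0) = 0"
  by (simp add: fun_eq_iff)

lemma cmul_0 [simp]: "cmul 0 f = 0" "cmul f 0 = 0"
  by (simp_all add: cmul_def fun_eq_iff)

lemma cmul_add: "cmul (f + g) h = cmul f h + cmul g h" "cmul h (f + g) = cmul h f + cmul h g"
  by (simp_all add: cmul_def fun_eq_iff algebra_simps sum.distrib)

lemma cmul_diff: "cmul (f - g) h = cmul f h - cmul g h" "cmul h (f - g) = cmul h f - cmul h g"
  by (simp_all add: cmul_def fun_eq_iff algebra_simps sum_subtractf)

lemma cmul_csc: "cmul (csc c f) g = csc c (cmul f g)" "cmul f (csc c g) = csc c (cmul f g)"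
  by (simp_all add: cmul_def csc_def fun_eq_iff sum_distrib_left mult_ac)

lemma cmul_sum: "cmul (sum F A) g = (\<Sum>a\<in>A. cmul (F a) g)" "cmul g (sum F A) = (\<Sum>a\<in>A. cmul g (F a))"
  by (induction A rule: infinite_finite_induct) (auto simp: cmul_add)

lemma csc_simps [simp]: "csc 1 f = f" "csc 0 f = 0" "csc c 0 = 0" "csc a (csc b f) = csc (a * b) f"
  by (simp_all add: csc_def fun_eq_iff mult_ac)

lemma csc_add: "csc c (f + g) = csc c f + csc c g" "csc (a + b) f = csc a f + csc b f"
  by (simp_all add: csc_def fun_eq_iff algebra_simps)

lemma csc_diff: "csc c (f - g) = csc c f - csc c g" "csc (a - b) f = csc a f - csc b f"
  by (simp_all add: csc_def fun_eq_iff algebra_simps)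

lemma csc_minus: "csc (- c) f = - csc c f" "csc c (- f) = - csc c f"
  by (simp_all add: csc_def fun_eq_iff)

lemma csc_sum: "csc c (sum F A) = (\<Sum>a\<in>A. csc c (F a))" "csc (sum G A) f = (\<Sum>a\<in>A. csc (G a) f)"
  by (induction A rule: infinite_finite_induct) (auto simp: csc_add)

lemma cmul_assoc: "cmul (cmul f g) h = cmul f (cmul g h)"
proof
  fix w
  have "cmul (cmul f g) h w = (\<Sum>(i, j)\<in>Sigma {0..length w} (\<lambda>i. {0..i}).
      f (take j w) * (g (drop j (take i w)) * h (drop i w)))"
  proof -
    have "cmul (cmul f g) h w = (\<Sum>i\<in>{0..length w}. \<Sum>j\<in>{0..i}.
        f (take j w) * (g (drop j (take i w)) * h (drop i w)))"
      unfolding cmul_def sum_distrib_right by (intro sum.cong) (auto simp: min_def mult.assoc)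
    then show ?thesis by (simp add: sum.Sigma)
  qed
  also have "\<dots> = (\<Sum>(j, k)\<in>Sigma {0..length w} (\<lambda>j. {0..length w - j}).
      f (take j w) * (g (take k (drop j w)) * h (drop k (drop j w))))"
    by (rule sum.reindex_bij_witness[where i = "\<lambda>(j, k). (j + k, j)" and j = "\<lambda>(i, j). (j, i - j)"])
      (auto simp: drop_take)
  also have "\<dots> = cmul f (cmul g h) w"
    by (simp add: cmul_def sum_distrib_left sum.Sigma cong: sum.cong)
  finally show "cmul (cmul f g) h w = cmul f (cmul g h) w" .
qed

lemma cmul_wd_wd [simp]: "cmul (wd u) (wd v) = wd (u @ v)"
proof
  fix w
  have "cmul (wd u) (wd v) w = (\<Sum>i\<in>{0..length w}. if i = length u \<and> w = u @ v then 1 else 0)"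
    unfolding cmul_def wd_def
    by (rule sum.cong) (auto simp: append_eq_conv_conj)
  also have "\<dots> = wd (u @ v) w" by (auto simp: wd_def)
  finally show "cmul (wd u) (wd v) w = wd (u @ v) w" .
qed

lemma cmul_wd_Nil [simp]: "cmul (wd []) f = f"
proof
  fix w
  have "cmul (wd []) f w = (\<Sum>i\<in>{0..length w}. if i = 0 then f w else 0)"
    unfolding cmul_def wd_def by (rule sum.cong) auto
  then show "cmul (wd []) f w = f w" by simp
qed

definition fin_supp :: "(gen list \<Rightarrow> 'k::comm_ring_1) \<Rightarrow> bool" where
  "fin_supp f = finite {w. f w \<noteq> 0}"

lemma fin_supp_subset: "{w. f w \<noteq> 0} \<subseteq> S \<Longrightarrow> finite S \<Longrightarrow> fin_supp f"
  unfolding fin_supp_def by (rule finite_subset)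

lemma fin_supp_wd [simp]: "fin_supp (wd u)"
  by (rule fin_supp_subset[of _ "{u}"]) (auto simp: wd_def)

lemma fin_supp_0 [simp]: "fin_supp 0"
  by (simp add: fin_supp_def)

lemma fin_supp_add [simp]: "fin_supp f \<Longrightarrow> fin_supp g \<Longrightarrow> fin_supp (f + g)"
  by (rule fin_supp_subset[of _ "{w. f w \<noteq> 0} \<union> {w. g w \<noteq> 0}"]) (auto simp: fin_supp_def)

lemma fin_supp_diff [simp]: "fin_supp f \<Longrightarrow> fin_supp g \<Longrightarrow> fin_supp (f - g)"
  by (rule fin_supp_subset[of _ "{w. f w \<noteq> 0} \<union> {w. g w \<noteq> 0}"]) (auto simp: fin_supp_def)

lemma fin_supp_csc [simp]: "fin_supp f \<Longrightarrow> fin_supp (csc c f)"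
  by (rule fin_supp_subset[of _ "{w. f w \<noteq> 0}"]) (auto simp: fin_supp_def csc_def)

lemma fin_supp_sum [simp]: "(\<And>a. a \<in> A \<Longrightarrow> fin_supp (F a)) \<Longrightarrow> fin_supp (sum F A)"
  by (induction A rule: infinite_finite_induct) auto

lemma fin_supp_expand: "fin_supp f \<Longrightarrow> f = (\<Sum>u | f u \<noteq> 0. csc (f u) (wd u))"
  by (auto simp: fun_eq_iff sum_fun_apply csc_def wd_def fin_supp_def if_distrib cong: if_cong)

lemma fin_supp_cmul [simp]:
  assumes "fin_supp f" "fin_supp g" shows "fin_supp (cmul f g)"
  by (subst fin_supp_expand[OF assms(1)], subst fin_supp_expand[OF assms(2)])
    (simp add: cmul_sum cmul_csc)

lemma fin_validI:
  "fin_supp f \<Longrightarrow> (\<And>w. f w \<noteq> 0 \<Longrightarrow> valid_word n Ib w) \<Longrightarrow> fin_valid n Ib f"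
  by (simp add: fin_valid_def fin_supp_def)

lemma fin_valid_fin_supp: "fin_valid n Ib f \<Longrightarrow> fin_supp f"
  by (simp add: fin_valid_def fin_supp_def)

lemma valid_word_append [simp]: "valid_word n Ib (u @ v) \<longleftrightarrow> valid_word n Ib u \<and> valid_word n Ib v"
  and valid_word_Cons [simp]: "valid_word n Ib (g # v) \<longleftrightarrow> valid_gen n Ib g \<and> valid_word n Ib v"
  and valid_word_Nil [simp]: "valid_word n Ib []"
  by (auto simp: valid_word_def)

lemma fin_valid_wd [simp]: "valid_word n Ib u \<Longrightarrow> fin_valid n Ib (wd u)"
  by (intro fin_validI fin_supp_wd) (auto simp: wd_def split: if_splits)

lemma fin_valid_csc [simp]: "fin_valid n Ib f \<Longrightarrow> fin_valid n Ib (csc c f)"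
  by (intro fin_validI fin_supp_csc)
     (auto simp: fin_valid_fin_supp csc_def, metis fin_valid_def mult_zero_right)

lemma fin_valid_0 [simp]: "fin_valid n Ib 0"
  by (simp add: fin_valid_def)

lemma fin_valid_cmul [simp]:
  assumes "fin_valid n Ib f" "fin_valid n Ib g" shows "fin_valid n Ib (cmul f g)"
proof (rule fin_validI)
  show "fin_supp (cmul f g)" using assms fin_valid_fin_supp fin_supp_cmul by blast
  fix w assume "cmul f g w \<noteq> 0"
  then obtain i where "f (take i w) * g (drop i w) \<noteq> 0"
    unfolding cmul_def by (meson sum.neutral)
  then have "f (take i w) \<noteq> 0" "g (drop i w) \<noteq> 0" by auto
  then have "valid_word n Ib (take i w @ drop i w)"
    using assms unfolding valid_word_append fin_valid_def by blast
  then show "valid_word n Ib w" by simp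
qed

subsection \<open>Linear functionals\<close>

definition is_hom :: "('a::comm_ring_1 \<Rightarrow> 'b::comm_ring_1) \<Rightarrow> bool" where
  "is_hom h \<longleftrightarrow> h 1 = 1 \<and> (\<forall>x y. h (x + y) = h x + h y) \<and> (\<forall>x y. h (x * y) = h x * h y)"

lemma is_hom_simps:
  assumes "is_hom h"
  shows "h 0 = 0" "h 1 = 1" "h (x + y) = h x + h y" "h (x * y) = h x * h y" "h (- x) = - h x"
    "h (x - y) = h x - h y" "h (sum F A) = (\<Sum>a\<in>A. h (F a))"
proof -
  have a: "h (x + y) = h x + h y" for x y using assms by (simp add: is_hom_def)
  show z: "h 0 = 0" using a[of 0 0] by simp
  have m: "h (- x) = - h x" for x using a[of x "- x"] z by (simp add: eq_neg_iff_add_eq_0 add.commute)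
  show "h 1 = 1" "h (x * y) = h x * h y" using assms by (simp_all add: is_hom_def)
  show "h (x + y) = h x + h y" "h (- x) = - h x" by (fact a m)+
  show "h (x - y) = h x - h y" using a[of x "- y"] m[of y] by simp
  show "h (sum F A) = (\<Sum>a\<in>A. h (F a))"
    by (induction A rule: infinite_finite_induct) (auto simp: z a)
qed

lemma is_hom_of_nat: "is_hom h \<Longrightarrow> h (of_nat n) = of_nat n"
  by (induction n) (auto simp: is_hom_simps)

lemma is_hom_of_int: "is_hom h \<Longrightarrow> h (of_int n) = of_int n"
  by (cases n) (auto simp: is_hom_simps is_hom_of_nat simp del: of_nat_Suc)

lemma is_hom_id: "is_hom id"
  by (simp add: is_hom_def)

text \<open>The linear extension of a function g on words, along a ring homomorphism h. Both an
  action on a fixed vector, read at one tableau, and the coefficient functionals on the Specht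
  module have this form.\<close>

definition ev :: "('a::comm_ring_1 \<Rightarrow> 'b::comm_ring_1) \<Rightarrow> (gen list \<Rightarrow> 'b) \<Rightarrow> (gen list \<Rightarrow> 'a) \<Rightarrow> 'b" where
  "ev h g f = (\<Sum>w | f w \<noteq> 0. h (f w) * g w)"

context
  fixes h :: "'a::comm_ring_1 \<Rightarrow> 'b::comm_ring_1"
  assumes h: "is_hom h"
begin

lemma ev_superset: "finite S \<Longrightarrow> {w. f w \<noteq> 0} \<subseteq> S \<Longrightarrow> ev h g f = (\<Sum>w\<in>S. h (f w) * g w)"
  unfolding ev_def by (rule sum.mono_neutral_left) (auto simp: is_hom_simps[OF h])

lemma ev_0 [simp]: "ev h g 0 = 0"
  by (simp add: ev_def)

lemma ev_add: 
  assumes "fin_supp f1" "fin_supp f2" shows "ev h g (f1 + f2) = ev h g f1 + ev h g f2"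
proof -
  let ?S = "{w. f1 w \<noteq> 0} \<union> {w. f2 w \<noteq> 0}"
  have f: "finite ?S" using assms by (simp add: fin_supp_def)
  have "ev h g (f1 + f2) = (\<Sum>w\<in>?S. h ((f1 + f2) w) * g w)" by (rule ev_superset[OF f]) auto
  moreover have "ev h g f1 = (\<Sum>w\<in>?S. h (f1 w) * g w)" by (rule ev_superset[OF f]) auto
  moreover have "ev h g f2 = (\<Sum>w\<in>?S. h (f2 w) * g w)" by (rule ev_superset[OF f]) auto
  ultimately show ?thesis by (simp add: is_hom_simps[OF h] algebra_simps sum.distrib)
qed

lemma ev_csc: 
  assumes "fin_supp f" shows "ev h g (csc c f) = h c * ev h g f"
proof -
  let ?S = "{w. f w \<noteq> 0}"
  have f: "finite ?S" using assms by (simp add: fin_supp_def)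
  have "ev h g (csc c f) = (\<Sum>w\<in>?S. h (csc c f w) * g w)" by (rule ev_superset[OF f]) (auto simp: csc_def)
  then show ?thesis by (simp add: ev_def csc_def is_hom_simps[OF h] sum_distrib_left mult_ac)
qed

lemma ev_diff:
  assumes "fin_supp f1" "fin_supp f2" shows "ev h g (f1 - f2) = ev h g f1 - ev h g f2"
proof -
  have e: "f1 - f2 = f1 + csc (- 1) f2" by (simp add: csc_minus)
  show ?thesis unfolding e using assms by (simp add: ev_add ev_csc is_hom_simps[OF h])
qed

lemma ev_sum: "(\<And>a. a \<in> A \<Longrightarrow> fin_supp (F a)) \<Longrightarrow> ev h g (sum F A) = (\<Sum>a\<in>A. ev h g (F a))"
  by (induction A rule: infinite_finite_induct) (auto simp: ev_add)

lemma ev_wd [simp]: "ev h g (wd u) = g u"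
  using ev_superset[of "{u}" "wd u" g] by (auto simp: wd_def is_hom_simps[OF h])

lemma ev_cmul:
  assumes "fin_supp a" "fin_supp f"
  shows "ev h g (cmul a f) = ev h (\<lambda>u. ev h (\<lambda>v. g (u @ v)) f) a"
proof -
  have "ev h g (cmul (wd u) f) = ev h (\<lambda>v. g (u @ v)) f" for u
    by (subst fin_supp_expand[OF assms(2)])
       (simp add: cmul_sum cmul_csc ev_sum ev_csc, simp add: ev_def)
  then show ?thesis using assms(2)
    by (subst fin_supp_expand[OF assms(1)])
       (simp add: cmul_sum cmul_csc ev_sum ev_csc, simp add: ev_def)
qed

lemma ev_cong: "(\<And>w. f w \<noteq> 0 \<Longrightarrow> g w = g' w) \<Longrightarrow> ev h g f = ev h g' f"
  unfolding ev_def by (rule sum.cong) auto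

lemma ev_zero: "(\<And>w. f w \<noteq> 0 \<Longrightarrow> g w = 0) \<Longrightarrow> ev h g f = 0"
  unfolding ev_def by (rule sum.neutral) auto

lemma ev_eval_sum: "ev h (\<lambda>w. \<Sum>i\<in>I. g i w * b i) f = (\<Sum>i\<in>I. ev h (g i) f * b i)"
  unfolding ev_def by (simp add: sum_distrib_left sum_distrib_right sum.swap[of _ I] mult_ac)

end

lemma ev_cmap:
  assumes h: "is_hom h" and f: "fin_supp f"
  shows "ev id (\<lambda>w. h (g w)) (cmap h f) = h (ev id g f)"
proof -
  have "ev id (\<lambda>w. h (g w)) (cmap h f) = (\<Sum>w | f w \<noteq> 0. cmap h f w * h (g w))"
    by (subst ev_superset[of id "{w. f w \<noteq> 0}"])
       (use f in \<open>auto simp: is_hom_id fin_supp_def cmap_def is_hom_simps[OF h]\<close>)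
  then show ?thesis by (simp add: ev_def cmap_def is_hom_simps[OF h])
qed

subsection \<open>Left ideals and base change\<close>

context
  fixes n :: nat and Ib :: "nat list set" and Rl G :: "(gen list \<Rightarrow> 'k::comm_ring_1) set"
  assumes ne: "Rl \<noteq> {}"
begin

text \<open>No clause of \<open>lideal\<close> yields 0 by itself; it comes from a relation
  multiplied by 0, hence the assumption that there is a relation.\<close>

lemma lideal_0 [simp]: "0 \<in> lideal n Ib Rl G"
proof -
  obtain r where "r \<in> Rl" using ne by auto
  from lideal.rel[OF this, of n Ib 0 0 G] show ?thesis by simp
qed

lemma lideal_add: "x \<in> lideal n Ib Rl G \<Longrightarrow> y \<in> lideal n Ib Rl G \<Longrightarrow> x + y \<in> lideal n Ib Rl G"
  using lideal.add[of x n Ib Rl G y] by (simp add: cadd_eq)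

lemma lideal_cmul: "x \<in> lideal n Ib Rl G \<Longrightarrow> fin_valid n Ib a \<Longrightarrow> cmul a x \<in> lideal n Ib Rl G"
proof (induction rule: lideal.induct)
  case (rel r b c)
  then show ?case using lideal.rel[of r Rl n Ib "cmul a b" c G] by (simp add: cmul_assoc)
next
  case (gen g b)
  then show ?case using lideal.gen[of g G n Ib "cmul a b" Rl] by (simp add: cmul_assoc)
next
  case (add x y)
  then show ?case unfolding cadd_eq cmul_add by (intro lideal_add)
qed

lemma lideal_csc: "x \<in> lideal n Ib Rl G \<Longrightarrow> csc c x \<in> lideal n Ib Rl G"
  using lideal_cmul[of x "csc c (wd [])"] by (simp add: cmul_csc)

lemma lideal_uminus: "x \<in> lideal n Ib Rl G \<Longrightarrow> - x \<in> lideal n Ib Rl G"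
  using lideal_csc[of x "- 1"] by (simp add: csc_minus)

lemma lideal_diff: "x \<in> lideal n Ib Rl G \<Longrightarrow> y \<in> lideal n Ib Rl G \<Longrightarrow> x - y \<in> lideal n Ib Rl G"
  using lideal_add[of x "- y"] lideal_uminus[of y] by simp

lemma lideal_sum: "(\<And>a. a \<in> A \<Longrightarrow> F a \<in> lideal n Ib Rl G) \<Longrightarrow> sum F A \<in> lideal n Ib Rl G"
  by (induction A rule: infinite_finite_induct) (auto intro: lideal_add)

end

lemma cmap_simps:
  assumes "is_hom h"
  shows "cmap h (f + g) = cmap h f + cmap h g" "cmap h (f - g) = cmap h f - cmap h g"
    "cmap h (cmul f g) = cmul (cmap h f) (cmap h g)" "cmap h (csc c f) = csc (h c) (cmap h f)"
    "cmap h (wd u) = wd u" "cmap h (sum F A) = (\<Sum>a\<in>A. cmap h (F a))" "cmap h 0 = 0"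
    "cmap h (qeval p r s u) = qeval p r s u" "cmap h (ddeval p r s t u) = ddeval p r s t u"
    "cmap h (eBl \<kappa> lam) = eBl \<kappa> lam"
proof -
  note hs = is_hom_simps[OF assms]
  show "cmap h (f + g) = cmap h f + cmap h g" "cmap h (f - g) = cmap h f - cmap h g"
    "cmap h (cmul f g) = cmul (cmap h f) (cmap h g)" "cmap h (csc c f) = csc (h c) (cmap h f)"
    "cmap h (sum F A) = (\<Sum>a\<in>A. cmap h (F a))" "cmap h 0 = 0"
    by (auto simp: cmap_def cmul_def csc_def fun_eq_iff sum_fun_apply hs)
  show w: "cmap h (wd u) = wd u" for u
    by (auto simp: cmap_def wd_def fun_eq_iff hs)
  then have w': "h (wd u v) = wd u v" for u v
    by (metis cmap_def)
  have l: "h (sum_list xs) = sum_list (map h xs)" for xs by (induction xs) (auto simp: hs)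
  show "cmap h (qeval p r s u) = qeval p r s u" "cmap h (ddeval p r s t u) = ddeval p r s t u"
    unfolding cmap_def qeval_def ddeval_def
    by (auto simp: fun_eq_iff l hs w' is_hom_of_int[OF assms] o_def intro!: arg_cong[where f = sum_list])
  show "cmap h (eBl \<kappa> lam) = eBl \<kappa> lam"
    by (auto simp: eBl_def cmap_def csum_def fun_eq_iff hs w')
qed

lemma lideal_base_change:
  assumes h: "is_hom h" and ne: "Rl' \<noteq> {}"
    and R: "\<And>r. r \<in> Rl \<Longrightarrow> cmap h r \<in> Rl'" and G: "\<And>g. g \<in> G \<Longrightarrow> cmap h g \<in> G'"
    and "x \<in> lideal n Ib Rl G"
  shows "cmap h x \<in> lideal n Ib Rl' G'"
proof -
  have fv: "fin_valid n Ib a \<Longrightarrow> fin_valid n Ib (cmap h a)" for a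
    unfolding fin_valid_def
    by (auto intro: finite_subset[of _ "{w. a w \<noteq> 0}"] simp: cmap_def is_hom_simps[OF h])
       (metis is_hom_simps(1)[OF h])
  show ?thesis using assms(5)
  proof (induction rule: lideal.induct)
    case (rel r a b)
    then show ?case unfolding cmap_simps[OF h] by (intro lideal.rel R fv)
  next
    case (gen g a)
    then show ?case unfolding cmap_simps[OF h] by (intro lideal.gen G fv)
  next
    case (add x y)
    then show ?case unfolding cadd_eq cmap_simps[OF h] by (intro lideal_add[OF ne])
  qed
qed

lemma cmap_image_compr:
  "cmap h ` {F a | a. P a} = {cmap h (F a) | a. P a}"
  "cmap h ` {F2 a b | a b. P2 a b} = {cmap h (F2 a b) | a b. P2 a b}"
  by auto

text \<open>All coefficients of the relations are images of integers, so a ring homomorphism maps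
  the relations onto those of the target ring.\<close>

lemma qh_rels_base_change:
  assumes "is_hom h" shows "qh_rels n Ib = cmap h ` qh_rels n Ib"
  unfolding qh_rels_def image_Un cmap_image_compr image_insert image_empty
    cadd_eq csub_eq csum_eq deltal_def delta_def zero_fun_eq
    cmap_simps[OF assms] if_distrib[of "cmap h"] if_distrib[of h] is_hom_simps(1,2)[OF assms]
  by (rule refl)

lemma qh_rels_nonempty: "qh_rels n Ib \<noteq> {}"
  unfolding qh_rels_def by blast

lemma fin_supp_qeval [simp]: "fin_supp (qeval p r s u)"
proof -
  have e: "qeval p r s u = (\<Sum>i<length p. case p ! i of (c, a, b) \<Rightarrow>
      csc (of_int c) (wd (replicate a (X r) @ replicate b (X s) @ u)))"
    by (auto simp: qeval_def fun_eq_iff sum_fun_apply csc_def sum_list_sum_nth atLeast0LessThan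
        case_prod_unfold)
  show ?thesis unfolding e by (simp add: case_prod_unfold)
qed

lemma fin_supp_ddeval [simp]: "fin_supp (ddeval p r s t u)"
proof -
  have e: "ddeval p r s t u = (\<Sum>i<length p. case p ! i of (c, a, b) \<Rightarrow>
      csc (of_int c) (\<Sum>k<a. wd (replicate k (X r) @ replicate (a - 1 - k) (X t) @ replicate b (X s) @ u)))"
    by (auto simp: ddeval_def fun_eq_iff sum_fun_apply csc_def sum_list_sum_nth atLeast0LessThan
        case_prod_unfold)
  show ?thesis unfolding e by (simp add: case_prod_unfold)
qed

lemma fin_supp_qh_rels: "r \<in> qh_rels n Ib \<Longrightarrow> fin_supp r"
  unfolding qh_rels_def
  by (auto simp: cadd_eq csub_eq csum_eq zero_fun_eq)

section \<open>Spanning over the deformed integral form\<close>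

text \<open>The eigenvalues satisfy \<open>Q\<^sub>i\<^sub>j(cz z k, cz z l) = 0\<close> for consecutive contents \<open>k\<close>, \<open>l\<close> of residues
  \<open>i\<close>, \<open>j\<close>, and they separate contents of equal residue. At \<open>z = 0\<close> they vanish.\<close>
definition cz :: "'a::comm_ring_1 \<Rightarrow> int \<Rightarrow> 'a" where
  "cz z k = (if k = 0 then - (z ^ 2) else if 0 < k then (- 1) ^ nat (k - 1) * z else (- 1) ^ nat (- k) * z)"

text \<open>Homogeneous polynomials for z of degree 2, with 0 in every degree. For odd or negative d
  only 0 remains.\<close>

definition mono_deg :: "int \<Rightarrow> int poly set" where
  "mono_deg d = {p. \<forall>m. coeff p m \<noteq> 0 \<longrightarrow> 2 * int m = d}"

lemma mono_deg_0 [simp]: "0 \<in> mono_deg d"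
  by (simp add: mono_deg_def)

lemma mono_deg_add: "p \<in> mono_deg d \<Longrightarrow> q \<in> mono_deg d \<Longrightarrow> p + q \<in> mono_deg d"
  unfolding mono_deg_def by (auto simp: add_nonneg_eq_0_iff) (metis add.right_neutral)

lemma mono_deg_monom: "2 * int m = d \<Longrightarrow> monom a m \<in> mono_deg d"
  by (auto simp: mono_deg_def coeff_monom split: if_splits)

lemma mono_deg_mult:
  assumes "p \<in> mono_deg d" "q \<in> mono_deg e" shows "p * q \<in> mono_deg (d + e)"
proof -
  \<comment> \<open>A homogeneous polynomial in one variable is a monomial.\<close>
  have "\<exists>a k. p = monom a k \<and> (a \<noteq> 0 \<longrightarrow> 2 * int k = d)" if "p \<in> mono_deg d" for p d
  proof (cases "p = 0")
    case True
    then show ?thesis by (intro exI[of _ 0]) simp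
  next
    case False
    then have k: "coeff p (degree p) \<noteq> 0" by simp
    have "coeff p m = coeff (monom (coeff p (degree p)) (degree p)) m" for m
    proof (cases "coeff p m = 0")
      case True
      then show ?thesis using k by (auto simp: coeff_monom)
    next
      case False
      then have "2 * int m = d" "2 * int (degree p) = d" using that k unfolding mono_deg_def by blast+
      then have "m = degree p" by linarith
      then show ?thesis by (simp add: coeff_monom)
    qed
    then have "p = monom (coeff p (degree p)) (degree p)" by (rule poly_eqI)
    moreover have "2 * int (degree p) = d" using that k by (simp add: mono_deg_def)
    ultimately show ?thesis by blast
  qed
  from this[OF assms(1)] this[OF assms(2)] obtain a k b l where
    e: "p = monom a k" "a \<noteq> 0 \<longrightarrow> 2 * int k = d" "q = monom b l" "b \<noteq> 0 \<longrightarrow> 2 * int l = e" by blast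
  show ?thesis
  proof (cases "a = 0 \<or> b = 0")
    case False
    then show ?thesis using e by (simp add: mult_monom mono_deg_monom)
  qed (use e in auto)
qed

lemma mono_deg_of_int: "of_int m \<in> mono_deg 0"
  by (simp add: mono_deg_monom flip: monom_0 add: of_int_poly)

text \<open>The eigenvalue has the degree of x_r: 4 for -z^2 at residue 0 and 2 for \<plusminus>z
  elsewhere. This keeps the deformed relation for x_r homogeneous.\<close>

lemma mono_deg_cz: "cz (monom 1 1) k \<in> mono_deg (ip (nat \<bar>k\<bar>) (nat \<bar>k\<bar>))"
proof -
  have z: "monom 1 1 \<in> mono_deg 2" by (simp add: mono_deg_monom)
  have i: "(- 1) ^ m \<in> mono_deg 0" for m
    using mono_deg_of_int[of "(- 1) ^ m"] by simp
  have "(- 1) * (monom 1 1 * monom 1 1) \<in> mono_deg (0 + (2 + 2))"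
    using i[of 1] by (intro mono_deg_mult z) simp
  then show ?thesis using mono_deg_mult[OF i z]
    by (auto simp: cz_def ip_def power2_eq_square)
qed

section \<open>Words: number of \<psi>'s, idempotents and degrees\<close>

definition npsi :: "gen list \<Rightarrow> nat" where
  "npsi u = length (filter (\<lambda>g. case g of Psi r \<Rightarrow> True | _ \<Rightarrow> False) u)"

lemma npsi_simps [simp]: "npsi [] = 0" "npsi (Psi r # u) = Suc (npsi u)" "npsi (X r # u) = npsi u"
  "npsi (E \<nu> # u) = npsi u" "npsi (u @ v) = npsi u + npsi v" "npsi (psiw is) = length is"
  "npsi (replicate a (X r)) = 0"
  by (induction "is") (auto simp: npsi_def psiw_def)

lemma wtrace_append:
  "wtrace (u @ v) \<nu> = (case wtrace v \<nu> of None \<Rightarrow> None | Some (\<mu>, d) \<Rightarrow>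
     (case wtrace u \<mu> of None \<Rightarrow> None | Some (\<mu>', d') \<Rightarrow> Some (\<mu>', d + d')))"
  by (induction u) (auto split: option.splits gen.splits)

lemma wtrace_replicate_X: "wtrace (replicate a (X r)) \<mu> = Some (\<mu>, int a * ip (nth1 \<mu> r) (nth1 \<mu> r))"
  by (induction a) (auto simp: algebra_simps)

lemma ip_sym: "ip i j = ip j i"
  by (auto simp: ip_def)

lemma psiw_simps [simp]: "psiw [] = []" "psiw (i # is) = Psi i # psiw is" "psiw (is @ js) = psiw is @ psiw js"
  by (simp_all add: psiw_def)

lemma wtrace_psiw_Some: "\<exists>\<mu> d. wtrace (psiw is) \<nu> = Some (\<mu>, d)"
  by (induction "is") auto

text \<open>Both sides of a commutation or braid move send an idempotent to the same one with the
  same degree, so rewriting a word does not leave its graded piece.\<close>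

lemma wtrace_beq:
  assumes "beq xs ys" "set xs \<subseteq> {1..<n}" "length \<nu> = n"
  shows "wtrace (psiw xs) \<nu> = wtrace (psiw ys) \<nu>"
  using assms
proof (induction rule: beq.induct)
  case (beq_sym xs ys)
  then show ?case using beq_length_set by metis
next
  case (beq_trans xs ys zs)
  then show ?case using beq_length_set by metis
next
  case (beq_comm i j xs ys)
  obtain \<mu> d where m: "wtrace (psiw ys) \<nu> = Some (\<mu>, d)" using wtrace_psiw_Some by blast
  have l: "length \<mu> = n" using m beq_comm.prems(2)
    by (induction ys arbitrary: \<mu> d) (auto split: option.splits)
  have ij: "1 \<le> i" "j < n" using beq_comm.prems by auto
  have "sw i (sw j \<mu>) = sw j (sw i \<mu>)"
    using ij beq_comm.hyps l by (intro nth1_eqI) (auto simp: nth1_sw sref_def)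
  moreover have "nth1 (sw j \<mu>) i = nth1 \<mu> i" "nth1 (sw j \<mu>) (Suc i) = nth1 \<mu> (Suc i)"
    "nth1 (sw i \<mu>) j = nth1 \<mu> j" "nth1 (sw i \<mu>) (Suc j) = nth1 \<mu> (Suc j)"
    using ij beq_comm.hyps l by (auto simp: nth1_sw sref_def)
  ultimately show ?case by (simp add: wtrace_append m split: option.split)
next
  case (beq_braid xs i ys)
  obtain \<mu> d where m: "wtrace (psiw ys) \<nu> = Some (\<mu>, d)" using wtrace_psiw_Some by blast
  have l: "length \<mu> = n" using m beq_braid.prems(2)
    by (induction ys arbitrary: \<mu> d) (auto split: option.splits)
  have i: "1 \<le> i" "Suc i < n" using beq_braid.prems by auto
  have "sw i (sw (Suc i) (sw i \<mu>)) = sw (Suc i) (sw i (sw (Suc i) \<mu>))"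
    using i l by (intro nth1_eqI) (auto simp: nth1_sw sref_def)
  then show ?case using i l by (simp add: wtrace_append m nth1_sw sref_def split: option.split)
qed simp

text \<open>This is the degree of \<psi>_r^2; in Q_01 = u + v^2 both terms have degree 4.\<close>

lemma Qpoly_homogeneous: "(c, a, b) \<in> set (Qpoly i j) \<Longrightarrow> int a * ip i i + int b * ip j j = - 2 * ip i j"
  by (auto simp: Qpoly_def Qlt_def ip_def split: if_splits)

lemma qeval_Nil: "qeval [] r s u = 0" and
  qeval_Cons: "qeval ((c, a, b) # p) r s u = csc (of_int c) (wd (replicate a (X r) @ replicate b (X s) @ u)) + qeval p r s u"
  by (simp_all add: qeval_def fun_eq_iff csc_def)

lemma ddeval_Nil: "ddeval [] r s t u = 0" and
  ddeval_Cons: "ddeval ((c, a, b) # p) r s t u = csc (of_int c)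
    (\<Sum>k<a. wd (replicate k (X r) @ replicate (a - 1 - k) (X t) @ replicate b (X s) @ u)) + ddeval p r s t u"
  by (simp_all add: ddeval_def fun_eq_iff csc_def sum_fun_apply)

text \<open>The part of \<open>spechtgens\<close> that is unchanged by the deformation.\<close>
definition specht_rest :: "int \<Rightarrow> nat list \<Rightarrow> ((nat \<Rightarrow> nat) \<Rightarrow> nat list) \<Rightarrow> (gen list \<Rightarrow> 'k::comm_ring_1) set" where
  "specht_rest \<kappa> lam red =
     {cmul (wd [Psi r]) (eBl \<kappa> lam) | r. 1 \<le> r \<and> r < sum_list lam \<and> internal lam r}
   \<union> {csub (wd [E \<nu>]) (csc (deltal \<nu> (nu0 \<kappa> lam)) (eBl \<kappa> lam)) | \<nu>. \<nu> \<in> Iblock \<kappa> lam}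
   \<union> {cmul (wd (psiw (red (wperm lam (garnir lam A))))) (eBl \<kappa> lam) | A. A \<in> garnir_nodes lam}"

locale specht =
  fixes \<kappa> :: int and lam :: "nat list" and red :: "(nat \<Rightarrow> nat) \<Rightarrow> nat list"
  assumes part: "is_partition lam"
    and red: "\<forall>w. isperm (sum_list lam) w \<longrightarrow> is_reduced (sum_list lam) (red w) w"
begin

abbreviation "n \<equiv> sum_list lam"
abbreviation "Ib \<equiv> Ibeta \<kappa> lam"
abbreviation "valid \<equiv> valid_word n Ib"

definition eig :: "nat \<Rightarrow> int poly" where
  "eig r = cz (monom 1 1) (cont \<kappa> (tinv lam (tlam lam) r))"

definition dgens :: "(gen list \<Rightarrow> int poly) set" where
  "dgens = {cmul (wd [X r]) (eBl \<kappa> lam) - csc (eig r) (eBl \<kappa> lam) | r. 1 \<le> r \<and> r \<le> n} \<union> specht_rest \<kappa> lam red"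

definition KZ :: "(gen list \<Rightarrow> int poly) set" where
  "KZ = lideal n Ib (qh_rels n Ib) dgens"

definition M :: "gen list \<Rightarrow> gen list \<Rightarrow> int poly" where
  "M u = cmul (wd u) (eBl \<kappa> lam)"

definition eqK :: "(gen list \<Rightarrow> int poly) \<Rightarrow> (gen list \<Rightarrow> int poly) \<Rightarrow> bool" (infix "\<simeq>" 50) where
  "x \<simeq> y \<longleftrightarrow> x - y \<in> KZ"

lemma red_rword: "w permutes {1..n} \<Longrightarrow> rword n (red w) w"
  using red rword_if_is_reduced isperm_permutes by blast

lemma KZ_0: "0 \<in> KZ"
  and KZ_add: "x \<in> KZ \<Longrightarrow> y \<in> KZ \<Longrightarrow> x + y \<in> KZ"
  and KZ_diff: "x \<in> KZ \<Longrightarrow> y \<in> KZ \<Longrightarrow> x - y \<in> KZ"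
  and KZ_csc: "x \<in> KZ \<Longrightarrow> csc a x \<in> KZ"
  and KZ_uminus: "x \<in> KZ \<Longrightarrow> - x \<in> KZ"
  and KZ_sum: "(\<And>i. i \<in> I \<Longrightarrow> F i \<in> KZ) \<Longrightarrow> sum F I \<in> KZ"
  and KZ_cmul: "x \<in> KZ \<Longrightarrow> fin_valid n Ib b \<Longrightarrow> cmul b x \<in> KZ"
  unfolding KZ_def
  by (auto intro: lideal_0[OF qh_rels_nonempty] lideal_add[OF qh_rels_nonempty] lideal_diff[OF qh_rels_nonempty]
    lideal_csc[OF qh_rels_nonempty] lideal_uminus[OF qh_rels_nonempty] lideal_sum[OF qh_rels_nonempty]
    lideal_cmul[OF qh_rels_nonempty])

lemma eqK_refl [simp]: "x \<simeq> x"
  by (simp add: eqK_def KZ_0)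

lemma eqK_sym: "x \<simeq> y \<Longrightarrow> y \<simeq> x"
  unfolding eqK_def using KZ_uminus[of "x - y"] by simp

lemma eqK_trans [trans]: "x \<simeq> y \<Longrightarrow> y \<simeq> w \<Longrightarrow> x \<simeq> w"
  unfolding eqK_def using KZ_add[of "x - y" "y - w"] by simp

lemma eqK_eq_trans [trans]: "x \<simeq> y \<Longrightarrow> y = w \<Longrightarrow> x \<simeq> w" "x = y \<Longrightarrow> y \<simeq> w \<Longrightarrow> x \<simeq> w"
  by simp_all

lemma eqK_add: "x \<simeq> y \<Longrightarrow> x' \<simeq> y' \<Longrightarrow> x + x' \<simeq> y + y'"
  unfolding eqK_def using KZ_add[of "x - y" "x' - y'"] by (simp add: algebra_simps)

lemma eqK_diff: "x \<simeq> y \<Longrightarrow> x' \<simeq> y' \<Longrightarrow> x - x' \<simeq> y - y'"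
  unfolding eqK_def using KZ_diff[of "x - y" "x' - y'"] by (simp add: algebra_simps)

lemma eqK_csc: "x \<simeq> y \<Longrightarrow> csc a x \<simeq> csc a y"
  unfolding eqK_def using KZ_csc[of "x - y" a] unfolding csc_diff .

lemma eqK_0_iff: "x \<simeq> 0 \<longleftrightarrow> x \<in> KZ"
  by (simp add: eqK_def)

lemma fin_valid_eBl: "fin_valid n Ib (eBl \<kappa> lam)"
proof (rule fin_validI)
  show "fin_supp (eBl \<kappa> lam)" unfolding eBl_def csum_eq by simp
  fix w assume "eBl \<kappa> lam w \<noteq> (0::'a)"
  then have "(\<Sum>\<nu>\<in>Iblock \<kappa> lam. wd [E \<nu>] w) \<noteq> (0::'a)" by (simp add: eBl_def csum_def)
  then obtain \<nu> where "\<nu> \<in> Iblock \<kappa> lam" "wd [E \<nu>] w \<noteq> (0::'a)" by (meson sum.neutral)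
  then show "valid w" using Iblock_subset by (auto simp: wd_def valid_gen_def split: if_splits)
qed

lemma fin_valid_M: "valid u \<Longrightarrow> fin_valid n Ib (M u)"
  unfolding M_def by (intro fin_valid_cmul fin_valid_wd fin_valid_eBl)

lemma cmul_wd_M: "cmul (wd u) (M v) = M (u @ v)"
  unfolding M_def by (simp add: cmul_assoc[symmetric])

lemma cmul_wd_eqK: "x \<simeq> y \<Longrightarrow> valid u \<Longrightarrow> cmul (wd u) x \<simeq> cmul (wd u) y"
  unfolding eqK_def using KZ_cmul[of "x - y" "wd u"] by (simp add: cmul_diff)

lemma M_KZ_append: "M v \<in> KZ \<Longrightarrow> valid u \<Longrightarrow> M (u @ v) \<in> KZ"
  using KZ_cmul[of "M v" "wd u"] by (simp add: cmul_wd_M)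

lemma rel_KZ: "r \<in> qh_rels n Ib \<Longrightarrow> valid u \<Longrightarrow> valid v \<Longrightarrow> cmul (wd u) (cmul r (M v)) \<in> KZ"
  unfolding KZ_def by (intro lideal.rel fin_valid_wd fin_valid_M)

lemma gen_KZ: "g \<in> dgens \<Longrightarrow> valid u \<Longrightarrow> cmul (wd u) g \<in> KZ"
  unfolding KZ_def by (intro lideal.gen fin_valid_wd)

section \<open>Defining relations applied to words on the cyclic vector\<close>

lemma M_E_E:
  assumes "valid u" "valid v" "\<nu> \<in> Ib" "\<nu>' \<in> Ib"
  shows "M (u @ E \<nu> # E \<nu>' # v) \<simeq> csc (deltal \<nu> \<nu>') (M (u @ E \<nu> # v))"
proof -
  have "csub (wd [E \<nu>, E \<nu>']) (csc (deltal \<nu> \<nu>') (wd [E \<nu>])) \<in> qh_rels n Ib"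
    using assms unfolding qh_rels_def Un_iff by blast
  from rel_KZ[OF this assms(1,2)] show ?thesis
    unfolding csub_eq cmul_diff cmul_csc cmul_wd_M eqK_def by simp
qed

lemma M_E_X:
  assumes "valid u" "valid v" "\<nu> \<in> Ib" "1 \<le> r" "r \<le> n"
  shows "M (u @ X r # E \<nu> # v) \<simeq> M (u @ E \<nu> # X r # v)"
proof -
  have "csub (wd [X r, E \<nu>]) (wd [E \<nu>, X r]) \<in> qh_rels n Ib"
    using assms unfolding qh_rels_def Un_iff by blast
  from rel_KZ[OF this assms(1,2)] show ?thesis
    unfolding csub_eq cmul_diff cmul_wd_M eqK_def by simp
qed

lemma M_E_Psi:
  assumes "valid u" "valid v" "\<nu> \<in> Ib" "1 \<le> r" "r < n"
  shows "M (u @ Psi r # E \<nu> # v) \<simeq> M (u @ E (sw r \<nu>) # Psi r # v)"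
proof -
  have "csub (wd [Psi r, E \<nu>]) (wd [E (sw r \<nu>), Psi r]) \<in> qh_rels n Ib"
    using assms unfolding qh_rels_def Un_iff by blast
  from rel_KZ[OF this assms(1,2)] show ?thesis
    unfolding csub_eq cmul_diff cmul_wd_M eqK_def by simp
qed

lemma M_Psi_X:
  assumes "valid u" "valid v" "1 \<le> r" "r < n" "1 \<le> s" "s \<le> n" "s \<noteq> r" "s \<noteq> Suc r"
  shows "M (u @ Psi r # X s # v) \<simeq> M (u @ X s # Psi r # v)"
proof -
  have "csub (wd [Psi r, X s]) (wd [X s, Psi r]) \<in> qh_rels n Ib"
    using assms unfolding qh_rels_def Un_iff by blast
  from rel_KZ[OF this assms(1,2)] show ?thesis
    unfolding csub_eq cmul_diff cmul_wd_M eqK_def by simp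
qed

lemma M_Psi_Psi:
  assumes "valid u" "valid v" "1 \<le> r" "Suc r < s" "s < n"
  shows "M (u @ Psi r # Psi s # v) \<simeq> M (u @ Psi s # Psi r # v)"
proof -
  have "1 \<le> r \<and> r < n \<and> 1 \<le> s \<and> s < n \<and> (Suc r < s \<or> Suc s < r)" using assms by auto
  then have "csub (wd [Psi r, Psi s]) (wd [Psi s, Psi r]) \<in> qh_rels n Ib"
    unfolding qh_rels_def Un_iff by blast
  from rel_KZ[OF this assms(1,2)] show ?thesis
    unfolding csub_eq cmul_diff cmul_wd_M eqK_def by simp
qed

lemma wtrace_Ib: "valid u \<Longrightarrow> \<nu> \<in> Ib \<Longrightarrow> wtrace u \<nu> = Some (\<mu>, d) \<Longrightarrow> \<mu> \<in> Ib"
  by (induction u arbitrary: \<mu> d) (auto simp: valid_gen_def Ibeta_sw split: option.splits gen.splits if_splits)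

text \<open>Orthogonality leaves of \<open>eBl\<close> at most the summand of \<mu>; the Specht
  generators then compare this idempotent with the cyclic vector.\<close>

lemma M_E:
  assumes "\<mu> \<in> Ib" shows "M [E \<mu>] \<simeq> csc (deltal \<mu> (nu0 \<kappa> lam)) (M [])"
proof -
  have "M [E \<mu>] = (\<Sum>\<nu>\<in>Iblock \<kappa> lam. wd [E \<mu>, E \<nu>])"
    unfolding M_def eBl_def csum_eq cmul_sum by simp
  also have "\<dots> \<simeq> (\<Sum>\<nu>\<in>Iblock \<kappa> lam. csc (deltal \<mu> \<nu>) (wd [E \<mu>]))"
  proof -
    have "wd [E \<mu>, E \<nu>] - csc (deltal \<mu> \<nu>) (wd [E \<mu>]) \<in> KZ" if nu: "\<nu> \<in> Iblock \<kappa> lam" for \<nu>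
    proof -
      have nuI: "\<nu> \<in> Ib" using nu Iblock_subset by blast
      have "csub (wd [E \<mu>, E \<nu>]) (csc (deltal \<mu> \<nu>) (wd [E \<mu>])) \<in> qh_rels n Ib"
        using assms nuI unfolding qh_rels_def Un_iff by blast
      from lideal.rel[OF this, of n Ib "wd []" "wd []" dgens] show ?thesis
        unfolding KZ_def csub_eq cmul_diff cmul_csc by simp
    qed
    then show ?thesis unfolding eqK_def sum_subtractf[symmetric] by (rule KZ_sum)
  qed
  also have "(\<Sum>\<nu>\<in>Iblock \<kappa> lam. csc (deltal \<mu> \<nu>) (wd [E \<mu>])) = csc (of_bool (\<mu> \<in> Iblock \<kappa> lam)) (wd [E \<mu>])"
    unfolding csc_sum(2)[symmetric] by (simp add: deltal_def of_bool_def)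
  also have "\<dots> \<simeq> csc (deltal \<mu> (nu0 \<kappa> lam)) (M [])"
  proof (cases "\<mu> \<in> Iblock \<kappa> lam")
    case True
    then have "csub (wd [E \<mu>]) (csc (deltal \<mu> (nu0 \<kappa> lam)) (eBl \<kappa> lam)) \<in> dgens"
      unfolding dgens_def specht_rest_def by blast
    from gen_KZ[OF this, of "[]"] show ?thesis using True
      unfolding csub_eq eqK_def M_def by simp
  next
    case False
    then have "\<mu> \<noteq> nu0 \<kappa> lam" by auto
    then show ?thesis using False by (simp add: deltal_def)
  qed
  finally show ?thesis .
qed

text \<open>\<open>wtrace\<close> only tracks symbols, so its verdicts have to be derived from the
  relations. The two claims go together: a mismatch at a letter E gives 0 because the word behind it
  is known to lie in the idempotent of its trace.\<close>

lemma M_E_trace: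
  assumes "valid u"
  shows "(wtrace u (nu0 \<kappa> lam) = None \<longrightarrow> M u \<in> KZ) \<and>
    (\<forall>\<nu> d \<mu>. wtrace u (nu0 \<kappa> lam) = Some (\<nu>, d) \<longrightarrow> \<mu> \<in> Ib \<longrightarrow> M (E \<mu> # u) \<simeq> csc (deltal \<mu> \<nu>) (M u))"
  using assms
proof (induction u)
  case Nil
  then show ?case using M_E by auto
next
  case (Cons g u)
  have u: "valid u" and g: "valid_gen n Ib g" using Cons.prems by auto
  note IH = Cons.IH[OF u]
  show ?case
  proof (cases "wtrace u (nu0 \<kappa> lam)")
    case None
    then have "M u \<in> KZ" using IH by blast
    then have "M (g # u) \<in> KZ" using M_KZ_append[of u "[g]"] g by simp
    then show ?thesis using None by simp
  next
    case (Some p)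
    obtain \<nu> d where p: "p = (\<nu>, d)" by (cases p)
    have nu: "\<nu> \<in> Ib" using wtrace_Ib[OF u nu0_Ibeta] Some p by blast
    have IH': "M (E \<mu> # u) \<simeq> csc (deltal \<mu> \<nu>) (M u)" if "\<mu> \<in> Ib" for \<mu> using IH Some p that by blast
    have IH'': "M (g # E \<mu> # u) \<simeq> csc (deltal \<mu> \<nu>) (M (g # u))" if "\<mu> \<in> Ib" for \<mu>
      using cmul_wd_eqK[OF IH'[OF that], of "[g]"] g unfolding cmul_csc cmul_wd_M by simp
    show ?thesis
    proof (cases g)
      case (E \<nu>')
      have nu': "\<nu>' \<in> Ib" using g E by (simp add: valid_gen_def)
      have m: "M (E \<nu>' # u) \<simeq> csc (deltal \<nu>' \<nu>) (M u)" by (rule IH'[OF nu'])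
      show ?thesis
      proof (cases "\<nu>' = \<nu>")
        case True
        have "M (E \<mu> # E \<nu> # u) \<simeq> csc (deltal \<mu> \<nu>) (M (E \<nu> # u))" if "\<mu> \<in> Ib" for \<mu>
        proof -
          have "M (E \<mu> # E \<nu> # u) \<simeq> csc (deltal \<mu> \<nu>) (M (E \<mu> # u))"
            using M_E_E[of "[]" u \<mu> \<nu>] u that nu by simp
          then show ?thesis by (cases "\<mu> = \<nu>") (auto simp: deltal_def)
        qed
        then show ?thesis using E True Some p by simp
      next
        case False
        then have "M (E \<nu>' # u) \<in> KZ" using m by (simp add: deltal_def eqK_0_iff)
        then show ?thesis using E False Some p by simp
      qed
    next
      case (X r)
      have r: "1 \<le> r" "r \<le> n" using g X by (auto simp: valid_gen_def)
      have "M (E \<mu> # X r # u) \<simeq> csc (deltal \<mu> \<nu>) (M (X r # u))" if "\<mu> \<in> Ib" for \<mu>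
        using eqK_trans[OF eqK_sym[OF M_E_X[of "[]" u \<mu> r]]] IH''[OF that] X u that r by simp
      then show ?thesis using X Some p by simp
    next
      case (Psi r)
      have r: "1 \<le> r" "r < n" using g Psi by (auto simp: valid_gen_def)
      have "M (E \<mu> # Psi r # u) \<simeq> csc (deltal \<mu> (sw r \<nu>)) (M (Psi r # u))" if mu: "\<mu> \<in> Ib" for \<mu>
      proof -
        have l: "length \<mu> = n" "length \<nu> = n" using Ibeta_length mu nu by auto
        have s: "sw r \<mu> \<in> Ib" by (rule Ibeta_sw[OF mu r])
        have ss: "sw r (sw r \<mu>) = \<mu>" "sw r (sw r \<nu>) = \<nu>" using nth_sw_sw r l by auto
        have "M (Psi r # E (sw r \<mu>) # u) \<simeq> M (E \<mu> # Psi r # u)"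
          using M_E_Psi[of "[]" u "sw r \<mu>" r] u s r ss by simp
        moreover have "deltal (sw r \<mu>) \<nu> = (deltal \<mu> (sw r \<nu>) :: int poly)"
          using ss unfolding deltal_def by metis
        ultimately show ?thesis using IH''[OF s] Psi eqK_trans eqK_sym by metis
      qed
      then show ?thesis using Psi Some p by simp
    qed
  qed
qed

lemma M_None: "valid u \<Longrightarrow> wtrace u (nu0 \<kappa> lam) = None \<Longrightarrow> M u \<in> KZ"
  using M_E_trace by blast

text \<open>Several relations for \<psi> carry an idempotent on the right while the words to be
  rewritten need not. The trace tells which one may be inserted.\<close>

lemma M_E_insert:
  assumes "valid u" "valid v" "wtrace v (nu0 \<kappa> lam) = Some (\<nu>, d)"
  shows "M (u @ E \<nu> # v) \<simeq> M (u @ v)"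
proof -
  have "\<nu> \<in> Ib" using wtrace_Ib[OF assms(2) nu0_Ibeta assms(3)] .
  then have "M (E \<nu> # v) \<simeq> M v" using M_E_trace[OF assms(2)] assms(3) by (force simp: deltal_def)
  from cmul_wd_eqK[OF this assms(1)] show ?thesis unfolding cmul_wd_M .
qed

text \<open>One statement for the three commutation rules, with e the signed Kronecker delta. The
  condition under which e \<noteq> 0 will show that the error term has the right degree and
  residues.\<close>

lemma M_X_Psi:
  assumes u: "valid u" and v: "valid v" and tr: "wtrace v (nu0 \<kappa> lam) = Some (\<nu>, d)"
    and r: "1 \<le> r" "r < n" and a: "1 \<le> a" "a \<le> n"
  shows "\<exists>e. M (u @ X a # Psi r # v) \<simeq> M (u @ Psi r # X (sref r a) # v) + csc (of_int e) (M (u @ v)) \<and>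
    (e \<noteq> 0 \<longrightarrow> nth1 \<nu> r = nth1 \<nu> (Suc r) \<and> (a = r \<or> a = Suc r))"
proof -
  have nu: "\<nu> \<in> Ib" using wtrace_Ib[OF v nu0_Ibeta tr] .
  let ?\<delta> = "delta (nth1 \<nu> r) (nth1 \<nu> (Suc r)) :: int poly"
  have ins: "M (u @ w @ E \<nu> # v) \<simeq> M (u @ w @ v)" if "valid w" for w
    using M_E_insert[of "u @ w" v \<nu> d] u v tr that by simp
  note insl = ins[of "[X r, Psi r]"] ins[of "[X (Suc r), Psi r]"] ins[of "[Psi r, X r]"]
    ins[of "[Psi r, X (Suc r)]"] ins[of "[]"]
  have vg: "valid [X r, Psi r]" "valid [X (Suc r), Psi r]" "valid [Psi r, X r]" "valid [Psi r, X (Suc r)]"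
    using r by (auto simp: valid_gen_def)
  consider "a = r" | "a = Suc r" | "a \<noteq> r" "a \<noteq> Suc r" by blast
  then show ?thesis
  proof cases
    case 1
    have "csub (wd [X r, Psi r, E \<nu>]) (csub (wd [Psi r, X (Suc r), E \<nu>]) (csc ?\<delta> (wd [E \<nu>]))) \<in> qh_rels n Ib"
      using r nu unfolding qh_rels_def Un_iff by blast
    from rel_KZ[OF this u v] have
      "M (u @ [X r, Psi r] @ E \<nu> # v) \<simeq> M (u @ [Psi r, X (Suc r)] @ E \<nu> # v) - csc ?\<delta> (M (u @ E \<nu> # v))"
      unfolding csub_eq cmul_diff cmul_csc cmul_wd_M eqK_def by simp
    also have "\<dots> \<simeq> M (u @ [Psi r, X (Suc r)] @ v) - csc ?\<delta> (M (u @ v))"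
      using insl vg by (intro eqK_diff eqK_csc) auto
    finally have "M (u @ [X r, Psi r] @ v) \<simeq> M (u @ [Psi r, X (Suc r)] @ v) - csc ?\<delta> (M (u @ v))"
      using eqK_trans[OF eqK_sym[OF insl(1)[OF vg(1)]]] by blast
    then show ?thesis using 1 by (intro exI[of _ "- delta (nth1 \<nu> r) (nth1 \<nu> (Suc r))"])
      (auto simp: delta_def sref_def csc_minus)
  next
    case 2
    have "csub (wd [X (Suc r), Psi r, E \<nu>]) (cadd (wd [Psi r, X r, E \<nu>]) (csc ?\<delta> (wd [E \<nu>]))) \<in> qh_rels n Ib"
      using r nu unfolding qh_rels_def Un_iff by blast
    from rel_KZ[OF this u v] have
      "M (u @ [X (Suc r), Psi r] @ E \<nu> # v) \<simeq> M (u @ [Psi r, X r] @ E \<nu> # v) + csc ?\<delta> (M (u @ E \<nu> # v))"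
      unfolding csub_eq cadd_eq cmul_diff cmul_add cmul_csc cmul_wd_M eqK_def by simp
    also have "\<dots> \<simeq> M (u @ [Psi r, X r] @ v) + csc ?\<delta> (M (u @ v))"
      using insl vg by (intro eqK_add eqK_csc) auto
    finally have "M (u @ [X (Suc r), Psi r] @ v) \<simeq> M (u @ [Psi r, X r] @ v) + csc ?\<delta> (M (u @ v))"
      using eqK_trans[OF eqK_sym[OF insl(2)[OF vg(2)]]] by blast
    then show ?thesis using 2 by (intro exI[of _ "delta (nth1 \<nu> r) (nth1 \<nu> (Suc r))"])
      (auto simp: delta_def sref_def)
  next
    case 3
    then have "M (u @ X a # Psi r # v) \<simeq> M (u @ Psi r # X (sref r a) # v)"
      using eqK_sym[OF M_Psi_X[OF u v r a]] by (simp add: sref_def)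
    then show ?thesis by (intro exI[of _ 0]) simp
  qed
qed

lemma M_square:
  assumes u: "valid u" and v: "valid v" and tr: "wtrace v (nu0 \<kappa> lam) = Some (\<nu>, d)" and r: "1 \<le> r" "r < n"
  shows "M (u @ Psi r # Psi r # v) \<simeq>
    cmul (wd u) (cmul (qeval (Qpoly (nth1 \<nu> r) (nth1 \<nu> (Suc r))) r (Suc r) [E \<nu>]) (M v))"
proof -
  have nu: "\<nu> \<in> Ib" using wtrace_Ib[OF v nu0_Ibeta tr] .
  have "csub (wd [Psi r, Psi r, E \<nu>]) (qeval (Qpoly (nth1 \<nu> r) (nth1 \<nu> (Suc r))) r (Suc r) [E \<nu>]) \<in> qh_rels n Ib"
    using r nu unfolding qh_rels_def Un_iff by blast
  from rel_KZ[OF this u v] have "M (u @ [Psi r, Psi r] @ E \<nu> # v) \<simeq>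
    cmul (wd u) (cmul (qeval (Qpoly (nth1 \<nu> r) (nth1 \<nu> (Suc r))) r (Suc r) [E \<nu>]) (M v))"
    unfolding csub_eq cmul_diff cmul_wd_M eqK_def by simp
  moreover have "valid (u @ [Psi r, Psi r])" using u r by (simp add: valid_gen_def)
  from M_E_insert[OF this v tr] have "M (u @ [Psi r, Psi r] @ E \<nu> # v) \<simeq> M (u @ Psi r # Psi r # v)" by simp
  ultimately show ?thesis using eqK_trans eqK_sym by blast
qed

lemma M_braid:
  assumes u: "valid u" and v: "valid v" and tr: "wtrace v (nu0 \<kappa> lam) = Some (\<nu>, d)" and r: "1 \<le> r" "Suc r < n"
  shows "M (u @ Psi (Suc r) # Psi r # Psi (Suc r) # v) - M (u @ Psi r # Psi (Suc r) # Psi r # v) \<simeq>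
    cmul (wd u) (cmul (if nth1 \<nu> r = nth1 \<nu> (Suc (Suc r))
       then ddeval (Qpoly (nth1 \<nu> r) (nth1 \<nu> (Suc r))) r (Suc r) (Suc (Suc r)) [E \<nu>] else 0) (M v))"
    (is "_ \<simeq> cmul (wd u) (cmul ?d (M v))")
proof -
  have nu: "\<nu> \<in> Ib" using wtrace_Ib[OF v nu0_Ibeta tr] .
  have "1 \<le> r \<and> Suc (Suc r) \<le> n \<and> \<nu> \<in> Ib" using r nu by simp
  then have "csub (csub (wd [Psi (Suc r), Psi r, Psi (Suc r), E \<nu>]) (wd [Psi r, Psi (Suc r), Psi r, E \<nu>]))
    (if nth1 \<nu> r = nth1 \<nu> (Suc (Suc r))
           then ddeval (Qpoly (nth1 \<nu> r) (nth1 \<nu> (Suc r))) r (Suc r) (Suc (Suc r)) [E \<nu>]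
           else (\<lambda>_. 0)) \<in> qh_rels n Ib"
    unfolding qh_rels_def Un_iff by blast
  from rel_KZ[OF this u v] have "M (u @ [Psi (Suc r), Psi r, Psi (Suc r)] @ E \<nu> # v)
     - M (u @ [Psi r, Psi (Suc r), Psi r] @ E \<nu> # v) \<simeq> cmul (wd u) (cmul ?d (M v))"
    unfolding csub_eq zero_fun_eq cmul_diff cmul_wd_M eqK_def by simp
  moreover have V: "valid (u @ [Psi (Suc r), Psi r, Psi (Suc r)])" "valid (u @ [Psi r, Psi (Suc r), Psi r])"
    using u r by (simp_all add: valid_gen_def)
  have "M (u @ [Psi (Suc r), Psi r, Psi (Suc r)] @ E \<nu> # v) - M (u @ [Psi r, Psi (Suc r), Psi r] @ E \<nu> # v)
    \<simeq> M (u @ Psi (Suc r) # Psi r # Psi (Suc r) # v) - M (u @ Psi r # Psi (Suc r) # Psi r # v)"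
    using M_E_insert[OF V(1) v tr] M_E_insert[OF V(2) v tr] by (intro eqK_diff) simp_all
  ultimately show ?thesis using eqK_trans eqK_sym by blast
qed

end

context specht
begin

section \<open>The graded span of the vectors of standard tableaux\<close>

definition relative_degree :: "(nat \<times> nat \<Rightarrow> nat) \<Rightarrow> int" where
  "relative_degree t = tdeg \<kappa> lam t - tdeg \<kappa> lam (tlam lam)"

definition PM :: "(nat \<times> nat \<Rightarrow> nat) \<Rightarrow> gen list \<Rightarrow> int poly" where
  "PM t = M (psiw (red (wperm lam t)))"

text \<open>The coefficient of \<open>PM t\<close> must supply the degree that t lacks, and only
  tableaux of residue sequence \<nu> occur. Tracking both over \<int>[z] makes straightening and the
  character come from one induction.\<close>

definition Sp :: "nat list \<Rightarrow> int \<Rightarrow> (gen list \<Rightarrow> int poly) set" where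
  "Sp \<nu> d = {y. \<exists>a. (\<forall>t\<in>Std lam. a t \<in> mono_deg (d - relative_degree t) \<and> (a t \<noteq> 0 \<longrightarrow> resseq \<kappa> lam t = \<nu>)) \<and>
     y \<simeq> (\<Sum>t\<in>Std lam. csc (a t) (PM t))}"

lemma SpI:
  assumes "\<And>t. t \<in> Std lam \<Longrightarrow> a t \<in> mono_deg (d - relative_degree t) \<and> (a t \<noteq> 0 \<longrightarrow> resseq \<kappa> lam t = \<nu>)"
    "y \<simeq> (\<Sum>t\<in>Std lam. csc (a t) (PM t))"
  shows "y \<in> Sp \<nu> d"
  unfolding Sp_def using assms by blast

lemma Sp_0: "0 \<in> Sp \<nu> d"
  by (rule SpI[of "\<lambda>_. 0"]) simp_all

lemma Sp_add:
  assumes "x \<in> Sp \<nu> d" "y \<in> Sp \<nu> d" shows "x + y \<in> Sp \<nu> d"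
proof -
  obtain a b where a: "\<And>t. t \<in> Std lam \<Longrightarrow> a t \<in> mono_deg (d - relative_degree t) \<and> (a t \<noteq> 0 \<longrightarrow> resseq \<kappa> lam t = \<nu>)"
      "x \<simeq> (\<Sum>t\<in>Std lam. csc (a t) (PM t))"
    and b: "\<And>t. t \<in> Std lam \<Longrightarrow> b t \<in> mono_deg (d - relative_degree t) \<and> (b t \<noteq> 0 \<longrightarrow> resseq \<kappa> lam t = \<nu>)"
      "y \<simeq> (\<Sum>t\<in>Std lam. csc (b t) (PM t))"
    using assms unfolding Sp_def by auto
  have "x + y \<simeq> (\<Sum>t\<in>Std lam. csc (a t + b t) (PM t))"
    using eqK_add[OF a(2) b(2)] unfolding csc_add sum.distrib .
  then show ?thesis
    by (rule SpI[rotated]) (use a(1) b(1) in \<open>force intro: mono_deg_add\<close>)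
qed

lemma Sp_csc:
  assumes "x \<in> Sp \<nu> d" "p \<in> mono_deg e" shows "csc p x \<in> Sp \<nu> (d + e)"
proof -
  obtain a where a: "\<And>t. t \<in> Std lam \<Longrightarrow> a t \<in> mono_deg (d - relative_degree t) \<and> (a t \<noteq> 0 \<longrightarrow> resseq \<kappa> lam t = \<nu>)"
      "x \<simeq> (\<Sum>t\<in>Std lam. csc (a t) (PM t))"
    using assms unfolding Sp_def by auto
  have "csc p x \<simeq> (\<Sum>t\<in>Std lam. csc (p * a t) (PM t))"
    using eqK_csc[OF a(2), of p] unfolding csc_sum csc_simps .
  moreover have "p * a t \<in> mono_deg (d + e - relative_degree t)" if "t \<in> Std lam" for t
    using mono_deg_mult[OF assms(2), of "a t" "d - relative_degree t"] a(1)[OF that] by (simp add: algebra_simps)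
  ultimately show ?thesis
    by (intro SpI[where a = "\<lambda>t. p * a t"]) (use a(1) in auto)
qed

lemma Sp_of_int: "x \<in> Sp \<nu> d \<Longrightarrow> csc (of_int m) x \<in> Sp \<nu> d"
  using Sp_csc[OF _ mono_deg_of_int, of x \<nu> d m] by simp

lemma Sp_uminus: "x \<in> Sp \<nu> d \<Longrightarrow> - x \<in> Sp \<nu> d"
  using Sp_of_int[of x \<nu> d "- 1"] by (simp add: csc_minus)

lemma Sp_sum: "(\<And>i. i \<in> I \<Longrightarrow> F i \<in> Sp \<nu> d) \<Longrightarrow> sum F I \<in> Sp \<nu> d"
  by (induction I rule: infinite_finite_induct) (auto intro: Sp_0 Sp_add)

lemma Sp_eqK: "x \<in> Sp \<nu> d \<Longrightarrow> y \<simeq> x \<Longrightarrow> y \<in> Sp \<nu> d"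
  unfolding Sp_def using eqK_trans by blast

lemma Sp_KZ: "x \<in> KZ \<Longrightarrow> x \<in> Sp \<nu> d"
  using Sp_eqK[OF Sp_0] by (simp add: eqK_0_iff)

lemma Sp_PM:
  assumes "t \<in> Std lam" shows "PM t \<in> Sp (resseq \<kappa> lam t) (relative_degree t)"
proof (rule SpI[where a = "\<lambda>s. if s = t then 1 else 0"])
  show "PM t \<simeq> (\<Sum>s\<in>Std lam. csc (if s = t then 1 else 0) (PM s))"
    using assms by (simp add: if_distrib[of "\<lambda>a. csc a _"] cong: if_cong)
qed (use mono_deg_of_int[of 1] in auto)

lemma psiw_valid [simp]: "set is \<subseteq> {1..<n} \<Longrightarrow> valid (psiw is)"
  by (induction "is") (auto simp: valid_gen_def)

lemma length_nu0: "length (nu0 \<kappa> lam) = n"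
  using Ibeta_length[OF nu0_Ibeta] .

section \<open>Spanning: the induction step for words with l letters \<psi>\<close>

context
  fixes l :: nat
  assumes IH: "\<And>u \<nu> d. valid u \<Longrightarrow> npsi u < l \<Longrightarrow> wtrace u (nu0 \<kappa> lam) = Some (\<nu>, d) \<Longrightarrow> M u \<in> Sp \<nu> d"
begin

lemma Sp_qeval:
  assumes "valid u" "valid v" "npsi u + npsi v < l" "wtrace v (nu0 \<kappa> lam) = Some (\<mu>, e)"
    and "wtrace u \<mu> = Some (\<nu>, f)" "1 \<le> r" "r < n"
    and "\<And>c a b. (c, a, b) \<in> set p \<Longrightarrow> int a * ip (nth1 \<mu> r) (nth1 \<mu> r) + int b * ip (nth1 \<mu> (Suc r)) (nth1 \<mu> (Suc r)) = D"
  shows "cmul (wd u) (cmul (qeval p r (Suc r) [E \<mu>]) (M v)) \<in> Sp \<nu> (e + D + f)"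
  using assms(8)
proof (induction p)
  case Nil
  show ?case unfolding qeval_Nil cmul_0 by (rule Sp_0)
next
  case (Cons x p)
  obtain c a b where x: "x = (c, a, b)" by (metis prod_cases3)
  have \<mu>: "\<mu> \<in> Ib" using wtrace_Ib[OF assms(2) nu0_Ibeta assms(4)] .
  let ?w = "u @ replicate a (X r) @ replicate b (X (Suc r)) @ E \<mu> # v"
  have "valid (replicate a (X r))" "valid (replicate b (X (Suc r)))"
    using assms by (auto simp: valid_word_def valid_gen_def)
  then have "valid ?w" using assms \<mu> by (simp add: valid_gen_def)
  moreover have "npsi ?w < l" using assms by simp
  moreover have "wtrace ?w (nu0 \<kappa> lam) = Some (\<nu>, e + D + f)"
    using assms Cons.prems[of c a b] x by (simp add: wtrace_append wtrace_replicate_X)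
  ultimately have "M ?w \<in> Sp \<nu> (e + D + f)" by (rule IH)
  then have "csc (of_int c) (M ?w) + cmul (wd u) (cmul (qeval p r (Suc r) [E \<mu>]) (M v)) \<in> Sp \<nu> (e + D + f)"
    using Cons by (intro Sp_add Sp_of_int) auto
  moreover have "cmul (wd u) (cmul (qeval (x # p) r (Suc r) [E \<mu>]) (M v))
    = csc (of_int c) (M ?w) + cmul (wd u) (cmul (qeval p r (Suc r) [E \<mu>]) (M v))"
    unfolding x qeval_Cons cmul_add cmul_csc cmul_wd_M by simp
  ultimately show ?case by metis
qed

text \<open>Dividing by x_r - x_(r+2) lowers the degree by that of x_r, and x_(r+2) has the same
  degree because the residues at r and r + 2 agree.\<close>

lemma Sp_ddeval:
  assumes "valid u" "valid v" "npsi u + npsi v < l" "wtrace v (nu0 \<kappa> lam) = Some (\<mu>, e)"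
    and "wtrace u \<mu> = Some (\<nu>, f)" "1 \<le> r" "Suc r < n" and eq: "nth1 \<mu> r = nth1 \<mu> (Suc (Suc r))"
    and "\<And>c a b. (c, a, b) \<in> set p \<Longrightarrow> int a * ip (nth1 \<mu> r) (nth1 \<mu> r) + int b * ip (nth1 \<mu> (Suc r)) (nth1 \<mu> (Suc r)) = D"
  shows "cmul (wd u) (cmul (ddeval p r (Suc r) (Suc (Suc r)) [E \<mu>]) (M v)) \<in> Sp \<nu> (e + (D - ip (nth1 \<mu> r) (nth1 \<mu> r)) + f)"
  using assms(9)
proof (induction p)
  case Nil
  show ?case unfolding ddeval_Nil cmul_0 by (rule Sp_0)
next
  case (Cons x p)
  obtain c a b where x: "x = (c, a, b)" by (metis prod_cases3)
  have \<mu>: "\<mu> \<in> Ib" using wtrace_Ib[OF assms(2) nu0_Ibeta assms(4)] .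
  let ?D = "e + (D - ip (nth1 \<mu> r) (nth1 \<mu> r)) + f"
  let ?w = "\<lambda>k. u @ replicate k (X r) @ replicate (a - 1 - k) (X (Suc (Suc r))) @ replicate b (X (Suc r)) @ E \<mu> # v"
  have w: "M (?w k) \<in> Sp \<nu> ?D" if k: "k < a" for k
  proof (rule IH)
    have "valid (replicate m (X r))" "valid (replicate m (X (Suc r)))" "valid (replicate m (X (Suc (Suc r))))" for m
      using assms by (auto simp: valid_word_def valid_gen_def)
    then show "valid (?w k)" using assms \<mu> by (simp add: valid_gen_def)
    show "npsi (?w k) < l" using assms by simp
    have "int (a - 1 - k) = int a - 1 - int k" using k by linarith
    then show "wtrace (?w k) (nu0 \<kappa> lam) = Some (\<nu>, ?D)"
      using assms(4,5) Cons.prems[of c a b] x eq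
      by (simp add: wtrace_append wtrace_replicate_X algebra_simps)
  qed
  have "csc (of_int c) (\<Sum>k<a. M (?w k)) + cmul (wd u) (cmul (ddeval p r (Suc r) (Suc (Suc r)) [E \<mu>]) (M v)) \<in> Sp \<nu> ?D"
    using Cons w by (intro Sp_add Sp_of_int Sp_sum) auto
  moreover have "cmul (wd u) (cmul (ddeval (x # p) r (Suc r) (Suc (Suc r)) [E \<mu>]) (M v))
    = csc (of_int c) (\<Sum>k<a. M (?w k)) + cmul (wd u) (cmul (ddeval p r (Suc r) (Suc (Suc r)) [E \<mu>]) (M v))"
    unfolding x ddeval_Cons cmul_add cmul_csc cmul_sum cmul_wd_M by simp
  ultimately show ?case by metis
qed

text \<open>Two letters \<psi> are traded for a polynomial of the same degree, so the induction
  hypothesis applies.\<close>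

lemma Sp_square:
  assumes "set xs \<subseteq> {1..<n}" "set ys \<subseteq> {1..<n}" "1 \<le> r" "r < n" "length (xs @ [r, r] @ ys) = l"
    and tr: "wtrace (psiw (xs @ [r, r] @ ys)) (nu0 \<kappa> lam) = Some (\<nu>, d)"
  shows "M (psiw (xs @ [r, r] @ ys)) \<in> Sp \<nu> d"
proof -
  obtain \<mu> e where m: "wtrace (psiw ys) (nu0 \<kappa> lam) = Some (\<mu>, e)" using wtrace_psiw_Some by blast
  have v: "valid (psiw xs)" "valid (psiw ys)" using assms by auto
  have \<mu>: "\<mu> \<in> Ib" using wtrace_Ib[OF v(2) nu0_Ibeta m] .
  have len: "length \<mu> = n" using Ibeta_length[OF \<mu>] .
  obtain \<nu>' f where f: "wtrace (psiw xs) \<mu> = Some (\<nu>', f)" using wtrace_psiw_Some by blast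
  have "nth1 (sw r \<mu>) r = nth1 \<mu> (Suc r)" "nth1 (sw r \<mu>) (Suc r) = nth1 \<mu> r" "sw r (sw r \<mu>) = \<mu>"
    using assms(3,4) len by (auto simp: nth1_sw sref_def nth_sw_sw)
  then have \<nu>: "\<nu>' = \<nu>" "d = e + (- 2 * ip (nth1 \<mu> r) (nth1 \<mu> (Suc r))) + f"
    using tr m f by (auto simp: wtrace_append ip_sym[of "nth1 \<mu> (Suc r)"])
  have "cmul (wd (psiw xs)) (cmul (qeval (Qpoly (nth1 \<mu> r) (nth1 \<mu> (Suc r))) r (Suc r) [E \<mu>]) (M (psiw ys))) \<in> Sp \<nu> d"
    unfolding \<nu>(2) by (rule Sp_qeval) (use v m f \<nu> assms Qpoly_homogeneous in auto)
  then show ?thesis using M_square[OF v m assms(3,4)] Sp_eqK by simp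
qed

text \<open>Stated for the difference, since neither word is known yet to lie in the span. A
  commutation is an equality in the module; a braid move leaves an error with three \<psi>'s
  fewer.\<close>

lemma Sp_beq:
  assumes "beq xs ys" "set xs \<subseteq> {1..<n}" "length xs = l" "wtrace (psiw xs) (nu0 \<kappa> lam) = Some (\<nu>, d)"
  shows "M (psiw xs) - M (psiw ys) \<in> Sp \<nu> d"
  using assms
proof (induction rule: beq.induct)
  case (beq_refl xs)
  show ?case unfolding diff_self by (rule Sp_0)
next
  case (beq_sym xs ys)
  have "set xs \<subseteq> {1..<n}" "length xs = l" "wtrace (psiw xs) (nu0 \<kappa> lam) = Some (\<nu>, d)"
    using beq_sym.prems beq_length_set[OF beq_sym.hyps] wtrace_beq[OF beq_sym.hyps _ length_nu0] by simp_all
  then have "M (psiw xs) - M (psiw ys) \<in> Sp \<nu> d" by (rule beq_sym.IH)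
  from Sp_uminus[OF this] show ?case unfolding minus_diff_eq .
next
  case (beq_trans xs ys zs)
  have "set ys \<subseteq> {1..<n}" "length ys = l" "wtrace (psiw ys) (nu0 \<kappa> lam) = Some (\<nu>, d)"
    using beq_trans.prems beq_length_set[OF beq_trans.hyps(1)] wtrace_beq[OF beq_trans.hyps(1) _ length_nu0] by simp_all
  from Sp_add[OF beq_trans.IH(1)[OF beq_trans.prems] beq_trans.IH(2)[OF this]]
  show ?case unfolding diff_add_cancel add_diff_eq .
next
  case (beq_comm i j xs ys)
  then have "M (psiw xs @ Psi i # Psi j # psiw ys) \<simeq> M (psiw xs @ Psi j # Psi i # psiw ys)"
    by (intro M_Psi_Psi) auto
  from Sp_KZ[OF this[unfolded eqK_def]] show ?case unfolding psiw_simps append_Cons append_Nil .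
next
  case (beq_braid xs r ys)
  obtain \<mu> e where m: "wtrace (psiw ys) (nu0 \<kappa> lam) = Some (\<mu>, e)" using wtrace_psiw_Some by blast
  have v: "valid (psiw xs)" "valid (psiw ys)" and r: "1 \<le> r" "Suc r < n" using beq_braid.prems by auto
  have \<mu>: "\<mu> \<in> Ib" using wtrace_Ib[OF v(2) nu0_Ibeta m] .
  have len: "length \<mu> = n" using Ibeta_length[OF \<mu>] .
  let ?dd = "ddeval (Qpoly (nth1 \<mu> r) (nth1 \<mu> (Suc r))) r (Suc r) (Suc (Suc r)) [E \<mu>] :: gen list \<Rightarrow> int poly"
  have "cmul (wd (psiw xs)) (cmul (if nth1 \<mu> r = nth1 \<mu> (Suc (Suc r)) then ?dd else 0) (M (psiw ys))) \<in> Sp \<nu> d"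
  proof (cases "nth1 \<mu> r = nth1 \<mu> (Suc (Suc r))")
    case True
    obtain \<nu>' f where f: "wtrace (psiw xs) \<mu> = Some (\<nu>', f)" using wtrace_psiw_Some by blast
    have "sw r (sw (Suc r) (sw r \<mu>)) = \<mu>"
      using r len True by (intro nth1_eqI) (auto simp: nth1_sw sref_def)
    then have \<nu>: "\<nu>' = \<nu>" "d = e + (- 2 * ip (nth1 \<mu> r) (nth1 \<mu> (Suc r)) - ip (nth1 \<mu> r) (nth1 \<mu> r)) + f"
      using beq_braid.prems(3) m f r len True
      by (auto simp: wtrace_append nth1_sw sref_def ip_sym[of "nth1 \<mu> (Suc r)"])
    have "cmul (wd (psiw xs)) (cmul ?dd (M (psiw ys))) \<in> Sp \<nu> d"
      unfolding \<nu>(2) by (rule Sp_ddeval) (use v m f \<nu> r True beq_braid.prems(2) Qpoly_homogeneous in auto)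
    then show ?thesis using True by simp
  qed (simp add: Sp_0)
  from Sp_eqK[OF this M_braid[OF v m r]]
  have "M (psiw xs @ Psi (Suc r) # Psi r # Psi (Suc r) # psiw ys) - M (psiw xs @ Psi r # Psi (Suc r) # Psi r # psiw ys) \<in> Sp \<nu> d" .
  from Sp_uminus[OF this] show ?case unfolding minus_diff_eq psiw_simps append_Cons append_Nil .
qed

text \<open>A reduced word belongs to a filling t. A violated row or column condition of t puts
  \<psi>_r with r inside a row, or a Garnir word, at the right end, where it kills the cyclic
  vector. Otherwise t is standard and the word may be replaced by the chosen one for t; a
  non-reduced word is handled by a square.\<close>

lemma Sp_psiw:
  assumes "set is \<subseteq> {1..<n}" "length is = l" "wtrace (psiw is) (nu0 \<kappa> lam) = Some (\<nu>, d)"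
  shows "M (psiw is) \<in> Sp \<nu> d"
proof -
  have move: "M (psiw is) \<in> Sp \<nu> d" if "beq is js" "M (psiw js) \<in> Sp \<nu> d" for js
  proof -
    have "(M (psiw is) - M (psiw js)) + M (psiw js) \<in> Sp \<nu> d"
      by (intro Sp_add Sp_beq that assms)
    then show ?thesis by simp
  qed
  let ?w = "wordperm is"
  show ?thesis
  proof (cases "length is = ilen n ?w")
    case False
    then obtain xs k ys where b: "beq is (xs @ [k, k] @ ys)" using nonreduced_beq_square assms(1) by blast
    show ?thesis
    proof (rule move[OF b], rule Sp_square)
      show "wtrace (psiw (xs @ [k, k] @ ys)) (nu0 \<kappa> lam) = Some (\<nu>, d)"
        using wtrace_beq[OF b assms(1) length_nu0] assms(3) by simp
    qed (use beq_length_set[OF b] assms in auto)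
  next
    case True
    then have rw: "rword n is ?w" using assms by (simp add: rword_def)
    note wp = rword_permutes[OF rw]
    define t where "t = ?w \<circ> tlam lam"
    have tf: "is_fill lam t" and wt: "wperm lam t = ?w"
      unfolding t_def using perm_fill[OF wp] wperm_perm[OF wp] by auto
    have kill: "M (psiw is) \<in> Sp \<nu> d"
      if js: "rword n js v" and iv: "invs n v \<subseteq> invs n ?w" and z: "M (psiw js) \<in> KZ" for js v
    proof -
      obtain ks where ks: "rword n (ks @ js) ?w" using rword_right_factor[OF js wp iv] by blast
      then have "M (psiw ks @ psiw js) \<in> KZ" using z by (intro M_KZ_append) (auto simp: rword_def)
      then show ?thesis using move[OF matsumoto[OF rw ks]] Sp_KZ by simp
    qed
    show ?thesis
    proof (cases "\<exists>a b. (a, b) \<in> nodes lam \<and> (a, Suc b) \<in> nodes lam \<and> \<not> t (a, b) < t (a, Suc b)")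
      case True
      then obtain a b where ab: "(a, b) \<in> nodes lam" "(a, Suc b) \<in> nodes lam" "\<not> t (a, b) < t (a, Suc b)" by blast
      define r where "r = tlam lam (a, b)"
      have r: "internal lam r" "tlam lam (a, Suc b) = Suc r" using nodes_internal[OF ab(1,2)] by (auto simp: r_def)
      have rn: "1 \<le> r" "r < n" using fill_range[OF tlam_fill ab(1)] fill_range[OF tlam_fill ab(2)] r by (auto simp: r_def)
      have "t (a, b) \<noteq> t (a, Suc b)" using fill_inj[OF tf ab(1,2)] by simp
      then have d: "?w (Suc r) < ?w r"
        using ab(3) wperm_tlam[OF tf ab(1)] wperm_tlam[OF tf ab(2)] r by (simp add: wt r_def)
      have "rword n [] (sref r \<circ> sref r)" by (simp add: rword_def)
      then have "rword n ([] @ [r]) (sref r)" using rn by (intro rword_snocI) (simp_all add: sref_def)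
      moreover have "invs n (sref r) \<subseteq> invs n ?w"
        using d rn by (auto simp: invs_def sref_def split: if_splits)
      moreover have "M (psiw ([] @ [r])) \<in> KZ"
        using gen_KZ[of "M [Psi r]" "[]"] r(1) rn unfolding dgens_def specht_rest_def M_def by auto
      ultimately show ?thesis by (rule kill)
    next
      case row: False
      show ?thesis
      proof (cases "\<exists>a c. (a, c) \<in> nodes lam \<and> (Suc a, c) \<in> nodes lam \<and> \<not> t (a, c) < t (Suc a, c)")
        case True
        then obtain a c where ac: "(a, c) \<in> nodes lam" "(Suc a, c) \<in> nodes lam" "\<not> t (a, c) < t (Suc a, c)" by blast
        then have A: "(a, c) \<in> garnir_nodes lam" by (simp add: garnir_nodes_def)
        have "t (a, c) \<noteq> t (Suc a, c)" using fill_inj[OF tf ac(1,2)] by simp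
        then have lt: "t (Suc a, c) < t (a, c)" using ac(3) by simp
        let ?v = "wperm lam (garnir lam (a, c))"
        note g = garnir_fill[OF part A refl refl]
        have "rword n (red ?v) ?v" by (rule red_rword[OF wperm_permutes[OF g]])
        moreover have "invs n ?v \<subseteq> invs n ?w"
          using garnir_invs_subset[OF part A refl refl tf _ lt] row wt by auto
        moreover have "M (psiw (red ?v)) \<in> KZ"
          using gen_KZ[of "M (psiw (red ?v))" "[]"] A unfolding dgens_def specht_rest_def M_def by auto
        ultimately show ?thesis by (rule kill)
      next
        case False
        then have t: "t \<in> Std lam" using tf row by (simp add: Std_iff)
        have rr: "rword n (red ?w) ?w" by (rule red_rword[OF wp])
        have b: "beq is (red ?w)" by (rule matsumoto[OF rw rr])
        have "wtrace (psiw (red ?w)) (nu0 \<kappa> lam) = Some (resseq \<kappa> lam t, relative_degree t)"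
          using wtrace_rword_Std[OF part t, of "red ?w" \<kappa>] rr wt by (simp add: relative_degree_def)
        then have "\<nu> = resseq \<kappa> lam t" "d = relative_degree t"
          using wtrace_beq[OF b assms(1) length_nu0] assms(3) by simp_all
        then show ?thesis using move[OF b] Sp_PM[OF t] by (simp add: PM_def wt)
      qed
    qed
  qed
qed

lemma M_X_end:
  assumes "valid u" "1 \<le> a" "a \<le> n"
  shows "M (u @ [X a]) \<simeq> csc (eig a) (M u)"
proof -
  have "cmul (wd [X a]) (eBl \<kappa> lam) - csc (eig a) (eBl \<kappa> lam) \<in> dgens"
    using assms unfolding dgens_def by blast
  from gen_KZ[OF this assms(1)] show ?thesis
    unfolding eqK_def cmul_diff cmul_csc M_def cmul_assoc[symmetric] cmul_wd_wd .
qed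

lemma eig_mono_deg: "1 \<le> a \<Longrightarrow> a \<le> n \<Longrightarrow> eig a \<in> mono_deg (ip (nth1 (nu0 \<kappa> lam) a) (nth1 (nu0 \<kappa> lam) a))"
  using mono_deg_cz[of "cont \<kappa> (tinv lam (tlam lam) a)"]
  by (simp add: eig_def nu0_def nth1_resseq resn_cont)

text \<open>Commuting \<open>X a\<close> to the right end leaves error terms with fewer \<open>\<psi>\<close>s.\<close>
lemma Sp_move_X:
  assumes "valid u" "set js \<subseteq> {1..<n}" "1 \<le> a" "a \<le> n" "npsi u + length js = l"
    and "wtrace (psiw js) (nu0 \<kappa> lam) = Some (\<mu>, e)" "wtrace u \<mu> = Some (\<nu>, f)"
  shows "\<exists>p\<in>mono_deg (ip (nth1 \<mu> a) (nth1 \<mu> a)).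
    M (u @ X a # psiw js) - csc p (M (u @ psiw js)) \<in> Sp \<nu> (e + ip (nth1 \<mu> a) (nth1 \<mu> a) + f)"
  using assms
proof (induction js arbitrary: u a \<mu> e f)
  case Nil
  have "M (u @ [X a]) - csc (eig a) (M u) \<in> KZ"
    using M_X_end[OF Nil(1,3,4)] unfolding eqK_def .
  then have "M (u @ X a # psiw []) - csc (eig a) (M (u @ psiw [])) \<in> Sp \<nu> (e + ip (nth1 \<mu> a) (nth1 \<mu> a) + f)"
    unfolding psiw_simps append_Nil2 by (rule Sp_KZ)
  moreover have "eig a \<in> mono_deg (ip (nth1 \<mu> a) (nth1 \<mu> a))" using eig_mono_deg[OF Nil(3,4)] Nil(6) by simp
  ultimately show ?case by (rule bexI)
next
  case (Cons i js)
  have i: "1 \<le> i" "i < n" and js: "set js \<subseteq> {1..<n}" using Cons.prems by auto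
  obtain \<mu>' e' where m: "wtrace (psiw js) (nu0 \<kappa> lam) = Some (\<mu>', e')" using wtrace_psiw_Some by blast
  have v: "valid (psiw js)" using js by simp
  have \<mu>': "\<mu>' \<in> Ib" using wtrace_Ib[OF v nu0_Ibeta m] .
  have len: "length \<mu>' = n" using Ibeta_length[OF \<mu>'] .
  have \<mu>: "\<mu> = sw i \<mu>'" "e = e' - ip (nth1 \<mu>' i) (nth1 \<mu>' (Suc i))" using Cons.prems(6) m by auto
  have na: "nth1 \<mu>' (sref i a) = nth1 \<mu> a" unfolding \<mu>(1) using i len Cons.prems(3,4) by (simp add: nth1_sw)
  let ?D = "e + ip (nth1 \<mu> a) (nth1 \<mu> a) + f"
  obtain k where k: "M (u @ X a # Psi i # psiw js) \<simeq> M (u @ Psi i # X (sref i a) # psiw js) + csc (of_int k) (M (u @ psiw js))"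
    "k \<noteq> 0 \<Longrightarrow> nth1 \<mu>' i = nth1 \<mu>' (Suc i) \<and> (a = i \<or> a = Suc i)"
    using M_X_Psi[OF Cons.prems(1) v m i Cons.prems(3,4)] by blast
  \<comment> \<open>The error term has lost the letter \<psi>_i. Its degree is still right: it
    occurs only for equal residues at i and i + 1, where \<psi>_i fixes the residue sequence and has
    minus the degree of x_a.\<close>
  have low: "csc (of_int k) (M (u @ psiw js)) \<in> Sp \<nu> ?D"
  proof (cases "k = 0")
    case False
    then have eq: "nth1 \<mu>' i = nth1 \<mu>' (Suc i)" "a = i \<or> a = Suc i" using k(2) by auto
    have "sw i \<mu>' = \<mu>'" using eq(1) i len by (intro nth1_eqI) (auto simp: nth1_sw sref_def)
    then have mm: "\<mu> = \<mu>'" using \<mu> by simp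
    have "M (u @ psiw js) \<in> Sp \<nu> (e' + f)"
      using Cons.prems m v mm by (intro IH) (auto simp: wtrace_append)
    moreover have "e' + f = ?D" using \<mu>(2) eq mm by auto
    ultimately show ?thesis by (intro Sp_of_int) simp
  qed (simp add: Sp_0)
  have sa: "1 \<le> sref i a" "sref i a \<le> n" using i Cons.prems(3,4) by (auto simp: sref_def)
  have tu: "wtrace (u @ [Psi i]) \<mu>' = Some (\<nu>, - ip (nth1 \<mu>' i) (nth1 \<mu>' (Suc i)) + f)"
    using Cons.prems(7) \<mu>(1) by (simp add: wtrace_append)
  have vu: "valid (u @ [Psi i])" "npsi (u @ [Psi i]) + length js = l"
    using Cons.prems(1,5) i by (auto simp: valid_gen_def)
  have D: "e' + ip (nth1 \<mu> a) (nth1 \<mu> a) + (- ip (nth1 \<mu>' i) (nth1 \<mu>' (Suc i)) + f) = ?D"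
    using \<mu>(2) by simp
  obtain p where p: "p \<in> mono_deg (ip (nth1 \<mu> a) (nth1 \<mu> a))"
    "M ((u @ [Psi i]) @ X (sref i a) # psiw js) - csc p (M ((u @ [Psi i]) @ psiw js)) \<in> Sp \<nu> ?D"
    using Cons.IH[OF vu(1) js sa vu(2) m tu] unfolding na D by blast
  have "(M (u @ Psi i # X (sref i a) # psiw js) - csc p (M (u @ Psi i # psiw js))) + csc (of_int k) (M (u @ psiw js)) \<in> Sp \<nu> ?D"
    using p(2) low by (intro Sp_add) auto
  moreover have "M (u @ X a # Psi i # psiw js) - csc p (M (u @ Psi i # psiw js)) \<simeq>
     (M (u @ Psi i # X (sref i a) # psiw js) + csc (of_int k) (M (u @ psiw js))) - csc p (M (u @ Psi i # psiw js))"
    by (intro eqK_diff k(1)) simp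
  ultimately have "M (u @ X a # Psi i # psiw js) - csc p (M (u @ Psi i # psiw js)) \<in> Sp \<nu> ?D"
    using Sp_eqK by (simp add: algebra_simps)
  then have "M (u @ X a # psiw (i # js)) - csc p (M (u @ psiw (i # js))) \<in> Sp \<nu> ?D"
    unfolding psiw_simps .
  then show ?case using p(1) by (rule bexI)
qed

text \<open>Letters of u are consumed from its right end: an idempotent is absorbed, an x becomes a
  polynomial in z up to fewer \<psi>'s, and a \<psi> joins the pure \<psi>-word. The total number of
  \<psi>'s stays l.\<close>

lemma Sp_word_psiw:
  assumes "valid u" "set is \<subseteq> {1..<n}" "npsi u + length is = l"
    and "wtrace (psiw is) (nu0 \<kappa> lam) = Some (\<mu>, e)" "wtrace u \<mu> = Some (\<nu>, f)"
  shows "M (u @ psiw is) \<in> Sp \<nu> (e + f)"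
  using assms
proof (induction u arbitrary: "is" \<mu> e f rule: rev_induct)
  case Nil
  then show ?case using Sp_psiw by simp
next
  case (snoc g u)
  have v: "valid (psiw is)" using snoc.prems by simp
  have u: "valid u" using snoc.prems by simp
  show ?case
  proof (cases g)
    case (E \<mu>')
    then have mm: "\<mu>' = \<mu>" "wtrace u \<mu> = Some (\<nu>, f)" using snoc.prems(5)
      by (auto simp: wtrace_append split: if_splits option.splits)
    have "M (u @ psiw is) \<in> Sp \<nu> (e + f)" using snoc.IH[OF u] snoc.prems mm E by simp
    then show ?thesis using M_E_insert[OF u v snoc.prems(4)] Sp_eqK E mm by simp
  next
    case (X a)
    have a: "1 \<le> a" "a \<le> n" using snoc.prems(1) X by (auto simp: valid_gen_def)
    obtain f' where f: "wtrace u \<mu> = Some (\<nu>, f')" "f = ip (nth1 \<mu> a) (nth1 \<mu> a) + f'"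
      using snoc.prems(5) X by (auto simp: wtrace_append split: option.splits)
    have "npsi u + length is = l" using snoc.prems X by simp
    note P = u snoc.prems(2) this snoc.prems(4) f(1)
    have 1: "M (u @ psiw is) \<in> Sp \<nu> (e + f')" by (rule snoc.IH[OF P])
    obtain p where p: "p \<in> mono_deg (ip (nth1 \<mu> a) (nth1 \<mu> a))"
      "M (u @ X a # psiw is) - csc p (M (u @ psiw is)) \<in> Sp \<nu> (e + ip (nth1 \<mu> a) (nth1 \<mu> a) + f')"
      using Sp_move_X[OF P(1,2) a P(3-5)] by blast
    from Sp_csc[OF 1 p(1)] have "csc p (M (u @ psiw is)) \<in> Sp \<nu> (e + ip (nth1 \<mu> a) (nth1 \<mu> a) + f')"
      by (simp add: algebra_simps)
    from Sp_add[OF p(2) this] show ?thesis using X f(2) by (simp add: algebra_simps)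
  next
    case (Psi i)
    have i: "1 \<le> i" "i < n" using snoc.prems(1) Psi by (auto simp: valid_gen_def)
    obtain f' where f: "wtrace u (sw i \<mu>) = Some (\<nu>, f')" "f = - ip (nth1 \<mu> i) (nth1 \<mu> (Suc i)) + f'"
      using snoc.prems(5) Psi by (auto simp: wtrace_append split: option.splits)
    have "M (u @ psiw (i # is)) \<in> Sp \<nu> (e - ip (nth1 \<mu> i) (nth1 \<mu> (Suc i)) + f')"
      by (rule snoc.IH[OF u _ _ _ f(1)]) (use snoc.prems i Psi in auto)
    then have "M (u @ psiw (i # is)) \<in> Sp \<nu> (e + f)" unfolding f(2) by (simp add: algebra_simps)
    then show ?thesis using Psi by simp
  qed
qed

end

theorem M_in_Sp:
  assumes "valid u" "wtrace u (nu0 \<kappa> lam) = Some (\<nu>, d)" shows "M u \<in> Sp \<nu> d"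
  using assms
proof (induction "npsi u" arbitrary: u \<nu> d rule: less_induct)
  case less
  have "M (u @ psiw []) \<in> Sp \<nu> (0 + d)"
    by (rule Sp_word_psiw[of "npsi u"]) (use less in auto)
  then show ?case by simp
qed

end

section \<open>The seminormal representation\<close>

definition Qev :: "(int \<times> nat \<times> nat) list \<Rightarrow> 'q::comm_ring_1 \<Rightarrow> 'q \<Rightarrow> 'q" where
  "Qev p u v = sum_list (map (\<lambda>(c, a, b). of_int c * (u ^ a * v ^ b)) p)"

definition ddev :: "(int \<times> nat \<times> nat) list \<Rightarrow> 'q::comm_ring_1 \<Rightarrow> 'q \<Rightarrow> 'q \<Rightarrow> 'q" where
  "ddev p u v w = sum_list (map (\<lambda>(c, a, b). of_int c * (\<Sum>k<a. u ^ k * w ^ (a - 1 - k) * v ^ b)) p)"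

text \<open>Ties the expanded form of the divided difference to the quotient in the braid relation;
  term by term it is the geometric sum for u^a - w^a.\<close>

lemma ddev_mult: "(u - w) * ddev p u v w = Qev p u v - Qev p w v"
proof (induction p)
  case (Cons x p)
  obtain c a b where x: "x = (c, a, b)" by (metis prod_cases3)
  have "(u - w) * (\<Sum>k<a. u ^ k * w ^ (a - 1 - k) * v ^ b) = (u ^ a - w ^ a) * v ^ b"
    unfolding power_diff_sumr2[of u a w] by (simp add: sum_distrib_right sum_distrib_left mult_ac)
  then have "(u - w) * (of_int c * (\<Sum>k<a. u ^ k * w ^ (a - 1 - k) * v ^ b)) = of_int c * ((u ^ a - w ^ a) * v ^ b)"
    by (metis mult.left_commute)
  then show ?case using Cons by (simp add: x Qev_def ddev_def distrib_left) (simp add: algebra_simps)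
qed (simp add: ddev_def Qev_def)

lemma Qev_sym: "Qev (Qpoly j i) v u = Qev (Qpoly i j) u v"
proof -
  have "Qev (map (\<lambda>(c, a, b). (c, b, a)) p) v u = Qev p u v" for p and u v :: 'a
    by (induction p) (auto simp: Qev_def mult_ac)
  note m = this[of _ u v] this[of _ v u]
  show ?thesis by (cases i j rule: linorder_cases) (simp_all add: Qpoly_def m, simp add: Qev_def)
qed

lemma cz_simps: "cz z 0 = - (z ^ 2)" "cz z (int (Suc a)) = (- 1) ^ a * z" "cz z (- int (Suc a)) = - ((- 1) ^ a * z)"
  by (simp_all add: cz_def nat_add_distrib)

lemma int_sign_cases:
  obtains "k = 0" | a where "k = int (Suc a)" | a where "k = - int (Suc a)"
proof (cases k "0::int" rule: linorder_cases)
  case less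
  then have "k = - int (Suc (nat (- k - 1)))" by simp
  then show thesis by (rule that(3))
next
  case greater
  then have "k = int (Suc (nat (k - 1)))" by simp
  then show thesis by (rule that(2))
qed (rule that(1))

text \<open>The alternating signs make u + v vanish on each side of content 0, and at 0 the value
  -z^2 cancels the square of \<plusminus>z.\<close>

lemma Qev_consecutive:
  assumes "l = k + 1"
  shows "Qev (Qpoly (nat \<bar>k\<bar>) (nat \<bar>l\<bar>)) (cz z k) (cz z l) = 0"
proof (cases k rule: int_sign_cases)
  case 1
  then show ?thesis using assms cz_simps(2)[of z 0] by (simp add: Qev_def Qpoly_def Qlt_def cz_simps)
next
  case (2 a)
  then have l: "l = int (Suc (Suc a))" using assms by simp
  have "nat \<bar>k\<bar> = Suc a" "nat \<bar>l\<bar> = Suc (Suc a)" using 2 l by auto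
  then show ?thesis unfolding 2 l cz_simps by (simp add: Qev_def Qpoly_def Qlt_def)
next
  case (3 a)
  show ?thesis
  proof (cases a)
    case 0
    then have "k = - 1" "l = 0" using 3 assms by auto
    then show ?thesis using cz_simps(3)[of z 0] by (simp add: Qev_def Qpoly_def Qlt_def cz_simps)
  next
    case (Suc b)
    then have kl: "k = - int (Suc (Suc b))" "l = - int (Suc b)" using 3 assms by auto
    then have "nat \<bar>k\<bar> = Suc (Suc b)" "nat \<bar>l\<bar> = Suc b" by auto
    then show ?thesis unfolding kl cz_simps by (simp add: Qev_def Qpoly_def Qlt_def)
  qed
qed

text \<open>Opposite nonzero contents have opposite eigenvalues, so their difference is
  \<plusminus>2z.\<close>

lemma cz_distinct:
  fixes z :: "'q::field"
  assumes "2 * z \<noteq> 0" "\<bar>k\<bar> = \<bar>l\<bar>" "k \<noteq> l"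
  shows "cz z k \<noteq> cz z l"
proof -
  have l: "l = - k" "k \<noteq> 0" using assms by auto
  have "(- 1) ^ a * z \<noteq> - ((- 1) ^ a * z)" for a :: nat
  proof
    assume "(- 1) ^ a * z = - ((- 1) ^ a * z)"
    then have "(- 1) ^ a * z + (- 1) ^ a * z = 0" by (simp only: eq_neg_iff_add_eq_0)
    then have "(- 1) ^ a * (2 * z) = 0" by (simp only: mult_2 distrib_left)
    then show False using assms(1) by (metis mult_eq_0_iff power_eq_0_iff neg_equal_0_iff_equal zero_neq_one)
  qed
  note d = this this[symmetric]
  show ?thesis
  proof (cases k rule: int_sign_cases)
    case (2 a)
    then show ?thesis unfolding l(1) 2 cz_simps using d by blast
  next
    case (3 a)
    then have "l = int (Suc a)" using l by simp
    then show ?thesis using 3 cz_simps(2,3)[of z a] d by metis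
  qed (use l in simp)
qed

lemma Qpoly_far: "i + 2 \<le> j \<or> j + 2 \<le> i \<Longrightarrow> Qpoly i j = [(1, 0, 0)]"
  by (auto simp: Qpoly_def Qlt_def)

lemma Qpoly_near: "j = Suc i \<Longrightarrow> i \<noteq> 0 \<Longrightarrow> Qpoly i j = [(1, 1, 0), (1, 0, 1)]"
  by (auto simp: Qpoly_def Qlt_def)

text \<open>Adjacent residues with contents that are not adjacent occur only for nonzero contents of
  opposite sign, and then u + v is \<plusminus>2z. For residues further apart Q = 1.\<close>

lemma Qev_nonzero:
  fixes z :: "'q::field"
  assumes "2 * z \<noteq> 0" "\<bar>k\<bar> \<noteq> \<bar>l\<bar>" "\<bar>k - l\<bar> \<noteq> 1"
  shows "Qev (Qpoly (nat \<bar>k\<bar>) (nat \<bar>l\<bar>)) (cz z k) (cz z l) \<noteq> 0"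
proof -
  have adj: "Qev (Qpoly (nat \<bar>k\<bar>) (nat \<bar>l\<bar>)) (cz z k) (cz z l) \<noteq> 0"
    if kl: "\<bar>l\<bar> = \<bar>k\<bar> + 1" "\<bar>k - l\<bar> \<noteq> 1" for k l
  proof -
    have nz: "(- 1) ^ a * z + (- 1) ^ a * z \<noteq> 0" for a :: nat
    proof
      assume "(- 1) ^ a * z + (- 1) ^ a * z = 0"
      then have "(- 1) ^ a * (2 * z) = 0" by (simp only: mult_2 distrib_left)
      then show False using assms(1) by (metis mult_eq_0_iff power_eq_0_iff neg_equal_0_iff_equal zero_neq_one)
    qed
    have l0: "l \<noteq> 0" "k \<noteq> 0" using kl by auto
    then have Q: "Qpoly (nat \<bar>k\<bar>) (nat \<bar>l\<bar>) = [(1, 1, 0), (1, 0, 1)]"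
      by (intro Qpoly_near) (use kl in linarith)+
    have "cz z k + cz z l \<noteq> 0"
    proof (cases k rule: int_sign_cases)
      case (2 a)
      then have "l = - int (Suc (Suc a))" using kl by auto
      then show ?thesis using nz[of a] 2 cz_simps(2)[of z a] cz_simps(3)[of z "Suc a"] by simp
    next
      case (3 a)
      then have "l = int (Suc (Suc a))" using kl by auto
      then have "cz z k + cz z l = - ((- 1) ^ a * z + (- 1) ^ a * z)"
        using 3 cz_simps(3)[of z a] cz_simps(2)[of z "Suc a"] by simp
      then show ?thesis using nz[of a] by (metis neg_equal_0_iff_equal)
    qed (use l0 in simp)
    then show ?thesis unfolding Q by (simp add: Qev_def)
  qed
  consider "\<bar>l\<bar> = \<bar>k\<bar> + 1" | "\<bar>k\<bar> = \<bar>l\<bar> + 1" | "\<bar>l\<bar> \<ge> \<bar>k\<bar> + 2 \<or> \<bar>k\<bar> \<ge> \<bar>l\<bar> + 2" using assms(2) by linarith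
  then show ?thesis
  proof cases
    case 1
    then show ?thesis using adj assms(3) by blast
  next
    case 2
    have "\<bar>l - k\<bar> \<noteq> 1" using assms(3) by linarith
    then have "Qev (Qpoly (nat \<bar>l\<bar>) (nat \<bar>k\<bar>)) (cz z l) (cz z k) \<noteq> 0" by (rule adj[OF 2])
    moreover have "Qev (Qpoly (nat \<bar>l\<bar>) (nat \<bar>k\<bar>)) (cz z l) (cz z k)
      = Qev (Qpoly (nat \<bar>k\<bar>) (nat \<bar>l\<bar>)) (cz z k) (cz z l)" by (rule Qev_sym)
    ultimately show ?thesis by argo
  next
    case 3
    then have "nat \<bar>k\<bar> + 2 \<le> nat \<bar>l\<bar> \<or> nat \<bar>l\<bar> + 2 \<le> nat \<bar>k\<bar>" by linarith
    then have "Qpoly (nat \<bar>k\<bar>) (nat \<bar>l\<bar>) = [(1, 0, 0)]" by (rule Qpoly_far)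
    then show ?thesis by (simp add: Qev_def)
  qed
qed

text \<open>Splits Q into one factor for each direction of the swap, without square roots: 1 one way
  and Q the other. For adjacent contents both factors are 0, which is consistent as Q vanishes
  there, and this stops the action from leaving the standard tableaux.\<close>

definition sn_beta :: "'q::comm_ring_1 \<Rightarrow> int \<Rightarrow> int \<Rightarrow> 'q" where
  "sn_beta z k l = (if \<bar>k - l\<bar> = 1 then 0 else if k < l then 1 else Qev (Qpoly (nat \<bar>k\<bar>) (nat \<bar>l\<bar>)) (cz z k) (cz z l))"

lemma sn_beta_mult:
  assumes "\<bar>k\<bar> \<noteq> \<bar>l\<bar>"
  shows "sn_beta z l k * sn_beta z k l = Qev (Qpoly (nat \<bar>k\<bar>) (nat \<bar>l\<bar>)) (cz z k) (cz z l)"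
proof (cases "\<bar>k - l\<bar> = 1")
  case True
  then have "l = k + 1 \<or> k = l + 1" by linarith
  then have "Qev (Qpoly (nat \<bar>k\<bar>) (nat \<bar>l\<bar>)) (cz z k) (cz z l) = 0"
    using Qev_consecutive[of l k z] Qev_consecutive[of k l z]
      Qev_sym[of "nat \<bar>l\<bar>" "nat \<bar>k\<bar>" "cz z l" "cz z k"] by presburger
  then show ?thesis using True by (simp add: sn_beta_def)
next
  case False
  have "\<bar>l - k\<bar> \<noteq> 1" "k < l \<or> l < k" using False assms by linarith+
  then show ?thesis using False Qev_sym[of "nat \<bar>l\<bar>" "nat \<bar>k\<bar>"] by (auto simp: sn_beta_def)
qed

lemma sn_beta_nonzero:
  fixes z :: "'q::field"
  assumes "2 * z \<noteq> 0" "\<bar>k\<bar> \<noteq> \<bar>l\<bar>" "\<bar>k - l\<bar> \<noteq> 1" shows "sn_beta z k l \<noteq> 0"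
  using assms(3) Qev_nonzero[OF assms] by (simp add: sn_beta_def)

text \<open>\<open>\<psi>\<^sub>r\<close> acts at a tableau with contents \<open>k\<close>, \<open>l\<close> at \<open>r\<close>, \<open>r + 1\<close> by \<open>snA z k l + snB z k l s\<^sub>r\<close>.\<close>
definition snA :: "'q::field \<Rightarrow> int \<Rightarrow> int \<Rightarrow> 'q" where
  "snA z k l = (if \<bar>k\<bar> = \<bar>l\<bar> then 1 / (cz z l - cz z k) else 0)"

definition snB :: "'q::field \<Rightarrow> int \<Rightarrow> int \<Rightarrow> 'q" where
  "snB z k l = (if \<bar>k\<bar> = \<bar>l\<bar> then 1 / (cz z l - cz z k) else sn_beta z l k)"

lemma snB_nonzero:
  fixes z :: "'q::field"
  assumes "2 * z \<noteq> 0" "\<bar>k - l\<bar> \<ge> 2" shows "snB z k l \<noteq> 0"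
proof (cases "\<bar>k\<bar> = \<bar>l\<bar>")
  case True
  moreover have "k \<noteq> l" using assms by auto
  ultimately show ?thesis using cz_distinct[OF assms(1)] by (simp add: snB_def)
next
  case False
  have "\<bar>l - k\<bar> \<noteq> 1" using assms by linarith
  then show ?thesis using False sn_beta_nonzero[OF assms(1)] by (simp add: snB_def)
qed

lemma snA_antisym: "snA z k l + snA z l k = 0"
proof -
  have "1 / (cz z l - cz z k) = - (1 / (cz z k - cz z l))" by (metis minus_diff_eq minus_divide_right)
  then show ?thesis by (auto simp: snA_def)
qed

text \<open>For equal residues this dictates the value of \<open>snA\<close>: it is the commutation
  of x's with \<psi>_r, read on the diagonal.\<close>

lemma snA_cz:
  assumes "2 * z \<noteq> 0" "k \<noteq> l"
  shows "cz z k * snA z k l = cz z l * snA z k l - of_bool (\<bar>k\<bar> = \<bar>l\<bar>)"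
    "cz z l * snA z k l = cz z k * snA z k l + of_bool (\<bar>k\<bar> = \<bar>l\<bar>)"
proof -
  have "cz z l - cz z k \<noteq> 0" if "\<bar>k\<bar> = \<bar>l\<bar>" using cz_distinct[OF assms(1) that assms(2)] by simp
  then show "cz z k * snA z k l = cz z l * snA z k l - of_bool (\<bar>k\<bar> = \<bar>l\<bar>)"
    by (auto simp: snA_def field_simps)
  then show "cz z l * snA z k l = cz z k * snA z k l + of_bool (\<bar>k\<bar> = \<bar>l\<bar>)" by simp
qed

text \<open>For equal residues \<open>snB\<close> coincides with \<open>snA\<close>, and
  antisymmetry makes the two products cancel, as Q_ii = 0 demands. Otherwise \<open>snA\<close> is 0
  and the two directions multiply to Q.\<close>

lemma sn_square: "snA z k l * snA z k l + snB z k l * snB z l k = Qev (Qpoly (nat \<bar>k\<bar>) (nat \<bar>l\<bar>)) (cz z k) (cz z l)"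
proof (cases "\<bar>k\<bar> = \<bar>l\<bar>")
  case True
  have "snB z l k = - snA z k l" using snA_antisym[of z k l] True by (simp add: snA_def snB_def add_eq_0_iff)
  moreover have "snB z k l = snA z k l" using True by (simp add: snA_def snB_def)
  moreover have "Qpoly (nat \<bar>k\<bar>) (nat \<bar>l\<bar>) = []" using True by (simp add: Qpoly_def)
  ultimately show ?thesis by (simp add: Qev_def)
next
  case False
  then show ?thesis using sn_beta_mult[of k l z] by (simp add: snA_def snB_def)
qed

text \<open>The braid relation as an identity between the values of a function on the six
  rearrangements of the contents \<open>k\<close>, \<open>l\<close>, \<open>m\<close>.\<close>
lemma sn_braid:
  fixes z :: "'q::field"
  assumes z: "2 * z \<noteq> 0" and d: "k \<noteq> l" "l \<noteq> m" "k \<noteq> m"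
  shows "(snA z l m * (snA z k l * (snA z l m * klm + snB z l m * kml) + snB z k l * (snA z k m * lkm + snB z k m * lmk))
      + snB z l m * (snA z k m * (snA z m l * kml + snB z m l * klm) + snB z k m * (snA z k l * mkl + snB z k l * mlk)))
    - (snA z k l * (snA z l m * (snA z k l * klm + snB z k l * lkm) + snB z l m * (snA z k m * kml + snB z k m * mkl))
      + snB z k l * (snA z k m * (snA z l k * lkm + snB z l k * klm) + snB z k m * (snA z l m * lmk + snB z l m * mlk)))
    = (if \<bar>k\<bar> = \<bar>m\<bar> then ddev (Qpoly (nat \<bar>k\<bar>) (nat \<bar>l\<bar>)) (cz z k) (cz z l) (cz z m) else 0) * klm"
proof -
  \<comment> \<open>Distinct integers, so at most two of the three have the same absolute
    value.\<close>
  consider "\<bar>k\<bar> = \<bar>l\<bar>" "\<bar>m\<bar> \<noteq> \<bar>k\<bar>" "\<bar>m\<bar> \<noteq> \<bar>l\<bar>" | "\<bar>l\<bar> = \<bar>m\<bar>" "\<bar>k\<bar> \<noteq> \<bar>l\<bar>" "\<bar>k\<bar> \<noteq> \<bar>m\<bar>"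
    | "\<bar>k\<bar> = \<bar>m\<bar>" "\<bar>l\<bar> \<noteq> \<bar>k\<bar>" "\<bar>l\<bar> \<noteq> \<bar>m\<bar>" | "\<bar>k\<bar> \<noteq> \<bar>l\<bar>" "\<bar>l\<bar> \<noteq> \<bar>m\<bar>" "\<bar>k\<bar> \<noteq> \<bar>m\<bar>"
    using d by linarith
  then show ?thesis
  proof cases
    case 1
    have eqs: "snA z l m = 0" "snA z k m = 0" "snA z m l = 0" "snB z k m = sn_beta z m k" "snB z l m = sn_beta z m l"
      "snB z k l = snA z k l" "snA z l k = - snA z k l" "snB z l k = - snA z k l"
      using 1 snA_antisym[of z k l] by (auto simp: snA_def snB_def add_eq_0_iff)
    show ?thesis unfolding eqs using 1 by (simp add: algebra_simps)
  next
    case 2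
    have eqs: "snA z k l = 0" "snA z k m = 0" "snA z l k = 0" "snB z k m = sn_beta z m k" "snB z k l = sn_beta z l k"
      "snB z l m = snA z l m" "snA z m l = - snA z l m" "snB z m l = - snA z l m"
      using 2 snA_antisym[of z l m] by (auto simp: snA_def snB_def add_eq_0_iff)
    show ?thesis unfolding eqs using 2 by (simp add: algebra_simps)
  next
    case 3
    have eqs: "snA z k l = 0" "snA z l m = 0" "snA z l k = 0" "snA z m l = 0"
      using 3 by (auto simp: snA_def)
    have B: "snB z k m = snA z k m" using 3 by (simp add: snA_def snB_def)
    \<comment> \<open>Here the right hand side can be nonzero. The two sides return to klm with
      coefficient \<open>snA z k m\<close> times Q at (m, l) and at (k, l) respectively, and the
      difference of these is the divided difference.\<close>
    have Q: "snB z l m * snB z m l = Qev (Qpoly (nat \<bar>k\<bar>) (nat \<bar>l\<bar>)) (cz z m) (cz z l)"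
      "snB z k l * snB z l k = Qev (Qpoly (nat \<bar>k\<bar>) (nat \<bar>l\<bar>)) (cz z k) (cz z l)"
      using sn_square[of z m l] sn_square[of z k l] 3(1) by (simp_all add: eqs mult.commute)
    have ne: "cz z k \<noteq> cz z m" by (rule cz_distinct[OF z 3(1) d(3)])
    have "snA z k m * (snB z l m * snB z m l - snB z k l * snB z l k) = ddev (Qpoly (nat \<bar>k\<bar>) (nat \<bar>l\<bar>)) (cz z k) (cz z l) (cz z m)"
      using ddev_mult[of "cz z k" "cz z m" "Qpoly (nat \<bar>k\<bar>) (nat \<bar>l\<bar>)" "cz z l"] ne 3(1)
      unfolding Q by (simp add: snA_def field_simps)
    then have "ddev (Qpoly (nat \<bar>k\<bar>) (nat \<bar>l\<bar>)) (cz z k) (cz z l) (cz z m) * klm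
       = snA z k m * (snB z l m * snB z m l - snB z k l * snB z l k) * klm" by simp
    then show ?thesis using 3(1) by (simp add: eqs B algebra_simps)
  next
    case 4
    have eqs: "snA z k l = 0" "snA z l m = 0" "snA z k m = 0" using 4 by (auto simp: snA_def)
    show ?thesis unfolding eqs using 4 by (simp add: algebra_simps)
  qed
qed

lemma fin_valid_diff [simp]: "fin_valid n Ib f \<Longrightarrow> fin_valid n Ib g \<Longrightarrow> fin_valid n Ib (f - g)"
  by (rule fin_validI) (auto simp: fin_valid_fin_supp, metis fin_valid_def diff_0_right)

lemma fin_valid_add [simp]: "fin_valid n Ib f \<Longrightarrow> fin_valid n Ib g \<Longrightarrow> fin_valid n Ib (f + g)"
  by (rule fin_validI) (auto simp: fin_valid_fin_supp, metis fin_valid_def add_0_right)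

lemma fin_valid_sum [simp]: "(\<And>a. a \<in> A \<Longrightarrow> fin_valid n Ib (F a)) \<Longrightarrow> fin_valid n Ib (sum F A)"
  by (induction A rule: infinite_finite_induct) (auto simp: fin_valid_0[unfolded zero_fun_def])

lemma valid_replicate: "valid_gen n Ib g \<Longrightarrow> valid_word n Ib (replicate k g)"
  by (auto simp: valid_word_def)

lemma fin_valid_qeval:
  assumes "valid_gen n Ib (X r)" "valid_gen n Ib (X s)" "valid_word n Ib u" shows "fin_valid n Ib (qeval p r s u)"
proof (induction p)
  case Nil
  show ?case unfolding qeval_Nil by (rule fin_valid_0)
next
  case (Cons x p)
  obtain c a b where x: "x = (c, a, b)" by (metis prod_cases3)
  show ?case unfolding x qeval_Cons using Cons assms
    by (intro fin_valid_add fin_valid_csc fin_valid_wd) (simp_all add: valid_replicate)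
qed

lemma fin_valid_ddeval:
  assumes "valid_gen n Ib (X r)" "valid_gen n Ib (X s)" "valid_gen n Ib (X t)" "valid_word n Ib u"
  shows "fin_valid n Ib (ddeval p r s t u)"
proof (induction p)
  case Nil
  show ?case unfolding ddeval_Nil by (rule fin_valid_0)
next
  case (Cons x p)
  obtain c a b where x: "x = (c, a, b)" by (metis prod_cases3)
  show ?case unfolding x ddeval_Cons using Cons assms
    by (intro fin_valid_add fin_valid_csc fin_valid_sum fin_valid_wd) (simp_all add: valid_replicate)
qed

lemma ev_swap: "ev h (\<lambda>v. ev h (\<lambda>w. g v w) b) r = ev h (\<lambda>w. ev h (\<lambda>v. g v w) r) b"
  unfolding ev_def sum_distrib_left by (subst sum.swap) (simp add: mult_ac)

lemma is_hom_power: "is_hom h \<Longrightarrow> h (x ^ m) = h x ^ m"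
  by (induction m) (auto simp: is_hom_simps)

lemma is_hom_cz: "is_hom h \<Longrightarrow> h (cz z k) = cz (h z) k"
  by (simp add: cz_def is_hom_simps is_hom_power)

context specht
begin

lemma resseq_Ib: "t \<in> Std lam \<Longrightarrow> resseq \<kappa> lam t \<in> Ib"
  using wtrace_Ib[OF psiw_valid nu0_Ibeta wtrace_rword_Std[OF part]] red_rword[OF wperm_permutes[OF Std_fill]]
  by (metis rword_def)

lemma fin_valid_qh_rels: "r \<in> qh_rels n Ib \<Longrightarrow> fin_valid n Ib r"
  unfolding qh_rels_def csub_eq cadd_eq csum_eq zero_fun_eq
  by (elim UnE CollectE exE conjE singletonE; hypsubst;
    (intro fin_valid_diff fin_valid_add fin_valid_csc fin_valid_sum fin_valid_wd fin_valid_qeval)?;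
    (simp add: valid_gen_def Ibeta_sw)?)
    (auto intro!: fin_valid_ddeval fin_valid_0 simp: valid_gen_def)

end

text \<open>The field enters through an embedding of \<int>[z]; injectivity makes z transcendental
  and 2z nonzero.\<close>

locale seminormal = specht +
  fixes H :: "int poly \<Rightarrow> 'q::field"
  assumes hom: "is_hom H" and inj: "H p = 0 \<Longrightarrow> p = 0"
begin

definition z :: 'q where "z = H (monom 1 1)"

lemma z2: "2 * z \<noteq> 0"
proof
  assume "2 * z = 0"
  then have "H (of_int 2 * monom 1 1) = 0"
    unfolding is_hom_simps(4)[OF hom] is_hom_of_int[OF hom] z_def by simp
  then have "coeff (of_int 2 * monom 1 1 :: int poly) 1 = 0" using inj by fastforce
  then show False by (simp add: of_int_poly)
qed

abbreviation ct :: "(nat \<times> nat \<Rightarrow> nat) \<Rightarrow> nat \<Rightarrow> int" where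
  "ct t r \<equiv> cont \<kappa> (tinv lam t r)"

text \<open>\<phi> is a vector of coefficients, and the clauses give the coefficient of t in the
  image. The term with \<open>snB\<close> thus brings the coefficient at
  \<open>sref r \<circ> t\<close> to t, and the scalars depend on the contents of the target
  t.\<close>

definition act :: "gen \<Rightarrow> ((nat \<times> nat \<Rightarrow> nat) \<Rightarrow> 'q) \<Rightarrow> (nat \<times> nat \<Rightarrow> nat) \<Rightarrow> 'q" where
  "act g \<phi> t = (if is_fill lam t then (case g of
      E \<nu> \<Rightarrow> if resseq \<kappa> lam t = \<nu> then \<phi> t else 0
    | X r \<Rightarrow> cz z (ct t r) * \<phi> t
    | Psi r \<Rightarrow> snA z (ct t r) (ct t (Suc r)) * \<phi> t + snB z (ct t r) (ct t (Suc r)) * \<phi> (sref r \<circ> t)) else 0)"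

definition actw :: "gen list \<Rightarrow> ((nat \<times> nat \<Rightarrow> nat) \<Rightarrow> 'q) \<Rightarrow> (nat \<times> nat \<Rightarrow> nat) \<Rightarrow> 'q" where
  "actw u \<phi> = foldr act u \<phi>"

definition V :: "((nat \<times> nat \<Rightarrow> nat) \<Rightarrow> 'q) set" where
  "V = {\<phi>. \<forall>t. t \<notin> Std lam \<longrightarrow> \<phi> t = 0}"

lemma actw_simps [simp]: "actw [] \<phi> = \<phi>" "actw (g # u) \<phi> = act g (actw u \<phi>)" "actw (u @ v) \<phi> = actw u (actw v \<phi>)"
  by (simp_all add: actw_def)

lemma act_E: "is_fill lam t \<Longrightarrow> act (E \<nu>) \<phi> t = (if resseq \<kappa> lam t = \<nu> then \<phi> t else 0)"
  and act_X: "is_fill lam t \<Longrightarrow> act (X r) \<phi> t = cz z (ct t r) * \<phi> t"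
  by (simp_all add: act_def)

lemma act_Psi: "is_fill lam t \<Longrightarrow> ct t r = k \<Longrightarrow> ct t (Suc r) = l \<Longrightarrow> sref r \<circ> t = T \<Longrightarrow>
    act (Psi r) \<phi> t = snA z k l * \<phi> t + snB z k l * \<phi> T"
  by (simp only: act_def if_True gen.case)

lemma ct_sref:
  "is_fill lam t \<Longrightarrow> 1 \<le> i \<Longrightarrow> i < n \<Longrightarrow> 1 \<le> k \<Longrightarrow> k \<le> n \<Longrightarrow> ct (sref i \<circ> t) k = ct t (sref i k)"
  by (simp only: tinv_sref)

lemma actw_linear: "actw u (\<lambda>t. \<Sum>i\<in>I. a i * \<phi> i t) = (\<lambda>t. \<Sum>i\<in>I. a i * actw u (\<phi> i) t)"
proof (induction u)
  case (Cons g u)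
  have lin: "act g (\<lambda>t. \<Sum>i\<in>I. a i * \<phi> i t) t = (\<Sum>i\<in>I. a i * act g (\<phi> i) t)" for \<phi> t
    by (cases g) (auto simp: act_def sum_distrib_left sum_distrib_right algebra_simps sum.distrib)
  show ?case unfolding actw_simps Cons.IH by (rule ext) (rule lin)
qed simp

lemma actw_0: "actw u (\<lambda>t. 0) = (\<lambda>t. 0)"
  using actw_linear[where I = "{}" and u = u] by simp

lemma V_Std: "\<phi> \<in> V \<Longrightarrow> \<phi> t \<noteq> 0 \<Longrightarrow> t \<in> Std lam"
  by (auto simp: V_def)

lemma sref_twice: "sref r \<circ> (sref r \<circ> t) = t"
  by (simp add: o_assoc)

text \<open>By \<open>Std_sref\<close> a swap leads from a standard tableau to a non-standard one
  only if the two contents are adjacent, and there \<open>sn_beta\<close> is 0.\<close>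

lemma act_V:
  assumes g: "valid_gen n Ib g" and \<phi>: "\<phi> \<in> V" shows "act g \<phi> \<in> V"
  unfolding V_def mem_Collect_eq
proof (intro allI impI)
  fix t assume t: "t \<notin> Std lam"
  have t0: "\<phi> t = 0" using \<phi> t by (auto simp: V_def)
  show "act g \<phi> t = 0"
  proof (cases "is_fill lam t")
    case f: True
    show ?thesis
    proof (cases g)
      case (Psi r)
      have r: "1 \<le> r" "r < n" using g Psi by (auto simp: valid_gen_def)
      have "snB z (ct t r) (ct t (Suc r)) * \<phi> (sref r \<circ> t) = 0"
      proof (cases "sref r \<circ> t \<in> Std lam")
        case True
        have "ct (sref r \<circ> t) r = ct t (Suc r)" "ct (sref r \<circ> t) (Suc r) = ct t r"
          using ct_sref[OF f r, of r] ct_sref[OF f r, of "Suc r"] r by (simp_all add: sref_def)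
        then have "\<bar>ct t (Suc r) - ct t r\<bar> = 1"
          using Std_sref[OF True r, of \<kappa>] t unfolding sref_twice by auto
        then have "\<bar>ct t r\<bar> \<noteq> \<bar>ct t (Suc r)\<bar> \<and> sn_beta z (ct t (Suc r)) (ct t r) = 0"
          by (auto simp: sn_beta_def)
        then show ?thesis by (simp add: snB_def)
      next
        case False
        then have "\<phi> (sref r \<circ> t) = 0" using V_Std[OF \<phi>] by blast
        then show ?thesis by (simp only: mult_zero_right)
      qed
      then show ?thesis using act_Psi[OF f refl refl refl, of r \<phi>] t0 Psi by simp
    qed (use t0 in \<open>auto simp: act_def\<close>)
  qed (simp add: act_def)
qed

lemma actw_V: "valid u \<Longrightarrow> \<phi> \<in> V \<Longrightarrow> actw u \<phi> \<in> V"
  by (induction u) (auto simp: act_V)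

lemma actw_replicate_X: "is_fill lam t \<Longrightarrow> actw (replicate k (X r) @ u) \<phi> t = cz z (ct t r) ^ k * actw u \<phi> t"
  by (induction k) (simp_all add: act_X)

lemma nth1_resseq_ct: "1 \<le> r \<Longrightarrow> r \<le> n \<Longrightarrow> nth1 (resseq \<kappa> lam t) r = nat \<bar>ct t r\<bar>"
  by (simp add: nth1_resseq resn_cont)

section \<open>The quiver Hecke relations at a standard tableau\<close>

context
  fixes t \<phi>
  assumes t: "t \<in> Std lam" and \<phi>: "\<phi> \<in> V"
begin

abbreviation "evt f \<equiv> ev H (\<lambda>w. actw w \<phi> t) f"

lemma fill_t: "is_fill lam t"
  by (rule Std_fill[OF t])

lemmas ev_simps = ev_diff[OF hom] ev_add[OF hom] ev_csc[OF hom] ev_wd[OF hom] ev_sum[OF hom]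
  fin_supp_wd fin_supp_csc fin_supp_diff fin_supp_add fin_supp_sum fin_supp_qeval fin_supp_ddeval

lemma evt_qeval: "evt (qeval p r s u) = Qev p (cz z (ct t r)) (cz z (ct t s)) * actw u \<phi> t"
proof (induction p)
  case Nil
  show ?case unfolding qeval_Nil by (simp add: ev_def Qev_def)
next
  case (Cons x p)
  obtain c a b where x: "x = (c, a, b)" by (metis prod_cases3)
  have "evt (qeval (x # p) r s u) = of_int c * (cz z (ct t r) ^ a * (cz z (ct t s) ^ b * actw u \<phi> t)) + evt (qeval p r s u)"
    unfolding x qeval_Cons by (simp only: ev_simps actw_replicate_X[OF fill_t] is_hom_of_int[OF hom])
  then show ?case unfolding Cons by (simp add: x Qev_def algebra_simps)
qed

lemma evt_ddeval: "evt (ddeval p r s s' u) = ddev p (cz z (ct t r)) (cz z (ct t s)) (cz z (ct t s')) * actw u \<phi> t"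
proof (induction p)
  case Nil
  show ?case unfolding ddeval_Nil by (simp add: ev_def ddev_def)
next
  case (Cons x p)
  obtain c a b where x: "x = (c, a, b)" by (metis prod_cases3)
  have "evt (ddeval (x # p) r s s' u) = of_int c * (\<Sum>k<a. cz z (ct t r) ^ k * (cz z (ct t s') ^ (a - 1 - k) *
      (cz z (ct t s) ^ b * actw u \<phi> t))) + evt (ddeval p r s s' u)"
    unfolding x ddeval_Cons by (simp only: ev_simps actw_replicate_X[OF fill_t] is_hom_of_int[OF hom])
  then show ?case unfolding Cons by (simp add: x ddev_def sum_distrib_right sum_distrib_left distrib_right distrib_left mult_ac)
qed

lemma H_delta: "H (delta i j) = delta i j" "H (deltal \<nu> \<mu>) = deltal \<nu> \<mu>"
  by (auto simp: delta_def deltal_def is_hom_simps(1,2)[OF hom])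

lemma rel_EE: "evt (csub (wd [E \<nu>, E \<nu>']) (csc (deltal \<nu> \<nu>') (wd [E \<nu>]))) = 0"
  unfolding csub_eq by (simp only: ev_simps) (auto simp: H_delta act_E[OF fill_t] deltal_def is_hom_simps(1,2)[OF hom])

lemma rel_sumE: "evt (csub (csum Ib (\<lambda>\<nu>. wd [E \<nu>])) (wd [])) = 0"
  unfolding csub_eq csum_eq using resseq_Ib[OF t] by (simp only: ev_simps) (simp add: act_E[OF fill_t])

lemma rel_XE: "evt (csub (wd [X r, E \<nu>]) (wd [E \<nu>, X r])) = 0"
  unfolding csub_eq by (simp only: ev_simps) (simp add: act_E[OF fill_t] act_X[OF fill_t])

lemma rel_XX: "evt (csub (wd [X r, X s]) (wd [X s, X r])) = 0"
  unfolding csub_eq by (simp only: ev_simps) (simp add: act_X[OF fill_t])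

lemma sw_resseq_eq_iff: 
  assumes "1 \<le> r" "r < n" "\<nu> \<in> Ib" shows "sw r (resseq \<kappa> lam t) = \<nu> \<longleftrightarrow> resseq \<kappa> lam t = sw r \<nu>"
  using nth_sw_sw[of r "resseq \<kappa> lam t"] nth_sw_sw[of r \<nu>] Ibeta_length[OF assms(3)] assms by auto

text \<open>The term without swap keeps the residue sequence although \<psi>_r should permute it; it
  is present only for equal residues at r and r + 1, where the permuted sequence is the
  same.\<close>

lemma rel_PsiE:
  assumes r: "1 \<le> r" "r < n" and \<nu>: "\<nu> \<in> Ib"
  shows "evt (csub (wd [Psi r, E \<nu>]) (wd [E (sw r \<nu>), Psi r])) = 0"
proof -
  define T where "T = sref r \<circ> t"
  have fT: "is_fill lam T" unfolding T_def by (rule sref_fill[OF fill_t r])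
  have rT: "resseq \<kappa> lam T = sw r (resseq \<kappa> lam t)" unfolding T_def by (rule resseq_sref[OF fill_t r])
  note P = act_Psi[OF fill_t refl refl T_def[symmetric]]
  have same: "sw r (resseq \<kappa> lam t) = resseq \<kappa> lam t" if "\<bar>ct t r\<bar> = \<bar>ct t (Suc r)\<bar>"
    using r that by (intro nth1_eqI) (auto simp: nth1_sw sref_def nth1_resseq_ct)
  have "snA z (ct t r) (ct t (Suc r)) * act (E \<nu>) \<phi> t =
     (if resseq \<kappa> lam t = sw r \<nu> then snA z (ct t r) (ct t (Suc r)) * \<phi> t else 0)"
    using same sw_resseq_eq_iff[OF r \<nu>] by (cases "\<bar>ct t r\<bar> = \<bar>ct t (Suc r)\<bar>") (auto simp: act_E[OF fill_t] snA_def)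
  moreover have "act (E \<nu>) \<phi> T = (if resseq \<kappa> lam t = sw r \<nu> then \<phi> T else 0)"
    unfolding act_E[OF fT] rT sw_resseq_eq_iff[OF r \<nu>] ..
  ultimately have "act (Psi r) (act (E \<nu>) \<phi>) t = act (E (sw r \<nu>)) (act (Psi r) \<phi>) t"
    unfolding P act_E[OF fill_t] by simp
  then show ?thesis unfolding csub_eq by (simp only: ev_simps actw_simps) simp
qed

lemma rel_PsiX:
  assumes r: "1 \<le> r" "r < n" and s: "1 \<le> s" "s \<le> n" "s \<noteq> r" "s \<noteq> Suc r"
  shows "evt (csub (wd [Psi r, X s]) (wd [X s, Psi r])) = 0"
proof -
  define T where "T = sref r \<circ> t"
  have fT: "is_fill lam T" unfolding T_def by (rule sref_fill[OF fill_t r])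
  note P = act_Psi[OF fill_t refl refl T_def[symmetric]]
  have "ct T s = ct t s" using ct_sref[OF fill_t r s(1,2)] s by (simp add: T_def sref_def)
  then have "act (Psi r) (act (X s) \<phi>) t = act (X s) (act (Psi r) \<phi>) t"
    unfolding P act_X[OF fill_t] act_X[OF fT] by (simp add: algebra_simps)
  then show ?thesis unfolding csub_eq by (simp only: ev_simps actw_simps) simp
qed

lemma rel_PsiPsi:
  assumes r: "1 \<le> r" "r < n" and s: "1 \<le> s" "s < n" "Suc r < s \<or> Suc s < r"
  shows "evt (csub (wd [Psi r, Psi s]) (wd [Psi s, Psi r])) = 0"
proof -
  define T where "T = sref r \<circ> t"
  define S where "S = sref s \<circ> t"
  define R where "R = sref s \<circ> T"
  have c: "sref r \<circ> sref s = sref s \<circ> sref r" using s(3) sref_commute[of r s] sref_commute[of s r] by auto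
  have RS: "sref r \<circ> S = R" unfolding R_def S_def T_def o_assoc c ..
  have fT: "is_fill lam T" unfolding T_def by (rule sref_fill[OF fill_t r])
  have fS: "is_fill lam S" unfolding S_def by (rule sref_fill[OF fill_t s(1,2)])
  have cT: "ct T s = ct t s" "ct T (Suc s) = ct t (Suc s)" unfolding T_def
    using ct_sref[OF fill_t r, of s] ct_sref[OF fill_t r, of "Suc s"] s by (auto simp: sref_def)
  have cS: "ct S r = ct t r" "ct S (Suc r) = ct t (Suc r)" unfolding S_def
    using ct_sref[OF fill_t s(1,2), of r] ct_sref[OF fill_t s(1,2), of "Suc r"] s r by (auto simp: sref_def)
  note P = act_Psi[OF fill_t refl refl T_def[symmetric]] act_Psi[OF fill_t refl refl S_def[symmetric]]
    act_Psi[OF fT cT R_def[symmetric]] act_Psi[OF fS cS RS]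
  have "act (Psi r) (act (Psi s) \<phi>) t = act (Psi s) (act (Psi r) \<phi>) t"
    unfolding P by (simp add: algebra_simps)
  then show ?thesis unfolding csub_eq by (simp only: ev_simps actw_simps) simp
qed

lemma ct_neq: "1 \<le> r \<Longrightarrow> r < n \<Longrightarrow> ct t r \<noteq> ct t (Suc r)"
  using Std_cont_distinct[OF part t, of r "Suc r"] by simp

lemma delta_resseq: "1 \<le> r \<Longrightarrow> r < n \<Longrightarrow>
    delta (nth1 (resseq \<kappa> lam t) r) (nth1 (resseq \<kappa> lam t) (Suc r)) = of_bool (\<bar>ct t r\<bar> = \<bar>ct t (Suc r)\<bar>)"
  by (simp add: delta_def nth1_resseq_ct eq_nat_nat_iff of_bool_def)

lemma rel_XPsi:
  assumes r: "1 \<le> r" "r < n"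
  shows "evt (csub (wd [X r, Psi r, E \<nu>])
          (csub (wd [Psi r, X (Suc r), E \<nu>]) (csc (delta (nth1 \<nu> r) (nth1 \<nu> (Suc r))) (wd [E \<nu>])))) = 0"
    "evt (csub (wd [X (Suc r), Psi r, E \<nu>])
          (cadd (wd [Psi r, X r, E \<nu>]) (csc (delta (nth1 \<nu> r) (nth1 \<nu> (Suc r))) (wd [E \<nu>])))) = 0"
proof -
  define T where "T = sref r \<circ> t"
  have fT: "is_fill lam T" unfolding T_def by (rule sref_fill[OF fill_t r])
  note P = act_Psi[OF fill_t refl refl T_def[symmetric]]
  have cT: "ct T r = ct t (Suc r)" "ct T (Suc r) = ct t r" unfolding T_def
    using ct_sref[OF fill_t r, of r] ct_sref[OF fill_t r, of "Suc r"] r by (auto simp: sref_def)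
  let ?k = "ct t r" and ?l = "ct t (Suc r)"
  let ?\<psi> = "act (E \<nu>) \<phi>"
  have d: "delta (nth1 \<nu> r) (nth1 \<nu> (Suc r)) * ?\<psi> t = of_bool (\<bar>?k\<bar> = \<bar>?l\<bar>) * ?\<psi> t"
    using delta_resseq[OF r] by (auto simp: act_E[OF fill_t])
  note A = snA_cz[OF z2 ct_neq[OF r]]
  have "cz z ?k * (snA z ?k ?l * ?\<psi> t) = (cz z ?l * snA z ?k ?l - of_bool (\<bar>?k\<bar> = \<bar>?l\<bar>)) * ?\<psi> t"
    unfolding A(1)[symmetric] by simp
  then have 1: "act (X r) (act (Psi r) ?\<psi>) t - (act (Psi r) (act (X (Suc r)) ?\<psi>) t - of_bool (\<bar>?k\<bar> = \<bar>?l\<bar>) * ?\<psi> t) = 0"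
    unfolding P act_X[OF fill_t] act_X[OF fT] cT by (simp add: algebra_simps)
  have "cz z ?l * (snA z ?k ?l * ?\<psi> t) = (cz z ?k * snA z ?k ?l + of_bool (\<bar>?k\<bar> = \<bar>?l\<bar>)) * ?\<psi> t"
    unfolding A(2)[symmetric] by simp
  then have 2: "act (X (Suc r)) (act (Psi r) ?\<psi>) t - (act (Psi r) (act (X r) ?\<psi>) t + of_bool (\<bar>?k\<bar> = \<bar>?l\<bar>) * ?\<psi> t) = 0"
    unfolding P act_X[OF fill_t] act_X[OF fT] cT by (simp add: algebra_simps)
  show "evt (csub (wd [X r, Psi r, E \<nu>])
          (csub (wd [Psi r, X (Suc r), E \<nu>]) (csc (delta (nth1 \<nu> r) (nth1 \<nu> (Suc r))) (wd [E \<nu>])))) = 0"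
    unfolding csub_eq using 1 by (simp only: ev_simps actw_simps H_delta d)
  show "evt (csub (wd [X (Suc r), Psi r, E \<nu>])
          (cadd (wd [Psi r, X r, E \<nu>]) (csc (delta (nth1 \<nu> r) (nth1 \<nu> (Suc r))) (wd [E \<nu>])))) = 0"
    unfolding csub_eq cadd_eq using 2 by (simp only: ev_simps actw_simps H_delta d)
qed

lemma rel_square:
  assumes r: "1 \<le> r" "r < n"
  shows "evt (csub (wd [Psi r, Psi r, E \<nu>]) (qeval (Qpoly (nth1 \<nu> r) (nth1 \<nu> (Suc r))) r (Suc r) [E \<nu>])) = 0"
proof -
  define T where "T = sref r \<circ> t"
  have fT: "is_fill lam T" unfolding T_def by (rule sref_fill[OF fill_t r])
  have T2: "sref r \<circ> T = t" unfolding T_def by (rule sref_twice)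
  have cT: "ct T r = ct t (Suc r)" "ct T (Suc r) = ct t r" unfolding T_def
    using ct_sref[OF fill_t r, of r] ct_sref[OF fill_t r, of "Suc r"] r by (auto simp: sref_def)
  note P = act_Psi[OF fill_t refl refl T_def[symmetric]] act_Psi[OF fT cT T2]
  let ?k = "ct t r" and ?l = "ct t (Suc r)"
  let ?\<psi> = "act (E \<nu>) \<phi>"
  have q: "Qev (Qpoly (nth1 \<nu> r) (nth1 \<nu> (Suc r))) (cz z ?k) (cz z ?l) * ?\<psi> t
    = Qev (Qpoly (nat \<bar>?k\<bar>) (nat \<bar>?l\<bar>)) (cz z ?k) (cz z ?l) * ?\<psi> t"
    using r nth1_resseq_ct[of r t] nth1_resseq_ct[of "Suc r" t] by (auto simp: act_E[OF fill_t])
  have "act (Psi r) (act (Psi r) ?\<psi>) t = (snA z ?k ?l * snA z ?k ?l + snB z ?k ?l * snB z ?l ?k) * ?\<psi> t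
     + snB z ?k ?l * (snA z ?k ?l + snA z ?l ?k) * ?\<psi> T"
    unfolding P by (simp add: algebra_simps)
  also have "\<dots> = Qev (Qpoly (nat \<bar>?k\<bar>) (nat \<bar>?l\<bar>)) (cz z ?k) (cz z ?l) * ?\<psi> t"
    unfolding sn_square snA_antisym by simp
  finally show ?thesis unfolding csub_eq
    by (simp only: ev_simps actw_simps evt_qeval q) simp
qed

text \<open>The fillings reached from t by s_r and s_(r+1) carry the six rearrangements of the
  contents (k, l, m), so \<open>sn_braid\<close> applies to the values of the vector there. These
  fillings may be non-standard; it is at t that the contents are known to be distinct.\<close>

lemma rel_braid:
  assumes r: "1 \<le> r" "Suc (Suc r) \<le> n"
  shows "evt (csub (csub (wd [Psi (Suc r), Psi r, Psi (Suc r), E \<nu>]) (wd [Psi r, Psi (Suc r), Psi r, E \<nu>]))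
          (if nth1 \<nu> r = nth1 \<nu> (Suc (Suc r))
           then ddeval (Qpoly (nth1 \<nu> r) (nth1 \<nu> (Suc r))) r (Suc r) (Suc (Suc r)) [E \<nu>]
           else (\<lambda>_. 0))) = 0"
proof -
  let ?q = "Suc r"
  have r': "r < n" "1 \<le> ?q" "?q < n" using r by auto
  define k l m where "k = ct t r" and "l = ct t (Suc r)" and "m = ct t (Suc (Suc r))"
  define T1 T2 where "T1 = sref r \<circ> t" and "T2 = sref ?q \<circ> t"
  define T12 T21 where "T12 = sref r \<circ> T2" and "T21 = sref ?q \<circ> T1"
  define W where "W = sref r \<circ> T21"
  have W: "sref ?q \<circ> T12 = W"
    unfolding W_def T12_def T21_def T1_def T2_def o_assoc sref_braid ..
  have fl: "is_fill lam T1" "is_fill lam T2" unfolding T1_def T2_def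
    by (rule sref_fill[OF fill_t r(1) r'(1)], rule sref_fill[OF fill_t r'(2,3)])
  have fl2: "is_fill lam T12" "is_fill lam T21" unfolding T12_def T21_def
    by (rule sref_fill[OF fl(2) r(1) r'(1)], rule sref_fill[OF fl(1) r'(2,3)])
  have c1: "ct T1 r = l" "ct T1 ?q = k" "ct T1 (Suc ?q) = m" unfolding T1_def k_def l_def m_def
    using ct_sref[OF fill_t r(1) r'(1), of r] ct_sref[OF fill_t r(1) r'(1), of ?q] ct_sref[OF fill_t r(1) r'(1), of "Suc ?q"] r
    by (auto simp: sref_def)
  have c2: "ct T2 r = k" "ct T2 ?q = m" "ct T2 (Suc ?q) = l" unfolding T2_def k_def l_def m_def
    using ct_sref[OF fill_t r'(2,3), of r] ct_sref[OF fill_t r'(2,3), of ?q] ct_sref[OF fill_t r'(2,3), of "Suc ?q"] r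
    by (auto simp: sref_def)
  have c12: "ct T12 ?q = k" "ct T12 (Suc ?q) = l" unfolding T12_def
    using ct_sref[OF fl(2) r(1) r'(1), of ?q] ct_sref[OF fl(2) r(1) r'(1), of "Suc ?q"] r c2
    by (auto simp: sref_def)
  have c21: "ct T21 r = l" "ct T21 ?q = m" unfolding T21_def
    using ct_sref[OF fl(1) r'(2,3), of r] ct_sref[OF fl(1) r'(2,3), of ?q] r c1
    by (auto simp: sref_def)
  have inv: "sref r \<circ> T1 = t" "sref ?q \<circ> T2 = t" unfolding T1_def T2_def by (rule sref_twice)+
  note P = act_Psi[OF fill_t k_def[symmetric] l_def[symmetric] T1_def[symmetric]]
    act_Psi[OF fill_t l_def[symmetric] m_def[symmetric] T2_def[symmetric]]
    act_Psi[OF fl(1) c1(1,2) inv(1)] act_Psi[OF fl(1) c1(2,3) T21_def[symmetric]]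
    act_Psi[OF fl(2) c2(1,2) T12_def[symmetric]] act_Psi[OF fl(2) c2(2,3) inv(2)]
    act_Psi[OF fl2(1) c12 W] act_Psi[OF fl2(2) c21 W_def[symmetric]]
  have ne: "k \<noteq> l" "l \<noteq> m" "k \<noteq> m"
    using ct_neq[OF r(1) r'(1)] ct_neq[OF r'(2,3)] Std_cont_distinct[OF part t, of r "Suc (Suc r)" \<kappa>] r
    by (simp_all add: k_def l_def m_def)
  let ?\<psi> = "act (E \<nu>) \<phi>"
  have res: "nth1 \<nu> r = nat \<bar>k\<bar>" "nth1 \<nu> ?q = nat \<bar>l\<bar>" "nth1 \<nu> (Suc ?q) = nat \<bar>m\<bar>" if "?\<psi> t \<noteq> 0"
  proof -
    have "\<nu> = resseq \<kappa> lam t" using that by (auto simp: act_E[OF fill_t] split: if_splits)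
    then show "nth1 \<nu> r = nat \<bar>k\<bar>" "nth1 \<nu> ?q = nat \<bar>l\<bar>" "nth1 \<nu> (Suc ?q) = nat \<bar>m\<bar>"
      using nth1_resseq_ct[of r t] nth1_resseq_ct[of ?q t] nth1_resseq_ct[of "Suc ?q" t] r
      by (simp_all add: k_def l_def m_def)
  qed
  have "evt (if nth1 \<nu> r = nth1 \<nu> (Suc ?q) then ddeval (Qpoly (nth1 \<nu> r) (nth1 \<nu> ?q)) r ?q (Suc ?q) [E \<nu>] else (\<lambda>_. 0))
    = (if nth1 \<nu> r = nth1 \<nu> (Suc ?q) then ddev (Qpoly (nth1 \<nu> r) (nth1 \<nu> ?q)) (cz z k) (cz z l) (cz z m) else 0) * ?\<psi> t"
    using evt_ddeval[of _ r ?q "Suc ?q" "[E \<nu>]"] by (simp add: k_def l_def m_def) (simp add: ev_def)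
  also have "\<dots> = (if \<bar>k\<bar> = \<bar>m\<bar> then ddev (Qpoly (nat \<bar>k\<bar>) (nat \<bar>l\<bar>)) (cz z k) (cz z l) (cz z m) else 0) * ?\<psi> t"
    using res by (cases "?\<psi> t = 0") (auto simp: eq_nat_nat_iff)
  also have "\<dots> = act (Psi ?q) (act (Psi r) (act (Psi ?q) ?\<psi>)) t - act (Psi r) (act (Psi ?q) (act (Psi r) ?\<psi>)) t"
    unfolding P by (rule sn_braid[OF z2 ne, symmetric])
  finally have e: "evt (if nth1 \<nu> r = nth1 \<nu> (Suc ?q) then ddeval (Qpoly (nth1 \<nu> r) (nth1 \<nu> ?q)) r ?q (Suc ?q) [E \<nu>] else (\<lambda>_. 0))
    = act (Psi ?q) (act (Psi r) (act (Psi ?q) ?\<psi>)) t - act (Psi r) (act (Psi ?q) (act (Psi r) ?\<psi>)) t" .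
  have fs: "fin_supp (if nth1 \<nu> r = nth1 \<nu> (Suc ?q) then ddeval (Qpoly (nth1 \<nu> r) (nth1 \<nu> ?q)) r ?q (Suc ?q) [E \<nu>] else (\<lambda>_. 0 :: int poly))"
    by (simp add: zero_fun_eq[symmetric] fin_supp_def)
       (simp add: fin_supp_def[symmetric])
  show ?thesis unfolding csub_eq by (simp only: ev_simps fs e actw_simps) simp
qed

end

lemma rel_act_0:
  assumes r: "r \<in> qh_rels n Ib" and \<phi>: "\<phi> \<in> V"
  shows "ev H (\<lambda>w. actw w \<phi> t) r = 0"
proof (cases "t \<in> Std lam")
  case t: True
  show ?thesis
  proof -
    have "r \<in> qh_rels n Ib \<Longrightarrow> ?thesis"
      unfolding qh_rels_def
      by (elim UnE CollectE exE conjE singletonE; hypsubst)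
        (simp_all only: rel_EE[OF t \<phi>] rel_sumE[OF t \<phi>] rel_XE[OF t \<phi>] rel_PsiE[OF t \<phi>] rel_XX[OF t \<phi>] rel_PsiX[OF t \<phi>]
          rel_PsiPsi[OF t \<phi>] rel_XPsi[OF t \<phi>] rel_square[OF t \<phi>] rel_braid[OF t \<phi>] not_False_eq_True)
    then show ?thesis using r .
  qed
next
  case False
  have "actw w \<phi> t = 0" if "r w \<noteq> 0" for w
  proof -
    have "valid w" using fin_valid_qh_rels[OF r] that by (simp add: fin_valid_def)
    then show ?thesis using V_Std[OF actw_V[OF _ \<phi>]] False by blast
  qed
  then show ?thesis by (intro ev_zero[OF hom])
qed

end

lemma lideal_fin_supp:
  assumes "x \<in> lideal n Ib Rl G" "\<And>r. r \<in> Rl \<Longrightarrow> fin_supp r" "\<And>g. g \<in> G \<Longrightarrow> fin_supp g"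
  shows "fin_supp x"
  using assms(1)
  by (induction rule: lideal.induct) (simp_all only: cadd_eq fin_supp_add fin_supp_cmul assms(2,3) fin_valid_fin_supp)

context specht
begin

lemma fin_valid_specht_rest: "g \<in> specht_rest \<kappa> lam red \<Longrightarrow> fin_valid n Ib g"
proof -
  have "valid (psiw (red (wperm lam (garnir lam A))))" if A: "A \<in> garnir_nodes lam" for A
  proof -
    obtain a c where a: "A = (a, c)" by (cases A)
    then have "is_fill lam (garnir lam A)" using garnir_fill[OF part _ refl refl, of a c] A by simp
    then have "rword n (red (wperm lam (garnir lam A))) (wperm lam (garnir lam A))"
      by (intro red_rword wperm_permutes)
    then show ?thesis by (intro psiw_valid) (simp add: rword_def)
  qed
  moreover have "\<nu> \<in> Iblock \<kappa> lam \<Longrightarrow> \<nu> \<in> Ib" for \<nu> using Iblock_subset by blast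
  ultimately show "g \<in> specht_rest \<kappa> lam red \<Longrightarrow> fin_valid n Ib g"
    unfolding specht_rest_def csub_eq
    by (elim UnE CollectE exE conjE; hypsubst)
      (intro fin_valid_cmul fin_valid_wd fin_valid_diff fin_valid_csc fin_valid_eBl; simp add: valid_gen_def)+
qed

lemma fin_valid_dgens: "g \<in> dgens \<Longrightarrow> fin_valid n Ib g"
proof -
  have "fin_valid n Ib (cmul (wd [X r]) (eBl \<kappa> lam) - csc (eig r) (eBl \<kappa> lam))" if "1 \<le> r" "r \<le> n" for r
    using that by (intro fin_valid_cmul fin_valid_wd fin_valid_diff fin_valid_csc fin_valid_eBl) (simp add: valid_gen_def)
  then show "g \<in> dgens \<Longrightarrow> fin_valid n Ib g"
    unfolding dgens_def using fin_valid_specht_rest by blast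
qed

lemma fin_supp_KZ: "x \<in> KZ \<Longrightarrow> fin_supp x"
  unfolding KZ_def
  by (erule lideal_fin_supp) (use fin_valid_dgens fin_valid_fin_supp fin_supp_qh_rels in blast)+

lemma psiw_red_valid: "t \<in> Std lam \<Longrightarrow> valid (psiw (red (wperm lam t)))"
  using red_rword[OF wperm_permutes[OF Std_fill]] by (intro psiw_valid) (simp add: rword_def)

lemma wtrace_psiw_red:
  "t \<in> Std lam \<Longrightarrow> wtrace (psiw (red (wperm lam t))) (nu0 \<kappa> lam) = Some (resseq \<kappa> lam t, relative_degree t)"
  unfolding relative_degree_def
  by (intro wtrace_rword_Std part red_rword wperm_permutes Std_fill)

section \<open>Straightening coefficients over \<int>[z]\<close>

definition is_cf :: "gen list \<Rightarrow> ((nat \<times> nat \<Rightarrow> nat) \<Rightarrow> int poly) \<Rightarrow> bool" where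
  "is_cf u a \<longleftrightarrow> M u \<simeq> (\<Sum>t\<in>Std lam. csc (a t) (PM t)) \<and>
    (\<forall>t\<in>Std lam. \<forall>\<nu> d. wtrace u (nu0 \<kappa> lam) = Some (\<nu>, d) \<longrightarrow>
       a t \<in> mono_deg (d - relative_degree t) \<and> (a t \<noteq> 0 \<longrightarrow> resseq \<kappa> lam t = \<nu>))"

text \<open>Chosen for every word separately. Compatibility with the relations is not built in; it
  will follow from independence in the seminormal representation.\<close>

definition cf :: "gen list \<Rightarrow> (nat \<times> nat \<Rightarrow> nat) \<Rightarrow> int poly" where
  "cf u = (SOME a. is_cf u a)"

lemma is_cf_cf:
  assumes "valid u" shows "is_cf u (cf u)"
proof -
  have "\<exists>a. is_cf u a"
  proof (cases "wtrace u (nu0 \<kappa> lam)")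
    case None
    then have "M u \<simeq> (\<Sum>t\<in>Std lam. csc 0 (PM t))"
      using M_None[OF assms] by (simp add: eqK_0_iff)
    then show ?thesis using None by (intro exI[of _ "\<lambda>_. 0"]) (simp add: is_cf_def)
  next
    case (Some p)
    obtain \<nu> d where p: "p = (\<nu>, d)" by (cases p)
    then have "M u \<in> Sp \<nu> d" using M_in_Sp[OF assms] Some by simp
    then obtain a where a: "\<forall>t\<in>Std lam. a t \<in> mono_deg (d - relative_degree t) \<and> (a t \<noteq> 0 \<longrightarrow> resseq \<kappa> lam t = \<nu>)"
      "M u \<simeq> (\<Sum>t\<in>Std lam. csc (a t) (PM t))" unfolding Sp_def by blast
    then have "is_cf u a" unfolding is_cf_def using Some p by simp
    then show ?thesis by blast
  qed
  then show ?thesis unfolding cf_def by (rule someI_ex)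
qed

end

section \<open>Independence in the seminormal representation\<close>

context seminormal
begin

definition v0 :: "(nat \<times> nat \<Rightarrow> nat) \<Rightarrow> 'q" where
  "v0 t = (if t = tlam lam then 1 else 0)"

lemma v0_V: "v0 \<in> V"
  using tlam_Std by (auto simp: V_def v0_def)

lemma ev_left: "ev H (\<lambda>w. actw (x @ w) \<phi> t) f = actw x (\<lambda>s. ev H (\<lambda>w. actw w \<phi> s) f) t"
  unfolding ev_def actw_linear by simp

text \<open>So the cyclic vector corresponds to \<open>v0\<close>: the residue sequence of
  \<open>tlam lam\<close> occurs once among the idempotents of \<open>eBl\<close>.\<close>

lemma ev_eBl: "ev H (\<lambda>w. actw w v0 s) (eBl \<kappa> lam) = v0 s"
proof -
  have "ev H (\<lambda>w. actw w v0 s) (eBl \<kappa> lam) = (\<Sum>\<nu>\<in>Iblock \<kappa> lam. act (E \<nu>) v0 s)"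
    unfolding eBl_def csum_eq by (simp add: ev_sum[OF hom] ev_wd[OF hom])
  also have "\<dots> = v0 s"
  proof (cases "s = tlam lam")
    case True
    have "resseq \<kappa> lam (tlam lam) \<in> Iblock \<kappa> lam" using nu0_Iblock by (simp add: nu0_def)
    then show ?thesis using True by (simp add: act_E[OF tlam_fill])
  next
    case False
    then show ?thesis by (intro sum.neutral[THEN trans]) (auto simp: act_def v0_def)
  qed
  finally show ?thesis .
qed

lemma fin_supp_eBl: "fin_supp (eBl \<kappa> lam)"
  by (rule fin_valid_fin_supp[OF fin_valid_eBl])

lemma ev_cmul_eBl: "ev H (\<lambda>w. actw w v0 s) (cmul (wd u) (eBl \<kappa> lam)) = actw u v0 s"
  unfolding ev_cmul[OF hom fin_supp_wd fin_supp_eBl] ev_wd[OF hom] ev_left ev_eBl by simp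

lemma act_E_v0: "act (E \<nu>) v0 = (\<lambda>s. deltal \<nu> (nu0 \<kappa> lam) * v0 s)"
proof
  fix s show "act (E \<nu>) v0 s = deltal \<nu> (nu0 \<kappa> lam) * v0 s"
    by (cases "s = tlam lam") (auto simp: act_def v0_def deltal_def nu0_def tlam_fill)
qed

lemma act_X_v0: "act (X r) v0 s = H (eig r) * v0 s"
  by (auto simp: act_def v0_def eig_def is_hom_cz[OF hom] z_def tlam_fill)

text \<open>Neighbours in a row have adjacent contents. Their residues differ, so \<open>snA\<close>
  vanishes, and the swap has coefficient \<open>sn_beta\<close> = 0.\<close>

lemma act_internal_v0:
  assumes r: "1 \<le> r" "r < n" and i: "internal lam r" shows "act (Psi r) v0 s = 0"
proof (cases "is_fill lam s")
  case f: True
  obtain a b where ab: "(a, b) \<in> nodes lam" "(a, Suc b) \<in> nodes lam" "tlam lam (a, b) = r" "tlam lam (a, Suc b) = Suc r"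
    using internal_nodes[OF i] by blast
  have ct0: "ct (tlam lam) (Suc r) = ct (tlam lam) r + 1"
    using fill_tinv_eq[OF tlam_fill ab(1,3)] fill_tinv_eq[OF tlam_fill ab(2,4)] by (simp add: cont_def)
  have 1: "snA z (ct s r) (ct s (Suc r)) * v0 s = 0"
  proof (cases "s = tlam lam")
    case True
    have "\<bar>ct (tlam lam) r\<bar> \<noteq> \<bar>ct (tlam lam) (Suc r)\<bar>" unfolding ct0 by linarith
    then show ?thesis using True by (simp add: snA_def)
  qed (simp add: v0_def)
  have 2: "snB z (ct s r) (ct s (Suc r)) * v0 (sref r \<circ> s) = 0"
  proof (cases "sref r \<circ> s = tlam lam")
    case True
    have "ct (sref r \<circ> s) r = ct s (Suc r)" "ct (sref r \<circ> s) (Suc r) = ct s r"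
      using ct_sref[OF f r, of r] ct_sref[OF f r, of "Suc r"] r by (simp_all add: sref_def)
    then have "ct s r = ct s (Suc r) + 1" using ct0 True by simp
    then have "\<bar>ct s r\<bar> \<noteq> \<bar>ct s (Suc r)\<bar>" "sn_beta z (ct s (Suc r)) (ct s r) = 0"
      by (linarith, simp add: sn_beta_def)
    then show ?thesis by (simp add: snB_def)
  qed (simp add: v0_def)
  show ?thesis unfolding act_Psi[OF f refl refl refl] 1 2 by simp
qed (simp add: act_def)

text \<open>Each \<psi>_r permutes residue sequences, also in its term without swap, which needs
  equal residues. All tableaux that occur have the residues of the one reached by the swaps
  alone.\<close>

lemma actw_psiw_v0_support:
  assumes "set js \<subseteq> {1..<n}" "actw (psiw js) v0 s \<noteq> 0"
  shows "resseq \<kappa> lam s = resseq \<kappa> lam (wordperm js \<circ> tlam lam)"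
  using assms
proof (induction js arbitrary: s)
  case Nil
  then show ?case by (simp add: v0_def split: if_splits)
next
  case (Cons r js)
  have r: "1 \<le> r" "r < n" and js: "set js \<subseteq> {1..<n}" using Cons.prems by auto
  have f: "is_fill lam s" using Cons.prems(2) by (auto simp: act_def split: if_splits)
  let ?t = "wordperm js \<circ> tlam lam"
  have tf: "is_fill lam ?t" by (rule perm_fill[OF wordperm_permutes[OF js]])
  have e: "resseq \<kappa> lam (wordperm (r # js) \<circ> tlam lam) = sw r (resseq \<kappa> lam ?t)"
    unfolding wordperm_Cons comp_assoc by (rule resseq_sref[OF tf r])
  have "snA z (ct s r) (ct s (Suc r)) * actw (psiw js) v0 s + snB z (ct s r) (ct s (Suc r)) * actw (psiw js) v0 (sref r \<circ> s) \<noteq> 0"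
    using Cons.prems(2) act_Psi[OF f refl refl refl, of r] by (simp only: psiw_simps actw_simps not_False_eq_True) 
  then consider "snA z (ct s r) (ct s (Suc r)) \<noteq> 0" "actw (psiw js) v0 s \<noteq> 0" | "actw (psiw js) v0 (sref r \<circ> s) \<noteq> 0"
    by (metis add_0_left mult_eq_0_iff)
  then show ?case
  proof cases
    case 1
    have "\<bar>ct s r\<bar> = \<bar>ct s (Suc r)\<bar>" using 1(1) by (auto simp: snA_def split: if_splits)
    then have "sw r (resseq \<kappa> lam s) = resseq \<kappa> lam s"
      using r by (intro nth1_eqI) (auto simp: nth1_sw sref_def nth1_resseq_ct)
    then show ?thesis unfolding e using Cons.IH[OF js 1(2)] by metis
  next
    case 2
    have "sw r (resseq \<kappa> lam s) = resseq \<kappa> lam ?t"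
      using Cons.IH[OF js 2] resseq_sref[OF f r, of \<kappa>] by metis
    then show ?thesis unfolding e using nth_sw_sw[of r "resseq \<kappa> lam s"] r by simp
  qed
qed

text \<open>A node off the belt starts with an entry outside the range p to q, and no letter of the
  word moves such an entry.\<close>

lemma actw_psiw_v0_off_belt:
  assumes A: "(a, c) \<in> garnir_nodes lam" and js: "set js \<subseteq> {1..<n}" "set js \<subseteq> {tlam lam (a, c)..<tlam lam (Suc a, c)}"
    and "actw (psiw js) v0 s \<noteq> 0" "B \<in> nodes lam" "B \<notin> belt lam (a, c)"
  shows "s B = tlam lam B"
  using js assms(4)
proof (induction js arbitrary: s)
  case Nil
  then show ?case by (simp add: v0_def split: if_splits)
next
  case (Cons r js)
  have js: "set js \<subseteq> {1..<n}" "set js \<subseteq> {tlam lam (a, c)..<tlam lam (Suc a, c)}" using Cons.prems by auto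
  have f: "is_fill lam s" using Cons.prems(3) by (auto simp: act_def split: if_splits)
  have "snA z (ct s r) (ct s (Suc r)) * actw (psiw js) v0 s + snB z (ct s r) (ct s (Suc r)) * actw (psiw js) v0 (sref r \<circ> s) \<noteq> 0"
    using Cons.prems(3) act_Psi[OF f refl refl refl, of r] by (simp only: psiw_simps actw_simps not_False_eq_True)
  then consider "actw (psiw js) v0 s \<noteq> 0" | "actw (psiw js) v0 (sref r \<circ> s) \<noteq> 0"
    by (metis add_0_left mult_eq_0_iff)
  then show ?case
  proof cases
    case 1
    then show ?thesis by (rule Cons.IH[OF js])
  next
    case 2
    have "sref r (s B) = tlam lam B" using Cons.IH[OF js 2] by simp
    then have "s B = sref r (tlam lam B)" by (metis sref_sref)
    moreover have "\<not> (tlam lam (a, c) \<le> tlam lam B \<and> tlam lam B \<le> tlam lam (Suc a, c))"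
      using belt_iff[OF part A refl refl assms(5)] assms(6) by simp
    ultimately show ?thesis using Cons.prems(2) by (auto simp: sref_def)
  qed
qed

text \<open>A tableau with nonzero coefficient would be standard, have the residues of the Garnir
  tableau and agree with \<open>tlam lam\<close> off the belt, which
  \<open>no_Std_with_garnir_residues\<close> excludes.\<close>

lemma garnir_v0:
  assumes A: "A \<in> garnir_nodes lam"
  shows "actw (psiw (red (wperm lam (garnir lam A)))) v0 s = 0"
proof (rule ccontr)
  assume ne: "actw (psiw (red (wperm lam (garnir lam A)))) v0 s \<noteq> 0"
  obtain a c where a: "A = (a, c)" by (cases A)
  have A': "(a, c) \<in> garnir_nodes lam" using A a by simp
  let ?g = "garnir lam (a, c)"
  let ?w = "wperm lam ?g"
  have gf: "is_fill lam ?g" by (rule garnir_fill[OF part A' refl refl])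
  have rw: "rword n (red ?w) ?w" by (rule red_rword[OF wperm_permutes[OF gf]])
  have js: "set (red ?w) \<subseteq> {1..<n}" "wordperm (red ?w) = ?w" using rw by (auto simp: rword_def)
  have js2: "set (red ?w) \<subseteq> {tlam lam (a, c)..<tlam lam (Suc a, c)}"
    by (rule rword_support[OF rw garnir_invs_belt[OF part A' refl refl]])
  note ne' = ne[unfolded a]
  have "s \<in> Std lam" using V_Std[OF actw_V[OF psiw_valid[OF js(1)] v0_V] ne'] .
  moreover have "resseq \<kappa> lam s = resseq \<kappa> lam ?g"
    using actw_psiw_v0_support[OF js(1) ne'] unfolding js(2) wperm_comp_tlam[OF gf] .
  ultimately show False
    using no_Std_with_garnir_residues[OF part A' refl refl] actw_psiw_v0_off_belt[OF A' js(1) js2 ne'] by blast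
qed

lemma dgens_v0:
  assumes "g \<in> dgens" shows "ev H (\<lambda>w. actw w v0 s) g = 0"
proof -
  note ev_s = ev_diff[OF hom] ev_csc[OF hom] ev_wd[OF hom] ev_cmul_eBl ev_eBl fin_supp_wd fin_supp_csc fin_supp_cmul
    fin_supp_eBl actw_simps
  have 1: "ev H (\<lambda>w. actw w v0 s) (cmul (wd [X r]) (eBl \<kappa> lam) - csc (eig r) (eBl \<kappa> lam)) = 0" for r
    by (simp only: ev_s act_X_v0) simp
  have 2: "ev H (\<lambda>w. actw w v0 s) (csub (wd [E \<nu>]) (csc (deltal \<nu> (nu0 \<kappa> lam)) (eBl \<kappa> lam))) = 0" for \<nu>
    unfolding csub_eq by (simp only: ev_s act_E_v0) (simp add: deltal_def is_hom_simps(1,2)[OF hom])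
  have "g \<in> dgens \<Longrightarrow> ?thesis"
    unfolding dgens_def specht_rest_def
    by (elim UnE CollectE exE conjE; hypsubst)
      (simp_all only: 1 2 ev_cmul_eBl actw_simps garnir_v0 act_internal_v0)
  then show ?thesis using assms .
qed

text \<open>Hence the deformed Specht module maps to the seminormal representation. For a multiple
  of a relation, the factor on its right keeps the vector in V, where the relations hold.\<close>

lemma KZ_v0:
  assumes "x \<in> KZ" shows "ev H (\<lambda>w. actw w v0 s) x = 0"
  using assms unfolding KZ_def
proof (induction arbitrary: s rule: lideal.induct)
  case (rel r a b)
  have fs: "fin_supp a" "fin_supp b" "fin_supp r"
    using rel fin_valid_fin_supp fin_supp_qh_rels by blast+
  have K: "ev H (\<lambda>v. actw (u @ v @ w) v0 s) r = 0" if "b w \<noteq> 0" for u w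
  proof -
    have "valid w" using rel(3) that by (simp add: fin_valid_def)
    then have "actw w v0 \<in> V" using actw_V v0_V by blast
    then have "ev H (\<lambda>v. actw v (actw w v0) s') r = 0" for s' using rel_act_0[OF rel(1)] by blast
    then show ?thesis using ev_left[of u "actw w v0" s r] actw_0[of u] by simp
  qed
  have "ev H (\<lambda>w. ev H (\<lambda>v. actw (u @ v @ w) v0 s) r) b = 0" for u
    by (rule ev_zero[OF hom]) (rule K)
  then have "ev H (\<lambda>v. ev H (\<lambda>w. actw (u @ v @ w) v0 s) b) r = 0" for u
    by (subst ev_swap)
  then show ?case
    by (simp only: ev_cmul[OF hom] fs fin_supp_cmul) (rule ev_zero[OF hom], simp only:)
next
  case (gen g a)
  have fs: "fin_supp a" "fin_supp g"
    using gen fin_valid_fin_supp fin_valid_dgens by blast+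
  have "ev H (\<lambda>v. actw (u @ v) v0 s) g = 0" for u
    unfolding ev_left dgens_v0[OF gen(1)] actw_0 ..
  then show ?case by (simp only: ev_cmul[OF hom fs]) (rule ev_zero[OF hom], simp only:)
next
  case (add x y)
  have "fin_supp x" "fin_supp y" using add(1,2) fin_supp_KZ unfolding KZ_def by blast+
  then show ?case unfolding cadd_eq by (simp only: ev_add[OF hom] add.IH) simp
qed

definition vt :: "(nat \<times> nat \<Rightarrow> nat) \<Rightarrow> (nat \<times> nat \<Rightarrow> nat) \<Rightarrow> 'q" where
  "vt t = actw (psiw (red (wperm lam t))) v0"

abbreviation "len t \<equiv> ilen n (wperm lam t)"

text \<open>Triangularity is with respect to length. The leading coefficient is a product of values
  of \<open>snB\<close>, nonzero since \<open>Std_rword_Cons\<close> puts the contents at distance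
  at least 2 for every letter.\<close>

lemma triangular:
  assumes "t \<in> Std lam" "rword n js (wperm lam t)"
  shows "actw (psiw js) v0 t \<noteq> 0 \<and> (\<forall>s. actw (psiw js) v0 s \<noteq> 0 \<longrightarrow> s = t \<or> len s < len t)"
  using assms
proof (induction js arbitrary: t)
  case Nil
  then have "wperm lam t = id" by (auto simp: rword_def)
  then have "t = tlam lam" using wperm_comp_tlam[OF Std_fill[OF Nil(1)]] by simp
  then show ?case by (simp add: v0_def)
next
  case (Cons i js)
  define t' where "t' = sref i \<circ> t"
  note R = Std_rword_Cons[OF part Cons.prems, folded t'_def]
  note f = Std_fill[OF Cons.prems(1)]
  let ?\<phi> = "actw (psiw js) v0"
  have IH: "?\<phi> t' \<noteq> 0" "\<And>s. ?\<phi> s \<noteq> 0 \<Longrightarrow> s = t' \<or> len s < len t'" using Cons.IH[OF R(1,2)] by auto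
  have len: "len t = Suc (len t')" using R(2) Cons.prems(2) by (simp add: rword_def)
  then have tt': "t \<noteq> t'" by auto
  \<comment> \<open>t is longer than everything in the support of \<open>?\<phi>\<close>, so only
    the swap from t' contributes to its coefficient.\<close>
  have "?\<phi> t = 0" using IH(2)[of t] len tt' by auto
  then have 1: "actw (psiw (i # js)) v0 t \<noteq> 0"
    using act_Psi[OF f refl refl t'_def[symmetric], of ?\<phi>] IH(1) snB_nonzero[OF z2 R(8)] by simp
  have 2: "s = t \<or> len s < len t" if s: "actw (psiw (i # js)) v0 s \<noteq> 0" for s
  proof -
    have fs: "is_fill lam s" using s by (auto simp: act_def split: if_splits)
    have "snA z (ct s i) (ct s (Suc i)) * ?\<phi> s + snB z (ct s i) (ct s (Suc i)) * ?\<phi> (sref i \<circ> s) \<noteq> 0"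
      using s act_Psi[OF fs refl refl refl, of i] by (simp only: psiw_simps actw_simps not_False_eq_True)
    then consider "?\<phi> s \<noteq> 0" | "?\<phi> (sref i \<circ> s) \<noteq> 0" by (metis add_0_left mult_eq_0_iff)
    then show ?thesis
    proof cases
      case 1
      then show ?thesis using IH(2)[OF 1] len by auto
    next
      case 2
      show ?thesis
      proof (cases "sref i \<circ> s = t'")
        case True
        then have "sref i \<circ> (sref i \<circ> s) = sref i \<circ> t'" by (simp only:)
        then show ?thesis unfolding sref_twice t'_def by blast
      next
        case False
        then have l: "len (sref i \<circ> s) < len t'" using IH(2)[OF 2] by blast
        let ?s = "sref i \<circ> s"
        have fs': "is_fill lam ?s" by (rule sref_fill[OF fs R(4,5)])
        have "len s = ilen n (sref i \<circ> wperm lam ?s)"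
          using wperm_sref[OF fs' R(4,5)] unfolding sref_twice by simp
        also have "\<dots> \<le> Suc (len ?s)" by (rule ilen_sref_comp_le[OF wperm_permutes[OF fs'] R(4,5)])
        finally show ?thesis using l len by linarith
      qed
    qed
  qed
  show ?case using 1 2 by blast
qed

lemma vt_triangular:
  assumes "t \<in> Std lam"
  shows "vt t t \<noteq> 0" "vt t s \<noteq> 0 \<Longrightarrow> s = t \<or> len s < len t"
  using triangular[OF assms red_rword[OF wperm_permutes[OF Std_fill[OF assms]]]] unfolding vt_def by blast+

text \<open>Among the tableaux with nonzero coefficient take one of maximal length: no other vector
  of the combination has a component there.\<close>

lemma vt_independent:
  assumes z: "\<And>s. (\<Sum>t\<in>Std lam. a t * vt t s) = 0" and t: "t \<in> Std lam"
  shows "a t = 0"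
proof (rule ccontr)
  assume "a t \<noteq> 0"
  let ?S = "{t \<in> Std lam. a t \<noteq> 0}"
  have "finite (len ` ?S)" "len ` ?S \<noteq> {}" using t \<open>a t \<noteq> 0\<close> by auto
  then have "Max (len ` ?S) \<in> len ` ?S" by (rule Max_in)
  then obtain u where u: "u \<in> ?S" "len u = Max (len ` ?S)" by auto
  have max: "len s \<le> len u" if "s \<in> ?S" for s
    unfolding u(2) using that by (intro Max_ge) auto
  have "a s * vt s u = 0" if s: "s \<in> Std lam - {u}" for s
  proof (rule ccontr)
    assume "a s * vt s u \<noteq> 0"
    then have "s \<in> ?S" "vt s u \<noteq> 0" using s by auto
    then show False using vt_triangular(2)[of s u] max[of s] s by auto
  qed
  then have "(\<Sum>t\<in>Std lam - {u}. a t * vt t u) = 0" by (rule sum.neutral[rule_format])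
  then have "(\<Sum>t\<in>Std lam. a t * vt t u) = a u * vt u u"
    using u by (subst sum.remove[of _ u]) auto
  then show False using z[of u] u vt_triangular(1)[of u] by auto
qed

section \<open>The straightening coefficients respect the relations\<close>

lemma actw_cf:
  assumes "valid u" shows "actw u v0 s = (\<Sum>t\<in>Std lam. H (cf u t) * vt t s)"
proof -
  have "M u - (\<Sum>t\<in>Std lam. csc (cf u t) (PM t)) \<in> KZ"
    using is_cf_cf[OF assms] unfolding is_cf_def eqK_def by blast
  from KZ_v0[OF this] have "ev H (\<lambda>w. actw w v0 s) (M u - (\<Sum>t\<in>Std lam. csc (cf u t) (PM t))) = 0" .
  moreover have "fin_supp (M v)" for v unfolding M_def by (intro fin_supp_cmul fin_supp_wd fin_supp_eBl)
  ultimately show ?thesis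
    by (simp add: ev_diff[OF hom] ev_sum[OF hom] ev_csc[OF hom] PM_def)
       (simp add: M_def ev_cmul_eBl vt_def)
qed

lemma ev_cf_expand:
  assumes "fin_valid n Ib f" "valid x" "valid y"
  shows "ev H (\<lambda>u. actw (x @ u @ y) v0 s) f = (\<Sum>t\<in>Std lam. H (ev id (\<lambda>u. cf (x @ u @ y) t) f) * vt t s)"
proof -
  have "ev H (\<lambda>u. actw (x @ u @ y) v0 s) f = ev H (\<lambda>u. \<Sum>t\<in>Std lam. H (cf (x @ u @ y) t) * vt t s) f"
    using assms by (intro ev_cong[OF hom] actw_cf) (simp add: fin_valid_def)
  also have "\<dots> = (\<Sum>t\<in>Std lam. ev H (\<lambda>u. H (cf (x @ u @ y) t)) f * vt t s)"
    by (rule ev_eval_sum[OF hom])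
  also have "\<dots> = (\<Sum>t\<in>Std lam. H (ev id (\<lambda>u. cf (x @ u @ y) t) f) * vt t s)"
    by (simp add: ev_def is_hom_simps[OF hom])
  finally show ?thesis .
qed

text \<open>If a combination of words acts by zero between x and y, its total coefficients vanish,
  first in the field by independence and then in \<int>[z] because H is injective.\<close>

lemma ev_cf_zero:
  assumes "fin_valid n Ib f" "valid x" "valid y" "\<And>s. ev H (\<lambda>u. actw (x @ u @ y) v0 s) f = 0" "t \<in> Std lam"
  shows "ev id (\<lambda>u. cf (x @ u @ y) t) f = 0"
  using vt_independent[of "\<lambda>t. H (ev id (\<lambda>u. cf (x @ u @ y) t) f)" t] assms(4,5) inj
  unfolding ev_cf_expand[OF assms(1-3)] by blast

text \<open>An identity in \<int>[z] without denominators, with arbitrary words on both sides of the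
  relation; it survives every specialisation.\<close>

lemma ev_cf_rel:
  assumes "r \<in> qh_rels n Ib" "valid x" "valid y" "t \<in> Std lam"
  shows "ev id (\<lambda>u. cf (x @ u @ y) t) r = 0"
proof (rule ev_cf_zero[OF fin_valid_qh_rels[OF assms(1)] assms(2,3) _ assms(4)])
  fix s
  have "ev H (\<lambda>v. actw v (actw y v0) s') r = 0" for s'
    by (rule rel_act_0[OF assms(1) actw_V[OF assms(3) v0_V]])
  then show "ev H (\<lambda>u. actw (x @ u @ y) v0 s) r = 0"
    using ev_left[of x "actw y v0" s r] actw_0[of x] by simp
qed

lemma ev_cf_gen:
  assumes "g \<in> dgens" "valid x" "t \<in> Std lam"
  shows "ev id (\<lambda>u. cf (x @ u) t) g = 0"
proof -
  have "ev H (\<lambda>u. actw (x @ u @ []) v0 s) g = 0" for s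
    using ev_left[of x v0 s g] dgens_v0[OF assms(1)] actw_0[of x] by simp
  from ev_cf_zero[OF fin_valid_dgens[OF assms(1)] assms(2) _ this assms(3)] show ?thesis by simp
qed

text \<open>\<open>cf\<close> was an arbitrary choice, yet it is dual to the vectors of standard
  tableaux: by independence such a vector has only its trivial expansion.\<close>

lemma ev_cf_PM:
  assumes "s \<in> Std lam" "t \<in> Std lam" shows "ev id (\<lambda>u. cf u t) (PM s) = of_bool (t = s)"
proof -
  have fv: "fin_valid n Ib (PM s)" unfolding PM_def by (rule fin_valid_M[OF psiw_red_valid[OF assms(1)]])
  have 1: "vt s s' = (\<Sum>t\<in>Std lam. H (ev id (\<lambda>u. cf u t) (PM s)) * vt t s')" for s'
    using ev_cf_expand[OF fv, of "[]" "[]" s'] by (simp add: PM_def M_def ev_cmul_eBl vt_def)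
  have 2: "vt s s' = (\<Sum>t\<in>Std lam. of_bool (t = s) * vt t s')" for s'
    using assms(1) by (simp add: of_bool_def if_distrib[of "\<lambda>x. x * _"] cong: if_cong)
  have "(\<Sum>t\<in>Std lam. (H (ev id (\<lambda>u. cf u t) (PM s)) - of_bool (t = s)) * vt t s') = 0" for s'
    unfolding left_diff_distrib sum_subtractf using 1[of s', symmetric] 2[of s', symmetric]
    by (simp only: diff_self)
  from vt_independent[OF this assms(2)] have "H (ev id (\<lambda>u. cf u t) (PM s) - of_bool (t = s)) = 0"
    by (simp add: is_hom_simps[OF hom] of_bool_def)
  then have "ev id (\<lambda>u. cf u t) (PM s) - of_bool (t = s) = 0" by (rule inj)
  then show ?thesis by simp
qed

end

section \<open>Specialisation at \<open>z = 0\<close> and the basis theorem\<close>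

text \<open>z = 0 followed by the map from \<int> to any commutative ring; this is how every
  characteristic is reached from \<int>[z].\<close>

definition spec0 :: "int poly \<Rightarrow> 'a::comm_ring_1" where
  "spec0 p = of_int (coeff p 0)"

lemma is_hom_spec0: "is_hom spec0"
  by (simp add: is_hom_def spec0_def coeff_mult_0)

text \<open>Only constants survive at z = 0, and they have degree 0. This turns homogeneity over
  \<int>[z] into equality of degrees.\<close>

lemma spec0_mono_deg:
  assumes "p \<in> mono_deg d" "spec0 p \<noteq> (0::'a::comm_ring_1)" shows "d = 0" "p \<noteq> 0"
proof -
  have "coeff p 0 \<noteq> 0" using assms(2) by (auto simp: spec0_def)
  then show "d = 0" "p \<noteq> 0" using assms(1) by (auto simp: mono_deg_def)
qed

lemma is_hom_to_fract: "is_hom to_fract"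
  by (simp add: is_hom_def)

text \<open>Gaussian elimination, one equation removing one unknown b0 with nonzero coefficient. It
  bounds the number of independent elements of a graded piece.\<close>

lemma homogeneous_system_nontrivial:
  fixes m :: "'b \<Rightarrow> 't \<Rightarrow> 'f::field"
  assumes "finite T" "finite B" "card T < card B"
  shows "\<exists>c. (\<exists>b\<in>B. c b \<noteq> 0) \<and> (\<forall>t\<in>T. (\<Sum>b\<in>B. c b * m b t) = 0)"
  using assms
proof (induction T arbitrary: B m rule: finite_induct)
  case empty
  then have "B \<noteq> {}" by auto
  then show ?case by (intro exI[of _ "\<lambda>_. 1"]) auto
next
  case (insert t T)
  show ?case
  proof (cases "\<forall>b\<in>B. m b t = 0")
    case True
    obtain c where c: "\<exists>b\<in>B. c b \<noteq> 0" "\<forall>t\<in>T. (\<Sum>b\<in>B. c b * m b t) = 0"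
      using insert.IH[of B m] insert.prems insert.hyps by auto
    then show ?thesis using True by (intro exI[of _ c]) auto
  next
    case False
    then obtain b0 where b0: "b0 \<in> B" "m b0 t \<noteq> 0" by blast
    let ?B = "B - {b0}"
    have "card T < card ?B" using insert.prems insert.hyps b0 by simp
    then obtain c where c: "\<exists>b\<in>?B. c b \<noteq> 0"
      "\<forall>s\<in>T. (\<Sum>b\<in>?B. c b * (m b s - m b t / m b0 t * m b0 s)) = 0"
      using insert.IH[of ?B "\<lambda>b s. m b s - m b t / m b0 t * m b0 s"] insert.prems by auto
    \<comment> \<open>The value at b0 is chosen so that the equation for t holds.\<close>
    define d where "d b = (if b = b0 then - (\<Sum>b\<in>?B. c b * (m b t / m b0 t)) else c b)" for b
    have d: "(\<Sum>b\<in>B. d b * m b s) = (\<Sum>b\<in>?B. c b * (m b s - m b t / m b0 t * m b0 s))" for s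
    proof -
      have "(\<Sum>b\<in>B. d b * m b s) = d b0 * m b0 s + (\<Sum>b\<in>?B. d b * m b s)"
        using b0 insert.prems by (simp add: sum.remove)
      also have "(\<Sum>b\<in>?B. d b * m b s) = (\<Sum>b\<in>?B. c b * m b s)"
        by (rule sum.cong) (auto simp: d_def)
      finally show ?thesis
        by (simp add: d_def sum_distrib_right right_diff_distrib sum_subtractf mult.assoc)
    qed
    have "(\<Sum>b\<in>B. d b * m b s) = 0" if "s \<in> insert t T" for s
    proof (cases "s = t")
      case True
      show ?thesis unfolding d True using b0 by simp
    next
      case False
      then show ?thesis unfolding d using c that by simp
    qed
    moreover have "\<exists>b\<in>B. d b \<noteq> 0" using c(1) by (auto simp: d_def)
    ultimately show ?thesis by blast
  qed
qed

context specht
begin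

section \<open>The Specht module as the fibre at z = 0\<close>

lemma spec0_eig: "spec0 (eig r) = 0"
proof -
  have "spec0 (monom 1 1 :: int poly) = (0::'a)" by (simp add: spec0_def)
  then show ?thesis unfolding eig_def is_hom_cz[OF is_hom_spec0] by (simp add: cz_def)
qed

lemma spechtgens_spec0: "spechtgens \<kappa> lam red = cmap spec0 ` dgens"
proof -
  have r: "cmap spec0 ` specht_rest \<kappa> lam red = specht_rest \<kappa> lam red"
    unfolding specht_rest_def image_Un cmap_image_compr csub_eq cmap_simps[OF is_hom_spec0]
      deltal_def if_distrib[of spec0] is_hom_simps(1,2)[OF is_hom_spec0] ..
  have e: "spechtgens \<kappa> lam red = {cmul (wd [X r]) (eBl \<kappa> lam) | r. 1 \<le> r \<and> r \<le> n} \<union> specht_rest \<kappa> lam red"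
    unfolding spechtgens_def specht_rest_def by (simp only: Un_assoc)
  show ?thesis
    unfolding e dgens_def image_Un cmap_image_compr cmap_simps[OF is_hom_spec0] spec0_eig r csc_simps diff_zero ..
qed

lemma KZ_SK: "x \<in> KZ \<Longrightarrow> cmap spec0 x \<in> SK \<kappa> lam red"
  unfolding KZ_def SK_def
  by (rule lideal_base_change[OF is_hom_spec0 qh_rels_nonempty])
     (simp_all only: spechtgens_spec0 imageI, metis imageI qh_rels_base_change[OF is_hom_spec0])

lemma psim_spec0: "psim \<kappa> lam red t = cmap spec0 (PM t)"
  unfolding psim_def PM_def M_def cmap_simps[OF is_hom_spec0] ..


lemma SK_span:
  assumes "valid u"
  shows "cmul (wd u) (eBl \<kappa> lam) - (\<Sum>t\<in>Std lam. csc (spec0 (cf u t)) (psim \<kappa> lam red t)) \<in> SK \<kappa> lam red"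
proof -
  have "M u - (\<Sum>t\<in>Std lam. csc (cf u t) (PM t)) \<in> KZ"
    using is_cf_cf[OF assms] unfolding is_cf_def eqK_def by blast
  from KZ_SK[OF this] show ?thesis
    unfolding cmap_simps[OF is_hom_spec0] M_def psim_spec0 .
qed

text \<open>The functional that reads off the coefficient of the basis vector of t, given on words
  by the specialised straightening coefficients.\<close>

definition Phi :: "(nat \<times> nat \<Rightarrow> nat) \<Rightarrow> (gen list \<Rightarrow> 'f::comm_ring_1) \<Rightarrow> 'f" where
  "Phi t f = ev id (\<lambda>u. spec0 (cf u t)) f"

interpretation sn: seminormal \<kappa> lam red "to_fract :: int poly \<Rightarrow> int poly fract"
  by unfold_locales (simp_all add: is_hom_to_fract)

lemma fin_supp_SK: "x \<in> SK \<kappa> lam red \<Longrightarrow> fin_supp x"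
proof -
  have "fin_supp (cmap spec0 g)" if "g \<in> dgens" for g
    using fin_valid_fin_supp[OF fin_valid_dgens[OF that]] unfolding fin_supp_def
    by (rule rev_finite_subset) (auto simp: cmap_def spec0_def)
  then show "x \<in> SK \<kappa> lam red \<Longrightarrow> fin_supp x"
    unfolding SK_def spechtgens_spec0 using lideal_fin_supp[of x] fin_supp_qh_rels by blast
qed

text \<open>Every relation and generator over the target ring is the image of one over \<int>[z],
  where \<open>ev_cf_rel\<close> and \<open>ev_cf_gen\<close> hold. So the functional vanishes on
  the left ideal although nothing acts over the target ring.\<close>

lemma Phi_SK:
  assumes "x \<in> SK \<kappa> lam red" "t \<in> Std lam" shows "Phi t x = 0"
  using assms(1) unfolding SK_def
proof (induction rule: lideal.induct)
  case (rel r a b)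
  have fs: "fin_supp a" "fin_supp b" "fin_supp r"
    using rel fin_valid_fin_supp fin_supp_qh_rels by blast+
  have "r \<in> cmap spec0 ` qh_rels n Ib" using rel(1) qh_rels_base_change[OF is_hom_spec0] by metis
  then obtain r0 where r0: "r0 \<in> qh_rels n Ib" "r = cmap spec0 r0" by blast
  have K: "ev id (\<lambda>v. spec0 (cf (u @ v @ w) t)) r = 0" if "a u \<noteq> 0" "b w \<noteq> 0" for u w
  proof -
    have "valid u" "valid w" using rel that by (auto simp: fin_valid_def)
    from sn.ev_cf_rel[OF r0(1) this assms(2)] show ?thesis
      unfolding r0(2) ev_cmap[OF is_hom_spec0 fin_supp_qh_rels[OF r0(1)]] by (simp add: is_hom_simps(1)[OF is_hom_spec0])
  qed
  have "ev id (\<lambda>w. ev id (\<lambda>v. spec0 (cf (u @ v @ w) t)) r) b = 0" if "a u \<noteq> 0" for u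
    by (rule ev_zero[OF is_hom_id]) (rule K[OF that])
  then have Z: "ev id (\<lambda>v. ev id (\<lambda>w. spec0 (cf (u @ v @ w) t)) b) r = 0" if "a u \<noteq> 0" for u
    using that by (subst ev_swap)
  have "Phi t (cmul a (cmul r b)) = ev id (\<lambda>u. ev id (\<lambda>v. ev id (\<lambda>w. spec0 (cf (u @ v @ w) t)) b) r) a"
    unfolding Phi_def by (simp only: ev_cmul[OF is_hom_id] fs fin_supp_cmul)
  also have "\<dots> = 0" by (rule ev_zero[OF is_hom_id]) (rule Z)
  finally show ?case .
next
  case (gen g a)
  obtain g0 where g0: "g0 \<in> dgens" "g = cmap spec0 g0" using gen(1) unfolding spechtgens_spec0 by blast
  have fs0: "fin_supp g0" by (rule fin_valid_fin_supp[OF fin_valid_dgens[OF g0(1)]])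
  have fs: "fin_supp a" using gen(2) by (rule fin_valid_fin_supp)
  have fsg: "fin_supp g" unfolding g0(2) using fs0 unfolding fin_supp_def
    by (rule rev_finite_subset) (auto simp: cmap_def spec0_def)
  have Z: "ev id (\<lambda>v. spec0 (cf (u @ v) t)) g = 0" if "a u \<noteq> 0" for u
  proof -
    have "valid u" using gen(2) that by (auto simp: fin_valid_def)
    from sn.ev_cf_gen[OF g0(1) this assms(2)] show ?thesis
      unfolding g0(2) ev_cmap[OF is_hom_spec0 fs0] by (simp add: is_hom_simps(1)[OF is_hom_spec0])
  qed
  show ?case unfolding Phi_def ev_cmul[OF is_hom_id fs fsg] by (rule ev_zero[OF is_hom_id]) (rule Z)
next
  case (add x y)
  have "fin_supp x" "fin_supp y" using add(1,2) fin_supp_SK unfolding SK_def by blast+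
  then show ?case using add(3,4) unfolding cadd_eq Phi_def by (simp only: ev_add[OF is_hom_id]) simp
qed

lemma fin_supp_PM: "fin_supp (PM t)"
  unfolding PM_def M_def by (intro fin_supp_cmul fin_supp_wd fin_valid_fin_supp[OF fin_valid_eBl])

lemma fin_supp_psim: "fin_supp (psim \<kappa> lam red t)"
  unfolding psim_def by (intro fin_supp_cmul fin_supp_wd fin_valid_fin_supp[OF fin_valid_eBl])

lemma Phi_psim: "s \<in> Std lam \<Longrightarrow> t \<in> Std lam \<Longrightarrow> Phi t (psim \<kappa> lam red s) = of_bool (t = s)"
  unfolding Phi_def psim_spec0 ev_cmap[OF is_hom_spec0 fin_supp_PM] sn.ev_cf_PM
  by (simp add: of_bool_def is_hom_simps(1,2)[OF is_hom_spec0])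

lemma Phi_sum:
  assumes "T \<subseteq> Std lam" "t \<in> T"
  shows "Phi t (\<Sum>s\<in>T. csc (c s) (psim \<kappa> lam red s)) = c t"
proof -
  have T: "finite T" using assms(1) finite_Std finite_subset by blast
  have "Phi t (\<Sum>s\<in>T. csc (c s) (psim \<kappa> lam red s)) = (\<Sum>s\<in>T. c s * Phi t (psim \<kappa> lam red s))"
    unfolding Phi_def by (simp add: ev_sum[OF is_hom_id] ev_csc[OF is_hom_id] fin_supp_psim)
  also have "\<dots> = (\<Sum>s\<in>T. c s * of_bool (t = s))"
    using assms by (intro sum.cong refl arg_cong2[where f = "(*)"] Phi_psim) auto
  finally show ?thesis using T assms(2) by (simp add: of_bool_def if_distrib cong: if_cong)
qed

lemma psim_independent:
  assumes "T \<subseteq> Std lam" "(\<Sum>s\<in>T. csc (c s) (psim \<kappa> lam red s)) \<in> SK \<kappa> lam red" "t \<in> T"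
  shows "c t = 0"
  using Phi_SK[OF assms(2), of t] Phi_sum[OF assms(1,3), of c] assms(1,3) by auto

section \<open>Spanning over the integral form, and graded dimensions\<close>

lemma SK_sum: "(\<And>i. i \<in> I \<Longrightarrow> F i \<in> SK \<kappa> lam red) \<Longrightarrow> sum F I \<in> SK \<kappa> lam red"
  and SK_csc: "x \<in> SK \<kappa> lam red \<Longrightarrow> csc a x \<in> SK \<kappa> lam red"
  unfolding SK_def by (auto intro: lideal_sum[OF qh_rels_nonempty] lideal_csc[OF qh_rels_nonempty])

text \<open>The straightening coefficients are images of integers, so a combination of words over
  the integral domain has coefficients in that domain again, although \<open>SK\<close> is formed
  over its fraction field.\<close>

lemma fract_span:
  fixes f :: "gen list \<Rightarrow> 'k::idom"
  assumes f: "fin_valid n Ib f"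
  shows "\<exists>c. cmul (cmap to_fract f) (eBl \<kappa> lam) - (\<Sum>t\<in>Std lam. csc (to_fract (c t)) (psim \<kappa> lam red t))
    \<in> SK \<kappa> lam red"
proof -
  let ?U = "{u. f u \<noteq> 0}"
  let ?F = "\<lambda>u. csc (to_fract (f u)) (cmul (wd u) (eBl \<kappa> lam) - (\<Sum>t\<in>Std lam. csc (spec0 (cf u t)) (psim \<kappa> lam red t)))
    :: gen list \<Rightarrow> 'k fract"
  define c where "c t = (\<Sum>u\<in>?U. f u * spec0 (cf u t))" for t
  have "(\<Sum>u\<in>?U. ?F u) \<in> SK \<kappa> lam red"
    using f by (intro SK_sum SK_csc SK_span) (auto simp: fin_valid_def)
  moreover have "cmap to_fract f = (\<Sum>u\<in>?U. csc (to_fract (f u)) (wd u))"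
    using arg_cong[OF fin_supp_expand[OF fin_valid_fin_supp[OF f]], of "cmap to_fract"]
    unfolding cmap_simps[OF is_hom_to_fract] .
  moreover have "to_fract (c t) = (\<Sum>u\<in>?U. to_fract (f u) * spec0 (cf u t))" for t
    unfolding c_def is_hom_simps(7)[OF is_hom_to_fract]
    by (simp add: is_hom_simps(4)[OF is_hom_to_fract] spec0_def is_hom_of_int[OF is_hom_to_fract])
  ultimately have "cmul (cmap to_fract f) (eBl \<kappa> lam) - (\<Sum>t\<in>Std lam. csc (to_fract (c t)) (psim \<kappa> lam red t)) \<in> SK \<kappa> lam red"
    unfolding csc_diff csc_sum csc_simps sum_subtractf cmul_sum cmul_csc
    by (simp only: csc_sum cmul_sum cmul_csc sum.swap[of _ "Std lam"])
  then show ?thesis by blast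
qed

text \<open>A word has coefficients homogeneous of its own degree minus that of the basis vector. At
  z = 0 only degree 0 is left, so just the tableaux of the same degree and residue sequence
  remain.\<close>

lemma gpiece_span:
  assumes "b \<in> gpiece \<kappa> lam \<nu> d"
  shows "\<exists>m. b - (\<Sum>t | t \<in> Std lam \<and> resseq \<kappa> lam t = \<nu> \<and> tdeg \<kappa> lam t = d. csc (m t) (psim \<kappa> lam red t))
    \<in> SK \<kappa> lam red"
proof -
  obtain u j where u: "b = cmul (wd u) (eBl \<kappa> lam)" "valid u" "wtrace u (nu0 \<kappa> lam) = Some (\<nu>, j)"
    "j + tdeg \<kappa> lam (tlam lam) = d" using assms unfolding gpiece_def by blast
  let ?T = "{t \<in> Std lam. resseq \<kappa> lam t = \<nu> \<and> tdeg \<kappa> lam t = d}"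
  have "csc (spec0 (cf u t)) (psim \<kappa> lam red t) = (0 :: gen list \<Rightarrow> 'a)" if t: "t \<in> Std lam - ?T" for t
  proof (rule ccontr)
    assume "csc (spec0 (cf u t)) (psim \<kappa> lam red t) \<noteq> (0 :: gen list \<Rightarrow> 'a)"
    then have s: "spec0 (cf u t) \<noteq> (0::'a)" by auto
    have c: "cf u t \<in> mono_deg (j - relative_degree t)" "cf u t \<noteq> 0 \<longrightarrow> resseq \<kappa> lam t = \<nu>"
      using is_cf_cf[OF u(2)] t u(3) unfolding is_cf_def by blast+
    show False using spec0_mono_deg[OF c(1) s] c(2) t u(4) by (auto simp: relative_degree_def)
  qed
  then have e: "(\<Sum>t\<in>Std lam. csc (spec0 (cf u t)) (psim \<kappa> lam red t)) = (\<Sum>t\<in>?T. csc (spec0 (cf u t)) (psim \<kappa> lam red t) :: gen list \<Rightarrow> 'a)"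
    by (intro sum.mono_neutral_right) auto
  have "b - (\<Sum>t\<in>?T. csc (spec0 (cf u t)) (psim \<kappa> lam red t)) \<in> SK \<kappa> lam red"
    using SK_span[OF u(2), where ?'a = 'a] unfolding u(1) e .
  then show ?thesis by (rule exI[where x = "\<lambda>t. spec0 (cf u t)"])
qed

lemma psim_gpiece:
  assumes "t \<in> Std lam" shows "psim \<kappa> lam red t \<in> gpiece \<kappa> lam (resseq \<kappa> lam t) (tdeg \<kappa> lam t)"
  unfolding gpiece_def psim_def mem_Collect_eq using psiw_red_valid[OF assms] wtrace_psiw_red[OF assms]
  by (intro exI conjI refl) (auto simp: relative_degree_def)

lemma inj_on_psim: "inj_on (psim \<kappa> lam red :: _ \<Rightarrow> gen list \<Rightarrow> 'a::comm_ring_1) (Std lam)"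
proof (rule inj_onI)
  fix s t assume st: "s \<in> Std lam" "t \<in> Std lam"
    and e: "(psim \<kappa> lam red s :: gen list \<Rightarrow> 'a) = psim \<kappa> lam red t"
  have "Phi t (psim \<kappa> lam red s :: gen list \<Rightarrow> 'a) = 1" unfolding e by (simp add: Phi_psim st)
  then show "s = t" using Phi_psim[OF st, where ?'a = 'a] by (auto simp: of_bool_def split: if_splits)
qed

text \<open>The \<psi>-vectors in the piece are independent and give the lower bound. More than N
  elements of the piece expand in N vectors modulo K, so
  \<open>homogeneous_system_nontrivial\<close> makes them dependent.\<close>

lemma gpiece_dimension:
  fixes \<nu> d
  defines "N \<equiv> card {t \<in> Std lam. resseq \<kappa> lam t = \<nu> \<and> tdeg \<kappa> lam t = d}"
    and "V \<equiv> (gpiece \<kappa> lam \<nu> d :: (gen list \<Rightarrow> 'f::field) set)"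
    and "K \<equiv> (SK \<kappa> lam red :: (gen list \<Rightarrow> 'f) set)"
  shows "\<exists>B\<subseteq>V. finite B \<and> indep_mod K B \<and> card B = N"
    and "B \<subseteq> V \<Longrightarrow> finite B \<Longrightarrow> indep_mod K B \<Longrightarrow> card B \<le> N"
proof -
  let ?T = "{t \<in> Std lam. resseq \<kappa> lam t = \<nu> \<and> tdeg \<kappa> lam t = d}"
  let ?p = "psim \<kappa> lam red :: _ \<Rightarrow> gen list \<Rightarrow> 'f"
  have inj: "inj_on ?p ?T" by (rule inj_on_subset[OF inj_on_psim]) auto
  have fT: "finite ?T" by simp
  show "\<exists>B\<subseteq>V. finite B \<and> indep_mod K B \<and> card B = N"
  proof (intro exI[of _ "?p ` ?T"] conjI)
    show "?p ` ?T \<subseteq> V" unfolding V_def using psim_gpiece by auto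
    show "card (?p ` ?T) = N" unfolding N_def by (rule card_image[OF inj])
    show "indep_mod K (?p ` ?T)" unfolding indep_mod_def csum_eq sum.reindex[OF inj] o_def K_def
    proof (intro allI impI ballI)
      fix c b
      assume c: "(\<Sum>t\<in>?T. csc (c (?p t)) (?p t)) \<in> SK \<kappa> lam red" and "b \<in> ?p ` ?T"
      then obtain t where t: "t \<in> ?T" "b = ?p t" by auto
      show "c b = 0" unfolding t(2) by (rule psim_independent[OF _ c t(1)]) auto
    qed
  qed simp
  show "card B \<le> N" if B: "B \<subseteq> V" "finite B" "indep_mod K B"
  proof (rule ccontr)
    assume "\<not> card B \<le> N"
    then have lt: "card ?T < card B" by (simp add: N_def)
    have "\<forall>b\<in>B. \<exists>m. b - (\<Sum>t\<in>?T. csc (m t) (?p t)) \<in> K"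
      using B(1) gpiece_span unfolding V_def K_def by blast
    from bchoice[OF this] obtain m where m: "\<forall>b\<in>B. b - (\<Sum>t\<in>?T. csc (m b t) (?p t)) \<in> K" ..
    from homogeneous_system_nontrivial[OF fT B(2) lt, of m]
    obtain c where c: "\<exists>b\<in>B. c b \<noteq> 0" "\<forall>t\<in>?T. (\<Sum>b\<in>B. c b * m b t) = 0" by (elim exE conjE)
    have "(\<Sum>b\<in>B. csc (c b) (b - (\<Sum>t\<in>?T. csc (m b t) (?p t)))) \<in> K"
      unfolding K_def by (intro SK_sum SK_csc) (rule m[unfolded K_def, rule_format])
    moreover have "(\<Sum>b\<in>B. csc (c b) (\<Sum>t\<in>?T. csc (m b t) (?p t))) = 0"
    proof -
      have "(\<Sum>b\<in>B. csc (c b) (\<Sum>t\<in>?T. csc (m b t) (?p t))) = (\<Sum>t\<in>?T. \<Sum>b\<in>B. csc (c b * m b t) (?p t))"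
        unfolding csc_sum csc_simps by (rule sum.swap)
      also have "\<dots> = 0" unfolding csc_sum(2)[symmetric] by (rule sum.neutral) (intro ballI, simp only: bspec[OF c(2)] csc_simps)
      finally show ?thesis .
    qed
    ultimately have "csum B (\<lambda>b. csc (c b) b) \<in> K"
      unfolding csum_eq csc_diff sum_subtractf by (simp only: diff_zero)
    then show False using B(3) c(1) unfolding indep_mod_def by blast
  qed
qed

end

theorem mainTheorem1:
  fixes lam :: "nat list" and \<kappa> :: int and red :: "(nat \<Rightarrow> nat) \<Rightarrow> nat list"
  assumes "is_partition lam"
    and "\<forall>w. isperm (sum_list lam) w \<longrightarrow> is_reduced (sum_list lam) (red w) w"
  shows
   "(\<forall>c :: (nat \<times> nat \<Rightarrow> nat) \<Rightarrow> 'k::idom.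
        csum (Std lam) (\<lambda>t. csc (to_fract (c t)) (psim \<kappa> lam red t)) \<in> SK \<kappa> lam red
          \<longrightarrow> (\<forall>t\<in>Std lam. c t = 0))
  \<and> (\<forall>f :: gen list \<Rightarrow> 'k. fin_valid (sum_list lam) (Ibeta \<kappa> lam) f \<longrightarrow>
        (\<exists>c :: (nat \<times> nat \<Rightarrow> nat) \<Rightarrow> 'k.
           csub (cmul (cmap to_fract f) (eBl \<kappa> lam))
                (csum (Std lam) (\<lambda>t. csc (to_fract (c t)) (psim \<kappa> lam red t)))
             \<in> SK \<kappa> lam red))
  \<and> (\<forall>\<nu> d. let N = card {t \<in> Std lam. resseq \<kappa> lam t = \<nu> \<and> tdeg \<kappa> lam t = d};
              V = (gpiece \<kappa> lam \<nu> d :: (gen list \<Rightarrow> 'f::field) set);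
              K = (SK \<kappa> lam red :: (gen list \<Rightarrow> 'f) set) in
        (\<exists>B\<subseteq>V. finite B \<and> indep_mod K B \<and> card B = N)
        \<and> (\<forall>B\<subseteq>V. finite B \<longrightarrow> indep_mod K B \<longrightarrow> card B \<le> N))"
proof -
  interpret specht \<kappa> lam red using assms by unfold_locales
  show ?thesis
    unfolding Let_def csum_eq csub_eq
  proof (intro conjI allI impI ballI)
    fix c :: "_ \<Rightarrow> 'k" and t
    assume "(\<Sum>t\<in>Std lam. csc (to_fract (c t)) (psim \<kappa> lam red t)) \<in> SK \<kappa> lam red" "t \<in> Std lam"
    from psim_independent[OF order_refl this] show "c t = 0" by simp
  next
    fix f :: "gen list \<Rightarrow> 'k"
    assume "fin_valid n Ib f"
    then show "\<exists>c. cmul (cmap to_fract f) (eBl \<kappa> lam) - (\<Sum>t\<in>Std lam. csc (to_fract (c t)) (psim \<kappa> lam red t))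
      \<in> SK \<kappa> lam red" by (rule fract_span)
  qed (rule gpiece_dimension; assumption)+
qed

end
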